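(* Let $p$ be a prime, let $X_{p,\sigma}$ and $X_{p,\sigma'}$ be supersingular $K3$ surfaces in characteristic $p$ with Artin invariants $\sigma$ and $\sigma'=11-\sigma$. Suppose that a genus one fibration $\phi:X_{p,\sigma}\to\mathbb{P}^1$ is a Jacobian fibration (that is, admits a section), and let $\phi':X_{p,\sigma'}\to\mathbb{P}^1$ be a genus one fibration such that $[\phi']\in\mathbb{E}(X_{p,\sigma'})$ corresponds to $[\phi]\in\mathbb{E}(X_{p,\sigma})$ under the canonical one-to-one correspondence between $\mathbb{E}(X_{p,\sigma})$ and $\mathbb{E}(X_{p,\sigma'})$. Then $\phi'$ does not admit a section.
   Context: A $K3$ surface over an algebraically closed field of characteristic $p>0$ is supersingular if its Néron-Severi lattice $S_X$ has rank $22$; then $S_X^{\vee}/S_X\cong(\mathbb{Z}/p)^{2\sigma}$ with $1\le\sigma\le10$, and $\sigma$ is the Artin invariant. Write $S_{p,\sigma}$ for the Néron-Severi lattice of $X_{p,\sigma}$ (its isomorphism class depends only on $p,\sigma$). For a $K3$ surface $Y$ and a genus one fibration $\phi:Y\to\mathbb{P}^1$ (elliptic or quasi-elliptic), $f_\phi\in S_Y$ denotes the class of a fiber. $\mathrm{O}^+(S_Y)$ is the group of isometries of $S_Y$ preserving a positive cone, acting from the right. Two genus one fibrations $\phi,\psi$ on $Y$ are lattice equivalent if there is $g\in \mathrm{O}^+(S_Y)$ with $f_\phi^g=f_\psi$. $\mathbb{E}(Y)$ is the set of lattice equivalence classes $[\phi]$ of genus one fibrations on $Y$. The canonical correspondence: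 when $\sigma+\sigma'=11$ there is an embedding of $\mathbb{Z}$-modules $j:S_{p,\sigma}\hookrightarrow S_{p,\sigma'}$ whose $\mathbb{Q}$-linear extension restricts to an isomorphism of lattices $S_{p,\sigma}^{\vee}(p)\cong S_{p,\sigma'}$, where $L(p)$ denotes $L$ with the bilinear form multiplied by $p$; $j$ is unique up to composition with elements of $\mathrm{O}(S_{p,\sigma'})$. Classes $[\phi]\in\mathbb{E}(X_{p,\sigma})$ and $[\phi']\in\mathbb{E}(X_{p,\sigma'})$ correspond if and only if $j(f_\phi)^g\in\mathbb{Q}^{\times}f_{\phi'}$ for some $g\in\mathrm{O}(S_{p,\sigma'})$; this is a bijection independent of the choice of $j$. *)

theory Defs
  imports
    "HOL-Analysis.Analysis"
    "HOL-Computational_Algebra.Computational_Algebra"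
    "HOL-Algebra.Product_Groups"
    "HOL-Algebra.Elementary_Groups"
begin

section \<open>Projective varieties over an algebraically closed field\<close>

text \<open>
  Varieties are treated classically (Hartshorne, Chapter I): closed points of an irreducible closed
  subset of projective space, with the sheaf of regular functions realised by functions with values
  in the base field. The projective space with homogeneous coordinates indexed by the finite type
  \<open>'n\<close> has dimension \<open>CARD('n) - 1\<close>; its points are the punctured lines in \<open>'k ^ 'n\<close>.
\<close>

type_synonym ('k, 'n) ppoint = "('k ^ 'n) set"
type_synonym ('k, 'n) pfun = "('k, 'n) ppoint \<Rightarrow> 'k"

definition proj_space :: "('k::field, 'n::finite) ppoint set" where
  "proj_space = {{c *s v | c. c \<noteq> 0} | v. v \<noteq> 0}"

text \<open>Homogeneous polynomials of degree \<open>d\<close>, identified with the functions they define; this is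
  harmless because the base field will be infinite.\<close>

definition form :: "nat \<Rightarrow> ('k::field ^ 'n::finite \<Rightarrow> 'k) set" where
  "form d = {F. \<exists>c. F = (\<lambda>v. \<Sum>m | (\<Sum>i\<in>UNIV. m i) = d. c m * (\<Prod>i\<in>UNIV. v $ i ^ m i))}"

definition zariski :: "('k::field, 'n::finite) ppoint topology" where
  "zariski = topology_generated_by
     {{P \<in> proj_space. \<forall>v\<in>P. F v \<noteq> 0} | F. \<exists>d. F \<in> form d}"

abbreviation ztop :: "('k::field, 'n::finite) ppoint set \<Rightarrow> ('k, 'n) ppoint topology" where
  "ztop X \<equiv> subtopology zariski X"

definition irreducible_closed :: "('k::field, 'n::finite) ppoint set \<Rightarrow> bool" where
  "irreducible_closed Z \<longleftrightarrow> closedin zariski Z \<and> Z \<noteq> {} \<and>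
     (\<forall>A B. closedin zariski A \<and> closedin zariski B \<and> Z \<subseteq> A \<union> B \<longrightarrow> Z \<subseteq> A \<or> Z \<subseteq> B)"

abbreviation projective_variety :: "('k::field, 'n::finite) ppoint set \<Rightarrow> bool" where
  "projective_variety X \<equiv> irreducible_closed X"

definition irreducible_chain :: "('k::field, 'n::finite) ppoint set \<Rightarrow> nat \<Rightarrow> bool" where
  "irreducible_chain X d \<longleftrightarrow> (\<exists>Z :: nat \<Rightarrow> ('k, 'n) ppoint set.
     (\<forall>i\<le>d. irreducible_closed (Z i) \<and> Z i \<subseteq> X) \<and> (\<forall>i<d. Z i \<subset> Z (Suc i)))"

definition zariski_dim :: "('k::field, 'n::finite) ppoint set \<Rightarrow> nat \<Rightarrow> bool" where
  "zariski_dim X d \<longleftrightarrow> irreducible_chain X d \<and> \<not> irreducible_chain X (Suc d)"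

text \<open>A property holds near \<open>P\<close> if it holds on a Zariski neighbourhood of \<open>P\<close> in \<open>X\<close>.\<close>

abbreviation near :: "('k::field, 'n::finite) ppoint set \<Rightarrow> ('k, 'n) ppoint \<Rightarrow> ('k, 'n) ppoint filter" where
  "near X P \<equiv> nhdsin (ztop X) P"

text \<open>The functions that are regular at \<open>P\<close>; modulo agreement near \<open>P\<close> they form the local
  ring of \<open>X\<close> at \<open>P\<close>. Subsets of this local ring are represented by sets of
  functions closed under agreement near \<open>P\<close>.\<close>

definition regular_at :: "('k::field, 'n::finite) ppoint set \<Rightarrow> ('k, 'n) ppoint \<Rightarrow> ('k, 'n) pfun \<Rightarrow> bool" where
  "regular_at X P f \<longleftrightarrow> P \<in> X \<and> (\<exists>d. \<exists>G\<in>form d. \<exists>H\<in>form d.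
     \<forall>\<^sub>F Q in near X P. \<forall>v\<in>Q. H v \<noteq> 0 \<and> f Q = G v / H v)"

definition regular_on :: "('k::field, 'n::finite) ppoint set \<Rightarrow> ('k, 'n) ppoint set \<Rightarrow> ('k, 'n) pfun \<Rightarrow> bool" where
  "regular_on X U f \<longleftrightarrow> (\<forall>P\<in>U. regular_at X P f)"

definition morphism ::
  "('k::field, 'n::finite) ppoint set \<Rightarrow> ('k, 'm::finite) ppoint set \<Rightarrow>
   (('k, 'n) ppoint \<Rightarrow> ('k, 'm) ppoint) \<Rightarrow> bool" where
  "morphism X Y f \<longleftrightarrow> continuous_map (ztop X) (ztop Y) f \<and>
     (\<forall>V h. openin (ztop Y) V \<and> regular_on Y V h \<longrightarrow> regular_on X {P \<in> X. f P \<in> V} (h \<circ> f))"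

definition ideal_at ::
  "('k::field, 'n::finite) ppoint set \<Rightarrow> ('k, 'n) ppoint \<Rightarrow> ('k, 'n) pfun set \<Rightarrow> ('k, 'n) pfun set" where
  "ideal_at X P G = {h. regular_at X P h \<and> (\<exists>A c. finite A \<and> A \<subseteq> G \<and>
     (\<forall>g\<in>A. regular_at X P (c g)) \<and> (\<forall>\<^sub>F Q in near X P. h Q = (\<Sum>g\<in>A. c g Q * g Q)))}"

definition max_ideal :: "('k::field, 'n::finite) ppoint set \<Rightarrow> ('k, 'n) ppoint \<Rightarrow> ('k, 'n) pfun set" where
  "max_ideal X P = {f. regular_at X P f \<and> f P = 0}"

text \<open>\<open>quotient_dim V W n\<close>: the quotient of the function space \<open>V\<close> by its subspace
  \<open>W\<close> is finite-dimensional, of dimension \<open>n\<close>.\<close>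

definition quotient_dim :: "('a \<Rightarrow> 'k::field) set \<Rightarrow> ('a \<Rightarrow> 'k) set \<Rightarrow> nat \<Rightarrow> bool" where
  "quotient_dim V W n \<longleftrightarrow> (\<exists>B. B \<subseteq> V \<and> finite B \<and> card B = n \<and>
     (\<forall>f\<in>V. \<exists>c. (\<lambda>x. f x - (\<Sum>g\<in>B. c g * g x)) \<in> W) \<and>
     (\<forall>c. (\<lambda>x. \<Sum>g\<in>B. c g * g x) \<in> W \<longrightarrow> (\<forall>g\<in>B. c g = 0)))"

text \<open>A surface; nonsingularity says that every local ring is regular, i.e. that all Zariski
  cotangent spaces have dimension 2.\<close>

definition nonsingular_surface :: "('k::field, 'n::finite) ppoint set \<Rightarrow> bool" where
  "nonsingular_surface X \<longleftrightarrow> projective_variety X \<and> zariski_dim X 2 \<and>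
     (\<forall>P\<in>X. quotient_dim (max_ideal X P)
        (ideal_at X P {(\<lambda>Q. f Q * g Q) | f g. f \<in> max_ideal X P \<and> g \<in> max_ideal X P}) 2)"


section \<open>Structure sheaf cohomology and 2-forms\<close>

text \<open>The first Cech cohomology of the structure sheaf with respect to the standard affine cover
  by the sets where one homogeneous coordinate does not vanish.\<close>

definition std_chart :: "('k::field, 'n::finite) ppoint set \<Rightarrow> 'n \<Rightarrow> ('k, 'n) ppoint set" where
  "std_chart X i = {P \<in> X. \<forall>v\<in>P. v $ i \<noteq> 0}"

definition cech_cocycles :: "('k::field, 'n::finite) ppoint set \<Rightarrow> ('n \<times> 'n \<times> ('k, 'n) ppoint \<Rightarrow> 'k) set" where
  "cech_cocycles X = {g.
     (\<forall>i j. regular_on X (std_chart X i \<inter> std_chart X j) (\<lambda>P. g (i, j, P))) \<and>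
     (\<forall>i j l. \<forall>P \<in> std_chart X i \<inter> std_chart X j \<inter> std_chart X l.
        g (i, l, P) = g (i, j, P) + g (j, l, P))}"

definition cech_coboundaries :: "('k::field, 'n::finite) ppoint set \<Rightarrow> ('n \<times> 'n \<times> ('k, 'n) ppoint \<Rightarrow> 'k) set" where
  "cech_coboundaries X = {g. \<exists>h. (\<forall>i. regular_on X (std_chart X i) (h i)) \<and>
     (\<forall>i j. \<forall>P \<in> std_chart X i \<inter> std_chart X j. g (i, j, P) = h j P - h i P)}"

definition h1_structure_sheaf :: "('k::field, 'n::finite) ppoint set \<Rightarrow> nat \<Rightarrow> bool" where
  "h1_structure_sheaf X n \<longleftrightarrow> quotient_dim (cech_cocycles X) (cech_coboundaries X) n"

text \<open>Tangent vectors at \<open>P\<close> are the point derivations of the local ring. A 2-form assigns to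
  each point an alternating form on its tangent space; it is regular if it is locally of the shape
  \<open>\<Sum> g\<^sub>i du\<^sub>i \<and> dv\<^sub>i\<close> with regular functions (Shafarevich III.5).\<close>

definition tangent_vector ::
  "('k::field, 'n::finite) ppoint set \<Rightarrow> ('k, 'n) ppoint \<Rightarrow> (('k, 'n) pfun \<Rightarrow> 'k) \<Rightarrow> bool" where
  "tangent_vector X P \<delta> \<longleftrightarrow>
     (\<forall>f g. regular_at X P f \<and> regular_at X P g \<longrightarrow>
        ((\<forall>\<^sub>F Q in near X P. f Q = g Q) \<longrightarrow> \<delta> f = \<delta> g) \<and>
        \<delta> (\<lambda>Q. f Q + g Q) = \<delta> f + \<delta> g \<and>
        \<delta> (\<lambda>Q. f Q * g Q) = f P * \<delta> g + g P * \<delta> f) \<and>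
     (\<forall>c f. regular_at X P f \<longrightarrow> \<delta> (\<lambda>Q. c * f Q) = c * \<delta> f)"

definition regular_2form ::
  "('k::field, 'n::finite) ppoint set \<Rightarrow>
   (('k, 'n) ppoint \<Rightarrow> (('k, 'n) pfun \<Rightarrow> 'k) \<Rightarrow> (('k, 'n) pfun \<Rightarrow> 'k) \<Rightarrow> 'k) \<Rightarrow> bool" where
  "regular_2form X \<omega> \<longleftrightarrow> (\<forall>P\<in>X. \<exists>U. openin (ztop X) U \<and> P \<in> U \<and>
     (\<exists>(m::nat) g u v.
        (\<forall>i<m. regular_on X U (g i) \<and> regular_on X U (u i) \<and> regular_on X U (v i)) \<and>
        (\<forall>Q\<in>U. \<forall>\<delta> \<epsilon>. tangent_vector X Q \<delta> \<and> tangent_vector X Q \<epsilon> \<longrightarrow>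
           \<omega> Q \<delta> \<epsilon> = (\<Sum>i<m. g i Q * (\<delta> (u i) * \<epsilon> (v i) - \<epsilon> (u i) * \<delta> (v i))))))"

text \<open>For a nonsingular surface, a nowhere vanishing regular 2-form is a trivialisation of the
  canonical bundle.\<close>

definition trivial_canonical_bundle :: "('k::field, 'n::finite) ppoint set \<Rightarrow> bool" where
  "trivial_canonical_bundle X \<longleftrightarrow> (\<exists>\<omega>. regular_2form X \<omega> \<and>
     (\<forall>P\<in>X. \<exists>\<delta> \<epsilon>. tangent_vector X P \<delta> \<and> tangent_vector X P \<epsilon> \<and> \<omega> P \<delta> \<epsilon> \<noteq> 0))"

definition K3_surface :: "('k::alg_closed_field, 'n::finite) ppoint set \<Rightarrow> bool" where
  "K3_surface X \<longleftrightarrow> nonsingular_surface X \<and> trivial_canonical_bundle X \<and> h1_structure_sheaf X 0"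


section \<open>Divisors and intersection numbers\<close>

text \<open>Rational functions on a variety are represented by functions that are regular at some
  point (hence on a dense open subset), two of them being identified if they agree on a nonempty
  open subset.\<close>

definition generically :: "('k::field, 'n::finite) ppoint set \<Rightarrow> (('k, 'n) ppoint \<Rightarrow> bool) \<Rightarrow> bool" where
  "generically X R \<longleftrightarrow> (\<exists>U. openin (ztop X) U \<and> U \<noteq> {} \<and> (\<forall>Q\<in>U. R Q))"

definition nonzero_rational :: "('k::field, 'n::finite) ppoint set \<Rightarrow> ('k, 'n) pfun \<Rightarrow> bool" where
  "nonzero_rational X f \<longleftrightarrow> (\<exists>P. regular_at X P f) \<and> generically X (\<lambda>Q. f Q \<noteq> 0)"

text \<open>The coset of \<open>f\<close> modulo the units of the local ring at \<open>P\<close>.\<close>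

definition unit_coset ::
  "('k::field, 'n::finite) ppoint set \<Rightarrow> ('k, 'n) ppoint \<Rightarrow> ('k, 'n) pfun \<Rightarrow> ('k, 'n) pfun set" where
  "unit_coset X P f = {g. nonzero_rational X g \<and>
     (\<exists>u. regular_at X P u \<and> u P \<noteq> 0 \<and> generically X (\<lambda>Q. g Q = u Q * f Q))}"

text \<open>A Cartier divisor is given by its set of local equations at each point; on a nonsingular
  variety Cartier and Weil divisors coincide.\<close>

type_synonym ('k, 'n) divisor = "('k, 'n) ppoint \<Rightarrow> ('k, 'n) pfun set"

definition divisors :: "('k::field, 'n::finite) ppoint set \<Rightarrow> ('k, 'n) divisor set" where
  "divisors X = {D. (\<forall>P. P \<notin> X \<longrightarrow> D P = {}) \<and>
     (\<forall>P\<in>X. \<exists>U f. openin (ztop X) U \<and> P \<in> U \<and> nonzero_rational X f \<and>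
        (\<forall>Q\<in>U. D Q = unit_coset X Q f))}"

definition div_plus ::
  "('k::field, 'n::finite) ppoint set \<Rightarrow> ('k, 'n) divisor \<Rightarrow> ('k, 'n) divisor \<Rightarrow> ('k, 'n) divisor" where
  "div_plus X D E = (\<lambda>P. \<Union>f\<in>D P. \<Union>g\<in>E P. unit_coset X P (\<lambda>Q. f Q * g Q))"

definition principal_divisor ::
  "('k::field, 'n::finite) ppoint set \<Rightarrow> ('k, 'n) pfun \<Rightarrow> ('k, 'n) divisor" where
  "principal_divisor X f = (\<lambda>P. if P \<in> X then unit_coset X P f else {})"

definition linearly_equivalent ::
  "('k::field, 'n::finite) ppoint set \<Rightarrow> ('k, 'n) divisor \<Rightarrow> ('k, 'n) divisor \<Rightarrow> bool" where
  "linearly_equivalent X D E \<longleftrightarrow>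
     (\<exists>f. nonzero_rational X f \<and> D = div_plus X E (principal_divisor X f))"

definition effective :: "('k::field, 'n::finite) ppoint set \<Rightarrow> ('k, 'n) divisor \<Rightarrow> bool" where
  "effective X D \<longleftrightarrow> D \<in> divisors X \<and> (\<forall>P\<in>X. \<exists>f\<in>D P. regular_at X P f)"

definition support :: "('k::field, 'n::finite) ppoint set \<Rightarrow> ('k, 'n) divisor \<Rightarrow> ('k, 'n) ppoint set" where
  "support X D = {P \<in> X. \<not> (\<exists>f\<in>D P. regular_at X P f \<and> f P \<noteq> 0)}"

definition local_intersection ::
  "('k::field, 'n::finite) ppoint set \<Rightarrow> ('k, 'n) divisor \<Rightarrow> ('k, 'n) divisor \<Rightarrow> ('k, 'n) ppoint \<Rightarrow> nat" where
  "local_intersection X D E P = (THE n. \<exists>f\<in>D P. \<exists>g\<in>E P. regular_at X P f \<and> regular_at X P g \<and>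
     quotient_dim {h. regular_at X P h} (ideal_at X P {f, g}) n)"

text \<open>The intersection pairing on a nonsingular projective surface is the unique pairing with the
  following properties (Hartshorne, Theorem V.1.1 and Proposition V.1.4). On such a surface two
  effective divisors have no common component if and only if their supports have finite
  intersection.\<close>

definition intersection_pairing ::
  "('k::field, 'n::finite) ppoint set \<Rightarrow> (('k, 'n) divisor \<Rightarrow> ('k, 'n) divisor \<Rightarrow> int) \<Rightarrow> bool" where
  "intersection_pairing X I \<longleftrightarrow>
     (\<forall>D\<in>divisors X. \<forall>E\<in>divisors X. I D E = I E D) \<and>
     (\<forall>D\<in>divisors X. \<forall>D'\<in>divisors X. \<forall>E\<in>divisors X. I (div_plus X D D') E = I D E + I D' E) \<and>
     (\<forall>D\<in>divisors X. \<forall>D'\<in>divisors X. \<forall>E\<in>divisors X.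
        linearly_equivalent X D D' \<longrightarrow> I D E = I D' E) \<and>
     (\<forall>D E. effective X D \<and> effective X E \<and> finite (support X D \<inter> support X E) \<longrightarrow>
        I D E = (\<Sum>P \<in> support X D \<inter> support X E. int (local_intersection X D E P)))"

definition numerically_equivalent ::
  "('k::field, 'n::finite) ppoint set \<Rightarrow> (('k, 'n) divisor \<Rightarrow> ('k, 'n) divisor \<Rightarrow> int) \<Rightarrow>
   ('k, 'n) divisor \<Rightarrow> ('k, 'n) divisor \<Rightarrow> bool" where
  "numerically_equivalent X I D E \<longleftrightarrow> (\<forall>C\<in>divisors X. I D C = I E C)"


section \<open>Lattices\<close>

text \<open>A lattice \<open>S\<close> with integer-valued form \<open>b\<close> is realised inside the real vector space
  \<open>S \<otimes> \<real>\<close>, modelled by a Euclidean space whose inner product plays no role; moreover \<open>b\<close> denotes the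
  real extension of the form. The rank of \<open>S\<close> is \<open>dim S\<close>. For nondegenerate \<open>b\<close> the dual lattice
  is automatically contained in \<open>S \<otimes> \<rat>\<close>.\<close>

definition full_lattice :: "'v::euclidean_space set \<Rightarrow> bool" where
  "full_lattice S \<longleftrightarrow> (\<exists>B. independent B \<and> span B = UNIV \<and>
     S = {\<Sum>x\<in>B. of_int (c x) *\<^sub>R x | c :: 'v \<Rightarrow> int. True})"

definition dual_lattice :: "'v::euclidean_space set \<Rightarrow> ('v \<Rightarrow> 'v \<Rightarrow> real) \<Rightarrow> 'v set" where
  "dual_lattice S b = {x. \<forall>y\<in>S. b x y \<in> \<int>}"

text \<open>The isometry group, each isometry being given by its linear extension.\<close>

definition isometries :: "'v::euclidean_space set \<Rightarrow> ('v \<Rightarrow> 'v \<Rightarrow> real) \<Rightarrow> ('v \<Rightarrow> 'v) set" where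
  "isometries S b = {g. linear g \<and> g ` S = S \<and> (\<forall>x y. b (g x) (g y) = b x y)}"

definition positive_isometries :: "'v::euclidean_space set \<Rightarrow> ('v \<Rightarrow> 'v \<Rightarrow> real) \<Rightarrow> ('v \<Rightarrow> 'v) set" where
  "positive_isometries S b = {g \<in> isometries S b. \<exists>C \<in> components {x. b x x > 0}. g ` C = C}"

definition additive_group :: "'v::ab_group_add set \<Rightarrow> 'v monoid" where
  "additive_group A = \<lparr>carrier = A, monoid.mult = (+), one = 0\<rparr>"

text \<open>\<open>\<sigma>\<close> is the Artin invariant: the discriminant group is an elementary abelian group of
  rank \<open>2\<sigma>\<close>.\<close>

definition artin_invariant :: "nat \<Rightarrow> 'v::euclidean_space set \<Rightarrow> ('v \<Rightarrow> 'v \<Rightarrow> real) \<Rightarrow> nat \<Rightarrow> bool" where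
  "artin_invariant p S b \<sigma> \<longleftrightarrow>
     additive_group (dual_lattice S b) Mod S \<cong> product_group {..<2 * \<sigma>} (\<lambda>_. integer_mod_group p)"

text \<open>The class map \<open>cl\<close> identifies the group of divisors modulo numerical equivalence, with the
  intersection form, with the lattice \<open>S\<close>. (On a K3 surface numerical, algebraic and linear
  equivalence coincide.)\<close>

definition neron_severi_lattice ::
  "('k::field, 'n::finite) ppoint set \<Rightarrow> (('k, 'n) divisor \<Rightarrow> ('k, 'n) divisor \<Rightarrow> int) \<Rightarrow>
   'v::euclidean_space set \<Rightarrow> ('v \<Rightarrow> 'v \<Rightarrow> real) \<Rightarrow> (('k, 'n) divisor \<Rightarrow> 'v) \<Rightarrow> bool" where
  "neron_severi_lattice X I S b cl \<longleftrightarrow>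
     full_lattice S \<and> bilinear b \<and> cl ` divisors X = S \<and>
     (\<forall>D\<in>divisors X. \<forall>E\<in>divisors X.
        cl (div_plus X D E) = cl D + cl E \<and>
        (cl D = cl E \<longleftrightarrow> numerically_equivalent X I D E) \<and>
        b (cl D) (cl E) = of_int (I D E))"

text \<open>\<open>X\<close> is a supersingular K3 surface in characteristic \<open>p\<close> with Artin invariant \<open>\<sigma>\<close>, with
  intersection pairing \<open>I\<close> and Neron-Severi lattice \<open>(S, b)\<close>.\<close>

definition supersingular_K3 ::
  "nat \<Rightarrow> nat \<Rightarrow> ('k::alg_closed_field, 'n::finite) ppoint set \<Rightarrow>
   (('k, 'n) divisor \<Rightarrow> ('k, 'n) divisor \<Rightarrow> int) \<Rightarrow>
   'v::euclidean_space set \<Rightarrow> ('v \<Rightarrow> 'v \<Rightarrow> real) \<Rightarrow> (('k, 'n) divisor \<Rightarrow> 'v) \<Rightarrow> bool" where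
  "supersingular_K3 p \<sigma> X I S b cl \<longleftrightarrow>
     CHAR('k) = p \<and> K3_surface X \<and> intersection_pairing X I \<and> neron_severi_lattice X I S b cl \<and>
     dim S = 22 \<and> artin_invariant p S b \<sigma>"


section \<open>Genus one fibrations\<close>

abbreviation proj_line :: "('k::field, 2) ppoint set" where
  "proj_line \<equiv> proj_space"

definition fiber ::
  "('k::field, 'n::finite) ppoint set \<Rightarrow> (('k, 'n) ppoint \<Rightarrow> ('k, 2) ppoint) \<Rightarrow> ('k, 2) ppoint \<Rightarrow> ('k, 'n) ppoint set" where
  "fiber X \<phi> a = {P \<in> X. \<phi> P = a}"

definition local_parameter :: "('k::field, 2) ppoint \<Rightarrow> ('k, 2) pfun \<Rightarrow> bool" where
  "local_parameter a t \<longleftrightarrow> t \<in> max_ideal proj_line a \<and> max_ideal proj_line a \<subseteq> ideal_at proj_line a {t}"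

text \<open>The scheme-theoretic fiber over \<open>a\<close>, as the pullback of the point divisor \<open>a\<close>.\<close>

definition fiber_divisor ::
  "('k::field, 'n::finite) ppoint set \<Rightarrow> (('k, 'n) ppoint \<Rightarrow> ('k, 2) ppoint) \<Rightarrow> ('k, 2) ppoint \<Rightarrow> ('k, 'n) divisor" where
  "fiber_divisor X \<phi> a = (\<lambda>P. if P \<notin> X then {}
     else if \<phi> P = a then \<Union>t\<in>{t. local_parameter a t}. unit_coset X P (t \<circ> \<phi>)
     else unit_coset X P (\<lambda>_. 1))"

text \<open>Reducedness of that fiber: its ideal at each of its points contains every function vanishing
  on the underlying set.\<close>

definition reduced_fiber ::
  "('k::field, 'n::finite) ppoint set \<Rightarrow> (('k, 'n) ppoint \<Rightarrow> ('k, 2) ppoint) \<Rightarrow> ('k, 2) ppoint \<Rightarrow> bool" where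
  "reduced_fiber X \<phi> a \<longleftrightarrow> (\<forall>P\<in>fiber X \<phi> a. \<forall>h.
     regular_at X P h \<and> (\<forall>\<^sub>F Q in near X P. Q \<in> fiber X \<phi> a \<longrightarrow> h Q = 0) \<longrightarrow>
     h \<in> ideal_at X P {f \<in> fiber_divisor X \<phi> a P. regular_at X P f})"

text \<open>The arithmetic genus of an integral projective curve is the dimension of the first cohomology
  of its structure sheaf. General fibers are integral of arithmetic genus one: nonsingular in the
  elliptic case, cuspidal in the quasi-elliptic case.\<close>

definition genus_one_fibration ::
  "('k::field, 'n::finite) ppoint set \<Rightarrow> (('k, 'n) ppoint \<Rightarrow> ('k, 2) ppoint) \<Rightarrow> bool" where
  "genus_one_fibration X \<phi> \<longleftrightarrow> morphism X proj_line \<phi> \<and>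
     finite {a \<in> proj_line. \<not> (projective_variety (fiber X \<phi> a) \<and> zariski_dim (fiber X \<phi> a) 1 \<and>
       reduced_fiber X \<phi> a \<and> h1_structure_sheaf (fiber X \<phi> a) 1)}"

definition admits_section ::
  "('k::field, 'n::finite) ppoint set \<Rightarrow> (('k, 'n) ppoint \<Rightarrow> ('k, 2) ppoint) \<Rightarrow> bool" where
  "admits_section X \<phi> \<longleftrightarrow> (\<exists>s. morphism proj_line X s \<and> (\<forall>a\<in>proj_line. \<phi> (s a) = a))"

text \<open>The class of a fiber; it does not depend on the chosen point of the line.\<close>

definition fiber_class ::
  "('k::field, 'n::finite) ppoint set \<Rightarrow> (('k, 'n) divisor \<Rightarrow> 'v) \<Rightarrow> (('k, 'n) ppoint \<Rightarrow> ('k, 2) ppoint) \<Rightarrow> 'v" where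
  "fiber_class X cl \<phi> = cl (fiber_divisor X \<phi> (SOME a. a \<in> proj_line))"

definition lattice_equivalent ::
  "('k::field, 'n::finite) ppoint set \<Rightarrow> 'v::euclidean_space set \<Rightarrow> ('v \<Rightarrow> 'v \<Rightarrow> real) \<Rightarrow> (('k, 'n) divisor \<Rightarrow> 'v) \<Rightarrow>
   (('k, 'n) ppoint \<Rightarrow> ('k, 2) ppoint) \<Rightarrow> (('k, 'n) ppoint \<Rightarrow> ('k, 2) ppoint) \<Rightarrow> bool" where
  "lattice_equivalent X S b cl \<phi> \<psi> \<longleftrightarrow>
     (\<exists>g\<in>positive_isometries S b. g (fiber_class X cl \<phi>) = fiber_class X cl \<psi>)"

definition fibration_class ::
  "('k::field, 'n::finite) ppoint set \<Rightarrow> 'v::euclidean_space set \<Rightarrow> ('v \<Rightarrow> 'v \<Rightarrow> real) \<Rightarrow> (('k, 'n) divisor \<Rightarrow> 'v) \<Rightarrow>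
   (('k, 'n) ppoint \<Rightarrow> ('k, 2) ppoint) \<Rightarrow> (('k, 'n) ppoint \<Rightarrow> ('k, 2) ppoint) set" where
  "fibration_class X S b cl \<phi> = {\<psi>. genus_one_fibration X \<psi> \<and> lattice_equivalent X S b cl \<phi> \<psi>}"

text \<open>\<open>j\<close> is given by its linear extension.\<close>

definition canonical_embedding ::
  "nat \<Rightarrow> 'v::euclidean_space set \<Rightarrow> ('v \<Rightarrow> 'v \<Rightarrow> real) \<Rightarrow> 'w::euclidean_space set \<Rightarrow> ('w \<Rightarrow> 'w \<Rightarrow> real) \<Rightarrow>
   ('v \<Rightarrow> 'w) \<Rightarrow> bool" where
  "canonical_embedding p S b S' b' j \<longleftrightarrow>
     linear j \<and> inj_on j S \<and> j ` S \<subseteq> S' \<and> bij_betw j (dual_lattice S b) S' \<and>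
     (\<forall>x\<in>dual_lattice S b. \<forall>y\<in>dual_lattice S b. b' (j x) (j y) = real p * b x y)"

text \<open>The canonical correspondence between classes of genus one fibrations on \<open>X\<close> and on \<open>X'\<close>. The
  condition on fiber classes does not depend on the representatives of \<open>\<Phi>\<close> and \<open>\<Phi>'\<close>.\<close>

definition classes_correspond ::
  "('k::field, 'n::finite) ppoint set \<Rightarrow> (('k, 'n) divisor \<Rightarrow> 'v::euclidean_space) \<Rightarrow>
   ('l::field, 'm::finite) ppoint set \<Rightarrow> 'w::euclidean_space set \<Rightarrow> ('w \<Rightarrow> 'w \<Rightarrow> real) \<Rightarrow> (('l, 'm) divisor \<Rightarrow> 'w) \<Rightarrow>
   ('v \<Rightarrow> 'w) \<Rightarrow>
   (('k, 'n) ppoint \<Rightarrow> ('k, 2) ppoint) set \<Rightarrow> (('l, 'm) ppoint \<Rightarrow> ('l, 2) ppoint) set \<Rightarrow> bool" where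
  "classes_correspond X cl X' S' b' cl' j \<Phi> \<Phi>' \<longleftrightarrow>
     (\<exists>\<phi>\<in>\<Phi>. \<exists>\<phi>'\<in>\<Phi>'. \<exists>g\<in>isometries S' b'. \<exists>c\<in>\<rat> - {0}.
        g (j (fiber_class X cl \<phi>)) = c *\<^sub>R fiber_class X' cl' \<phi>')"

end

theory Submission
  imports Defs
begin

text \<open>
  If a fibration has a section, its fiber class has intersection number 1 with the curve of the section.
  Suppose this holds for \<open>f\<close> on \<open>X\<close> and for \<open>f'\<close> on \<open>X'\<close>, and that \<open>j f = c u\<close> with \<open>u\<close> the image of \<open>f'\<close>
  under an isometry. Write \<open>u = j w\<close> with \<open>w\<close> in the dual of \<open>S\<close>, so that \<open>f = c w\<close>. Pairing with the
  section shows that \<open>1/c\<close> is an integer, so \<open>u\<close> pairs with \<open>S'\<close> in \<open>(p/c) f (S\<^sup>\<or>) \<subseteq> p \<int>\<close>,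
  which contradicts the existence of a class pairing to 1 with \<open>f'\<close>.

  The geometric part has to produce the curve \<open>C = s(P\<^sup>1)\<close> as a Cartier divisor. It is the fixed locus of
  the retraction \<open>r = s \<circ> \<phi>\<close>, so its ideal is generated near each point by the finitely many
  differences \<open>x\<^sub>i - x\<^sub>i \<circ> r\<close> of affine coordinates. Nakayama's lemma and the regularity of the surface
  make this ideal principal, with a generator \<open>h\<close> that together with the local equation of the fiber
  generates the maximal ideal. Hence the fiber and \<open>C\<close> meet transversally in one point.
\<close>

text \<open>The retraction does the work of a general theory of curves on surfaces. It supplies
  finitely many explicit generators of the ideal of the curve, which Nakayama's lemma requires, and
  it lets equations be tested on the line, where cancelling a local parameter is elementary.
  Finiteness matters a second time: a Cartier divisor needs one equation valid on an open set, and
  finitely many relations between germs hold on a common neighbourhood.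

  The two-dimensional cotangent space is used to find a second generator beside the fiber parameter,
  and again to see that this generator is not the zero germ.

  In the lattice part the rational factor \<open>c\<close> is arbitrary, because the correspondence
  sees fiber classes only up to scaling; the unit pairing on \<open>X\<close> is what bounds it. The
  factor \<open>p\<close> of the contradiction comes from the rescaling of the form under
  \<open>j\<close>.\<close>

no_notation fps_nth (infixl \<open>$\<close> 75)

section \<open>Forms and the Zariski topology\<close>

text \<open>A sum over an infinite set is 0 by convention, so the sums in \<open>form\<close> have
  their intended meaning only because of this.\<close>

lemma finite_multi_indices: "finite {m :: 'n::finite \<Rightarrow> nat. (\<Sum>i\<in>UNIV. m i) = d}"
proof (rule finite_subset)
  show "{m :: 'n \<Rightarrow> nat. (\<Sum>i\<in>UNIV. m i) = d} \<subseteq> PiE UNIV (\<lambda>_. {..d})"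
    by (auto intro: member_le_sum)
qed (intro finite_PiE; simp)

lemma monomial_in_form:
  fixes m :: "'n::finite \<Rightarrow> nat"
  shows "(\<lambda>v. c * (\<Prod>i\<in>UNIV. v $ i ^ m i)) \<in> form (\<Sum>i\<in>UNIV. m i)"
  unfolding form_def
proof (intro CollectI exI ext)
  fix v :: "'a ^ 'n"
  show "c * (\<Prod>i\<in>UNIV. v $ i ^ m i) = (\<Sum>m' | (\<Sum>i\<in>UNIV. m' i) = (\<Sum>i\<in>UNIV. m i).
      (if m' = m then c else 0) * (\<Prod>i\<in>UNIV. v $ i ^ m' i))"
    by (simp add: if_distrib[of "\<lambda>x. x * _"] finite_multi_indices cong: if_cong)
qed

lemma form_add:
  assumes "F \<in> form d" "G \<in> form d"
  shows "(\<lambda>v. F v + G v) \<in> form d"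
proof -
  from assms obtain c c' where
    "F = (\<lambda>v. \<Sum>m | (\<Sum>i\<in>UNIV. m i) = d. c m * (\<Prod>i\<in>UNIV. v $ i ^ m i))"
    "G = (\<lambda>v. \<Sum>m | (\<Sum>i\<in>UNIV. m i) = d. c' m * (\<Prod>i\<in>UNIV. v $ i ^ m i))"
    unfolding form_def by auto
  then show ?thesis
    unfolding form_def by (intro CollectI exI[of _ "\<lambda>m. c m + c' m"]) (simp add: sum.distrib algebra_simps)
qed

lemma form_zero: "(\<lambda>v. 0) \<in> form d"
  unfolding form_def by (intro CollectI exI[of _ "\<lambda>m. 0"]) simp

lemma form_sum: "(\<And>x. x \<in> A \<Longrightarrow> F x \<in> form d) \<Longrightarrow> (\<lambda>v. \<Sum>x\<in>A. F x v) \<in> form d"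
  by (induction A rule: infinite_finite_induct) (auto intro: form_add form_zero)

lemma form_mult:
  assumes "F \<in> form d" "G \<in> form e"
  shows "(\<lambda>v. F v * G v) \<in> form (d + e)"
proof -
  from assms obtain c c' where
    F: "F = (\<lambda>v. \<Sum>m | (\<Sum>i\<in>UNIV. m i) = d. c m * (\<Prod>i\<in>UNIV. v $ i ^ m i))" and
    G: "G = (\<lambda>v. \<Sum>m | (\<Sum>i\<in>UNIV. m i) = e. c' m * (\<Prod>i\<in>UNIV. v $ i ^ m i))"
    unfolding form_def by auto
  have "(\<lambda>v. \<Sum>m | (\<Sum>i\<in>UNIV. m i) = d. \<Sum>m' | (\<Sum>i\<in>UNIV. m' i) = e.
      (c m * c' m') * (\<Prod>i\<in>UNIV. v $ i ^ (m i + m' i))) \<in> form (d + e)"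
  proof (intro form_sum)
    fix m m' :: "'b \<Rightarrow> nat"
    assume "m \<in> {m. (\<Sum>i\<in>UNIV. m i) = d}" "m' \<in> {m. (\<Sum>i\<in>UNIV. m i) = e}"
    then have "(\<Sum>i\<in>UNIV. m i + m' i) = d + e"
      by (simp add: sum.distrib)
    then show "(\<lambda>v :: 'a ^ 'b. (c m * c' m') * (\<Prod>i\<in>UNIV. v $ i ^ (m i + m' i))) \<in> form (d + e)"
      using monomial_in_form[of "c m * c' m'" "\<lambda>i. m i + m' i"] by metis
  qed
  then show ?thesis
    unfolding F G sum_product by (simp add: power_add prod.distrib mult_ac)
qed

lemma form_const: "(\<lambda>v :: 'k::field ^ 'n::finite. c) \<in> form 0"
  using monomial_in_form[of c "\<lambda>i::'n. 0"] by simp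

lemma form_coordinate: "(\<lambda>v. v $ k) \<in> form 1"
proof -
  have "(\<lambda>v::'a ^ 'b. 1 * (\<Prod>i\<in>UNIV. v $ i ^ (if i = k then 1 else 0))) \<in> form (\<Sum>i\<in>UNIV. if i = k then 1 else 0)"
    by (rule monomial_in_form)
  then show ?thesis
    by (simp add: if_distrib[of "\<lambda>x. _ ^ x"] cong: if_cong)
qed

lemma form_homogeneous:
  assumes "F \<in> form d"
  shows "F (a *s v) = a ^ d * F v"
proof -
  from assms obtain c where
    F: "F = (\<lambda>v. \<Sum>m | (\<Sum>i\<in>UNIV. m i) = d. c m * (\<Prod>i\<in>UNIV. v $ i ^ m i))"
    unfolding form_def by auto
  show ?thesis
    unfolding F by (auto simp: sum_distrib_left power_mult_distrib prod.distrib simp flip: power_sum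
        intro!: sum.cong)
qed

section \<open>Points of projective space and their representatives\<close>

lemma proj_space_cases:
  assumes "P \<in> proj_space"
  obtains v where "v \<noteq> 0" "P = {c *s v | c. c \<noteq> 0}" "v \<in> P"
proof -
  from assms obtain v where v: "v \<noteq> 0" "P = {c *s v | c. c \<noteq> 0}"
    unfolding proj_space_def by auto
  moreover have "v \<in> P"
    unfolding v(2) by (intro CollectI exI[of _ 1]) simp
  ultimately show thesis by (rule that)
qed

lemma representative_unique:
  assumes "P \<in> proj_space" "v \<in> P" "w \<in> P"
  obtains c where "c \<noteq> 0" "w = c *s v"
proof -
  from assms(1) obtain u where u: "P = {c *s u | c. c \<noteq> 0}"
    by (rule proj_space_cases)
  with assms obtain a b where "v = a *s u" "w = b *s u" "a \<noteq> 0" "b \<noteq> 0"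
    by auto
  then have "b / a \<noteq> 0" "w = (b / a) *s v" by auto
  then show thesis by (rule that)
qed

lemma representative_scale:
  assumes "P \<in> proj_space" "v \<in> P" "c \<noteq> 0"
  shows "c *s v \<in> P"
proof -
  from assms(1) obtain u where u: "P = {c *s u | c. c \<noteq> 0}"
    by (rule proj_space_cases)
  with assms(2) obtain a where "a \<noteq> 0" "v = a *s u" by auto
  then have "c *s v = (c * a) *s u" "c * a \<noteq> 0" using assms(3) by auto
  then show ?thesis unfolding u by blast
qed

lemma proj_space_eqI:
  assumes "P \<in> proj_space" "Q \<in> proj_space" "v \<in> P" "v \<in> Q"
  shows "P = Q"
  using assms by (metis representative_unique representative_scale subsetI subset_antisym)

lemma representative_coordinate:
  assumes "P \<in> proj_space"
  obtains v k where "v \<in> P" "v $ k \<noteq> 0"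
  using assms by (metis proj_space_cases vec_eq_iff zero_index)

lemma representative_exists: "P \<in> proj_space \<Longrightarrow> \<exists>v. v \<in> P"
  by (erule proj_space_cases) blast

text \<open>Representatives differ by a nonzero scalar, which changes the value of a form by a
  nonzero factor. The universal condition in the basic open sets can thus be tested on one
  vector.\<close>

lemma form_nonvanishing:
  assumes "F \<in> form d" "P \<in> proj_space" "v \<in> P"
  shows "(\<forall>w\<in>P. F w \<noteq> 0) \<longleftrightarrow> F v \<noteq> 0"
  using assms by (metis form_homogeneous representative_unique no_zero_divisors power_not_zero)

section \<open>Basic open sets of the Zariski topology\<close>

lemma topspace_zariski [simp]: "topspace zariski = proj_space"
proof -
  have "{P \<in> proj_space. \<forall>v\<in>P. (1::'a) \<noteq> 0} \<in> {{P \<in> proj_space. \<forall>v\<in>P. F v \<noteq> (0::'a)} | F. \<exists>d. F \<in> form d}"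
    by (intro CollectI exI[of _ "\<lambda>_. 1"] exI[of _ 0] conjI form_const refl)
  then show ?thesis
    unfolding zariski_def topology_generated_by_topspace by auto
qed

lemma openin_nonvanishing:
  assumes "F \<in> form d" "X \<subseteq> proj_space"
  shows "openin (ztop X) {P \<in> X. \<forall>v\<in>P. F v \<noteq> 0}"
proof -
  have "openin zariski {P \<in> proj_space. \<forall>v\<in>P. F v \<noteq> 0}"
    unfolding zariski_def using assms(1) by (intro topology_generated_by_Basis) auto
  moreover have "{P \<in> X. \<forall>v\<in>P. F v \<noteq> 0} = {P \<in> proj_space. \<forall>v\<in>P. F v \<noteq> 0} \<inter> X"
    using assms(2) by auto
  ultimately show ?thesis
    unfolding openin_subtopology by blast
qed

text \<open>The generating family is already a basis: two nonvanishing loci meet in the nonvanishing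
  locus of the product of the two forms.\<close>

lemma zariski_base:
  assumes "openin zariski U" "P \<in> U"
  shows "\<exists>d. \<exists>F\<in>form d. (\<forall>v\<in>P. F v \<noteq> 0) \<and> (\<forall>Q\<in>proj_space. (\<forall>v\<in>Q. F v \<noteq> 0) \<longrightarrow> Q \<in> U)"
proof -
  from assms(1) have "generate_topology_on {{P \<in> proj_space. \<forall>v\<in>P. F v \<noteq> 0} | F. \<exists>d. F \<in> form d} U"
    unfolding zariski_def by (rule openin_topology_generated_by)
  then show ?thesis using assms(2)
  proof (induction rule: generate_topology_on.induct)
    case (Int A B)
    from Int.prems have P: "P \<in> A" "P \<in> B" by auto
    from Int.IH(1)[OF P(1)] obtain d F where "F \<in> form d"
      "\<forall>v\<in>P. F v \<noteq> 0" "\<forall>Q\<in>proj_space. (\<forall>v\<in>Q. F v \<noteq> 0) \<longrightarrow> Q \<in> A"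
      by blast
    moreover from Int.IH(2)[OF P(2)] obtain e G where "G \<in> form e"
      "\<forall>v\<in>P. G v \<noteq> 0" "\<forall>Q\<in>proj_space. (\<forall>v\<in>Q. G v \<noteq> 0) \<longrightarrow> Q \<in> B"
      by blast
    ultimately show ?case
      using form_mult[of F d G e] by (intro exI[of _ "d + e"] bexI[of _ "\<lambda>v. F v * G v"]) auto
  next
    case (UN K)
    from UN.prems obtain B where B: "B \<in> K" "P \<in> B" by blast
    from UN.IH[OF this] obtain d F where "F \<in> form d" "\<forall>v\<in>P. F v \<noteq> 0"
      "\<forall>Q\<in>proj_space. (\<forall>v\<in>Q. F v \<noteq> 0) \<longrightarrow> Q \<in> B"
      by blast
    with B(1) show ?case by (intro exI[of _ d] bexI[of _ F]) auto
  qed auto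
qed

section \<open>Local rings\<close>

text \<open>The ratio does not depend on the chosen representative; it is 0 where the denominator vanishes.\<close>

definition affine_coord :: "'n \<Rightarrow> 'n \<Rightarrow> ('k::field, 'n::finite) pfun" where
  "affine_coord k i Q = (let v = SOME v. v \<in> Q in v $ i / v $ k)"

lemma affine_coord_eq:
  assumes "Q \<in> proj_space" "v \<in> Q"
  shows "affine_coord k i Q = v $ i / v $ k"
proof -
  have "(SOME v. v \<in> Q) \<in> Q" using assms(2) by (rule someI)
  then obtain c where "c \<noteq> 0" "(SOME v. v \<in> Q) = c *s v"
    using assms by (metis representative_unique)
  then show ?thesis by (simp add: affine_coord_def)
qed

text \<open>Common setting of the surface and of the line; the calculus of germs is needed on
  both.\<close>

locale proj_subset =
  fixes X :: "('k::field, 'n::finite) ppoint set"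
  assumes subset: "X \<subseteq> proj_space"
begin

lemma topspace_ztop [simp]: "topspace (ztop X) = X"
  using subset by auto

lemma eventually_near:
  "P \<in> X \<Longrightarrow> eventually R (near X P) \<longleftrightarrow> (\<exists>U. openin (ztop X) U \<and> P \<in> U \<and> (\<forall>Q\<in>U. R Q))"
  unfolding eventually_nhdsin topspace_ztop by simp

lemma eventually_near_self: "P \<in> X \<Longrightarrow> eventually R (near X P) \<Longrightarrow> R P"
  unfolding eventually_near by auto

lemma eventually_near_mem: "P \<in> X \<Longrightarrow> eventually (\<lambda>Q. Q \<in> X) (near X P)"
  unfolding eventually_near using openin_topspace[of "ztop X", unfolded topspace_ztop] by blast

lemma eventually_near_open: "openin (ztop X) U \<Longrightarrow> P \<in> U \<Longrightarrow> eventually (\<lambda>Q. Q \<in> U) (near X P)"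
  using openin_subset[of "ztop X" U] by (subst eventually_near) auto

text \<open>The neighbourhood filter is generated by open sets. This is how relations between germs
  at \<open>P\<close> are spread to germs at nearby points.\<close>

lemma eventually_near_near:
  assumes "P \<in> X" "eventually R (near X P)"
  shows "eventually (\<lambda>Q. eventually R (near X Q)) (near X P)"
proof -
  from assms obtain U where "openin (ztop X) U" "P \<in> U" "\<forall>Q\<in>U. R Q"
    by (auto simp: eventually_near)
  moreover then have "U \<subseteq> X" using openin_subset[of "ztop X" U] by simp
  ultimately show ?thesis
    using assms(1) by (subst eventually_near) (auto intro!: exI[of _ U] simp: eventually_near subset_iff)
qed

lemma eventually_nonvanishing:
  assumes "F \<in> form d" "P \<in> X" "v \<in> P" "F v \<noteq> 0"
  shows "eventually (\<lambda>Q. \<forall>v\<in>Q. F v \<noteq> 0) (near X P)"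
proof -
  have "\<forall>w\<in>P. F w \<noteq> 0"
    using form_nonvanishing[OF assms(1) _ assms(3)] assms(2,4) subset by blast
  with eventually_near_open[OF openin_nonvanishing[OF assms(1) subset]] assms(2)
  have "eventually (\<lambda>Q. Q \<in> {Q \<in> X. \<forall>w\<in>Q. F w \<noteq> 0}) (near X P)"
    by blast
  then show ?thesis by eventually_elim blast
qed

lemma regular_atI:
  assumes "P \<in> X" "G \<in> form d" "H \<in> form d" "eventually (\<lambda>Q. \<forall>v\<in>Q. H v \<noteq> 0 \<and> f Q = G v / H v) (near X P)"
  shows "regular_at X P f"
  unfolding regular_at_def using assms by blast

lemma regular_atE:
  assumes "regular_at X P f"
  obtains d G H where "G \<in> form d" "H \<in> form d"
    "eventually (\<lambda>Q. \<forall>v\<in>Q. H v \<noteq> 0 \<and> f Q = G v / H v) (near X P)"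
  using assms unfolding regular_at_def by blast

lemma regular_at_mem: "regular_at X P f \<Longrightarrow> P \<in> X"
  unfolding regular_at_def by blast

lemma regular_at_cong:
  assumes "regular_at X P f" "eventually (\<lambda>Q. g Q = f Q) (near X P)"
  shows "regular_at X P g"
proof -
  from assms(1) obtain d G H where *: "G \<in> form d" "H \<in> form d"
    "eventually (\<lambda>Q. \<forall>v\<in>Q. H v \<noteq> 0 \<and> f Q = G v / H v) (near X P)"
    by (rule regular_atE)
  from *(3) assms(2) have "eventually (\<lambda>Q. \<forall>v\<in>Q. H v \<noteq> 0 \<and> g Q = G v / H v) (near X P)"
    by eventually_elim auto
  then show ?thesis
    using * by (intro regular_atI[OF regular_at_mem[OF assms(1)]])
qed

lemma regular_at_const: "P \<in> X \<Longrightarrow> regular_at X P (\<lambda>Q. c)"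
  by (rule regular_atI[OF _ form_const[of c] form_const[of 1]]) auto

lemma regular_at_add:
  assumes "regular_at X P f" "regular_at X P g"
  shows "regular_at X P (\<lambda>Q. f Q + g Q)"
proof -
  from assms(1) obtain d G H where 1: "G \<in> form d" "H \<in> form d"
    "eventually (\<lambda>Q. \<forall>v\<in>Q. H v \<noteq> 0 \<and> f Q = G v / H v) (near X P)"
    by (rule regular_atE)
  from assms(2) obtain e G' H' where 2: "G' \<in> form e" "H' \<in> form e"
    "eventually (\<lambda>Q. \<forall>v\<in>Q. H' v \<noteq> 0 \<and> g Q = G' v / H' v) (near X P)"
    by (rule regular_atE)
  show ?thesis
  proof (rule regular_atI)
    show "(\<lambda>v. G v * H' v + H v * G' v) \<in> form (d + e)" "(\<lambda>v. H v * H' v) \<in> form (d + e)"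
      using 1 2 by (auto intro: form_add form_mult)
    show "eventually (\<lambda>Q. \<forall>v\<in>Q. H v * H' v \<noteq> 0 \<and>
        f Q + g Q = (G v * H' v + H v * G' v) / (H v * H' v)) (near X P)"
      using 1(3) 2(3) by eventually_elim (auto simp: field_simps)
  qed (use assms(1) regular_at_mem in blast)
qed

lemma regular_at_mult:
  assumes "regular_at X P f" "regular_at X P g"
  shows "regular_at X P (\<lambda>Q. f Q * g Q)"
proof -
  from assms(1) obtain d G H where 1: "G \<in> form d" "H \<in> form d"
    "eventually (\<lambda>Q. \<forall>v\<in>Q. H v \<noteq> 0 \<and> f Q = G v / H v) (near X P)"
    by (rule regular_atE)
  from assms(2) obtain e G' H' where 2: "G' \<in> form e" "H' \<in> form e"
    "eventually (\<lambda>Q. \<forall>v\<in>Q. H' v \<noteq> 0 \<and> g Q = G' v / H' v) (near X P)"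
    by (rule regular_atE)
  show ?thesis
  proof (rule regular_atI)
    show "(\<lambda>v. G v * G' v) \<in> form (d + e)" "(\<lambda>v. H v * H' v) \<in> form (d + e)"
      using 1 2 by (auto intro: form_mult)
    show "eventually (\<lambda>Q. \<forall>v\<in>Q. H v * H' v \<noteq> 0 \<and> f Q * g Q = (G v * G' v) / (H v * H' v)) (near X P)"
      using 1(3) 2(3) by eventually_elim auto
  qed (use assms(1) regular_at_mem in blast)
qed

lemma regular_at_diff:
  assumes "regular_at X P f" "regular_at X P g"
  shows "regular_at X P (\<lambda>Q. f Q - g Q)"
  using regular_at_add[OF assms(1) regular_at_mult[OF regular_at_const[of P "-1"] assms(2)]]
    regular_at_mem[OF assms(1)] by simp

lemma regular_at_sum:
  "P \<in> X \<Longrightarrow> (\<And>x. x \<in> A \<Longrightarrow> regular_at X P (f x)) \<Longrightarrow> regular_at X P (\<lambda>Q. \<Sum>x\<in>A. f x Q)"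
  by (induction A rule: infinite_finite_induct) (auto intro: regular_at_add regular_at_const)

text \<open>Near \<open>P\<close> the function is a quotient \<open>G / H\<close>, and its zeros are
  those of the form \<open>G\<close>.\<close>

lemma regular_at_nonzero:
  assumes "regular_at X P f" "f P \<noteq> 0"
  shows "eventually (\<lambda>Q. f Q \<noteq> 0) (near X P)"
proof -
  have P: "P \<in> X" using assms(1) by (rule regular_at_mem)
  from assms(1) obtain d G H where 1: "G \<in> form d" "H \<in> form d"
    "eventually (\<lambda>Q. \<forall>v\<in>Q. H v \<noteq> 0 \<and> f Q = G v / H v) (near X P)"
    by (rule regular_atE)
  obtain v where v: "v \<in> P" using P subset by (meson proj_space_cases subsetD)
  have "G v \<noteq> 0" using eventually_near_self[OF P 1(3)] v assms(2) by auto
  from eventually_nonvanishing[OF 1(1) P v this] 1(3) eventually_near_mem[OF P]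
  show ?thesis
  proof eventually_elim
    case (elim Q)
    then show ?case
      using subset by (metis divide_eq_0_iff proj_space_cases subsetD)
  qed
qed

lemma regular_at_inverse:
  assumes "regular_at X P f" "f P \<noteq> 0"
  shows "regular_at X P (\<lambda>Q. inverse (f Q))"
proof -
  have P: "P \<in> X" using assms(1) by (rule regular_at_mem)
  from assms(1) obtain d G H where 1: "G \<in> form d" "H \<in> form d"
    "eventually (\<lambda>Q. \<forall>v\<in>Q. H v \<noteq> 0 \<and> f Q = G v / H v) (near X P)"
    by (rule regular_atE)
  from regular_at_nonzero[OF assms] 1(3)
  have "eventually (\<lambda>Q. \<forall>v\<in>Q. G v \<noteq> 0 \<and> inverse (f Q) = H v / G v) (near X P)"
    by eventually_elim auto
  with P 1(2,1) show ?thesis by (rule regular_atI)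
qed

lemma regular_at_near:
  assumes "regular_at X P f"
  shows "eventually (\<lambda>Q. regular_at X Q f) (near X P)"
proof -
  have P: "P \<in> X" using assms by (rule regular_at_mem)
  from assms obtain d G H where 1: "G \<in> form d" "H \<in> form d"
    "eventually (\<lambda>Q. \<forall>v\<in>Q. H v \<noteq> 0 \<and> f Q = G v / H v) (near X P)"
    by (rule regular_atE)
  from eventually_near_near[OF P 1(3)] eventually_near_mem[OF P]
  show ?thesis by eventually_elim (rule regular_atI[OF _ 1(1,2)])
qed

lemma regular_at_affine_coord:
  assumes "P \<in> X" "v \<in> P" "v $ k \<noteq> 0"
  shows "regular_at X P (affine_coord k i)"
proof (rule regular_atI[OF assms(1)])
  show "(\<lambda>v. v $ i) \<in> form 1" "(\<lambda>v. v $ k) \<in> form 1"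
    by (rule form_coordinate)+
  from eventually_nonvanishing[OF form_coordinate assms] eventually_near_mem[OF assms(1)]
  show "eventually (\<lambda>Q. \<forall>v\<in>Q. v $ k \<noteq> 0 \<and> affine_coord k i Q = v $ i / v $ k) (near X P)"
    by eventually_elim (use subset affine_coord_eq in blast)
qed

text \<open>Dividing numerator and denominator by a power of coordinate \<open>k\<close> turns a
  quotient of forms into a quotient of polynomials in the affine coordinates. So the local ring
  arises from constants and coordinates by ring operations and inversion of units, and a claim about
  all germs reduces to the coordinates.\<close>

lemma regular_at_induct [consumes 3, case_names const coord add mult inverse cong]:
  assumes "regular_at X P f" "w \<in> P" "w $ k \<noteq> 0"
    and const: "\<And>c. R (\<lambda>Q. c)"
    and coord: "\<And>i. R (affine_coord k i)"
    and add: "\<And>f g. R f \<Longrightarrow> R g \<Longrightarrow> R (\<lambda>Q. f Q + g Q)"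
    and mult: "\<And>f g. R f \<Longrightarrow> R g \<Longrightarrow> R (\<lambda>Q. f Q * g Q)"
    and inverse: "\<And>f. R f \<Longrightarrow> f P \<noteq> 0 \<Longrightarrow> R (\<lambda>Q. inverse (f Q))"
    and cong: "\<And>f g. R f \<Longrightarrow> eventually (\<lambda>Q. g Q = f Q) (near X P) \<Longrightarrow> R g"
  shows "R f"
proof -
  have P: "P \<in> X" using assms(1) by (rule regular_at_mem)
  have sum: "R (\<lambda>Q. \<Sum>x\<in>A. F x Q)" if "\<And>x. x \<in> A \<Longrightarrow> R (F x)" for A :: "('n \<Rightarrow> nat) set" and F
    using that by (induction A rule: infinite_finite_induct) (auto intro: const add)
  have power: "R (\<lambda>Q. F Q ^ n)" if "R F" for F and n :: nat
    using that by (induction n) (auto intro: const mult)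
  have prod: "R (\<lambda>Q. \<Prod>x\<in>A. F x Q)" if "\<And>x. x \<in> A \<Longrightarrow> R (F x)" for A :: "'n set" and F
    using that by (induction A rule: infinite_finite_induct) (auto intro: const mult)
  \<comment> \<open>Evaluation at the representative whose coordinate \<open>k\<close> is 1. The
    value is that at \<open>v\<close> divided by \<open>v $ k ^ d\<close>, and this denominator
    cancels in the quotient because \<open>G\<close> and \<open>H\<close> have the same
    degree.\<close>
  define dehom where "dehom G Q = G (\<chi> i. affine_coord k i Q)" for G :: "'k ^ 'n \<Rightarrow> 'k" and Q
  have dehom: "R (dehom G)" if "G \<in> form d" for G and d
  proof -
    from that obtain c where
      G: "G = (\<lambda>v. \<Sum>m | (\<Sum>i\<in>UNIV. m i) = d. c m * (\<Prod>i\<in>UNIV. v $ i ^ m i))"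
      unfolding form_def by auto
    have "R (\<lambda>Q. \<Sum>m | (\<Sum>i\<in>UNIV. m i) = d. c m * (\<Prod>i\<in>UNIV. affine_coord k i Q ^ m i))"
      by (intro sum mult const prod power coord)
    then show ?thesis by (simp add: dehom_def [abs_def] G)
  qed
  have dehom_eq: "dehom G Q = G v / v $ k ^ d" if "G \<in> form d" "Q \<in> X" "v \<in> Q" for G d Q v
  proof -
    have "(\<chi> i. affine_coord k i Q) = inverse (v $ k) *s v"
      using that subset affine_coord_eq[of Q v k] by (auto simp: vec_eq_iff field_simps)
    then show ?thesis
      using form_homogeneous[OF that(1), of "inverse (v $ k)" v] by (simp add: dehom_def field_simps)
  qed
  from assms(1) obtain d G H where 1: "G \<in> form d" "H \<in> form d"
    "eventually (\<lambda>Q. \<forall>v\<in>Q. H v \<noteq> 0 \<and> f Q = G v / H v) (near X P)"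
    by (rule regular_atE)
  have "dehom H P \<noteq> 0"
    using eventually_near_self[OF P 1(3)] dehom_eq[OF 1(2) P assms(2)] assms(2,3) by auto
  then have "R (\<lambda>Q. dehom G Q * inverse (dehom H Q))"
    by (rule mult[OF dehom[OF 1(1)] inverse[OF dehom[OF 1(2)]]])
  moreover have "eventually (\<lambda>Q. f Q = dehom G Q * inverse (dehom H Q)) (near X P)"
    using 1(3) eventually_near_mem[OF P] eventually_nonvanishing[OF form_coordinate P assms(2,3)]
  proof eventually_elim
    case (elim Q)
    moreover obtain v where "v \<in> Q" using elim subset by (meson proj_space_cases subsetD)
    ultimately show ?case
      using dehom_eq[OF 1(1)] dehom_eq[OF 1(2)] by auto
  qed
  ultimately show ?thesis by (rule cong)
qed

end

section \<open>Ideals of local rings\<close>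

text \<open>Closure under agreement near \<open>P\<close> makes the set a union of classes of germs,
  so it stands for an ideal of the local ring and no quotient ring has to be formed.\<close>

definition germ_ideal :: "('k::field, 'n::finite) ppoint set \<Rightarrow> ('k, 'n) ppoint \<Rightarrow> ('k, 'n) pfun set \<Rightarrow> bool" where
  "germ_ideal X P J \<longleftrightarrow> (\<forall>f\<in>J. regular_at X P f) \<and> (\<lambda>Q. 0) \<in> J \<and>
     (\<forall>f\<in>J. \<forall>g\<in>J. (\<lambda>Q. f Q + g Q) \<in> J) \<and>
     (\<forall>c. regular_at X P c \<longrightarrow> (\<forall>f\<in>J. (\<lambda>Q. c Q * f Q) \<in> J)) \<and>
     (\<forall>f\<in>J. \<forall>g. (\<forall>\<^sub>F Q in near X P. g Q = f Q) \<longrightarrow> g \<in> J)"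

text \<open>For closed \<open>C\<close> this is the stalk at \<open>P\<close> of its radical ideal
  sheaf.\<close>

definition vanishing_ideal ::
  "('k::field, 'n::finite) ppoint set \<Rightarrow> ('k, 'n) ppoint set \<Rightarrow> ('k, 'n) ppoint \<Rightarrow> ('k, 'n) pfun set" where
  "vanishing_ideal X C P = {h. regular_at X P h \<and> (\<forall>\<^sub>F Q in near X P. Q \<in> C \<longrightarrow> h Q = 0)}"

context proj_subset
begin

lemma germ_ideal_regular: "germ_ideal X P J \<Longrightarrow> f \<in> J \<Longrightarrow> regular_at X P f"
  and germ_ideal_zero: "germ_ideal X P J \<Longrightarrow> (\<lambda>Q. 0) \<in> J"
  and germ_ideal_add: "germ_ideal X P J \<Longrightarrow> f \<in> J \<Longrightarrow> g \<in> J \<Longrightarrow> (\<lambda>Q. f Q + g Q) \<in> J"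
  and germ_ideal_mult: "germ_ideal X P J \<Longrightarrow> regular_at X P c \<Longrightarrow> f \<in> J \<Longrightarrow> (\<lambda>Q. c Q * f Q) \<in> J"
  and germ_ideal_cong: "germ_ideal X P J \<Longrightarrow> f \<in> J \<Longrightarrow> \<forall>\<^sub>F Q in near X P. g Q = f Q \<Longrightarrow> g \<in> J"
  unfolding germ_ideal_def by blast+

lemma germ_ideal_sum:
  "germ_ideal X P J \<Longrightarrow> (\<And>x. x \<in> A \<Longrightarrow> f x \<in> J) \<Longrightarrow> (\<lambda>Q. \<Sum>x\<in>A. f x Q) \<in> J"
  by (induction A rule: infinite_finite_induct) (auto intro: germ_ideal_zero germ_ideal_add)

lemma ideal_atE:
  assumes "f \<in> ideal_at X P G"
  obtains A c where "regular_at X P f" "finite A" "A \<subseteq> G" "\<And>x. x \<in> A \<Longrightarrow> regular_at X P (c x)"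
    "\<forall>\<^sub>F Q in near X P. f Q = (\<Sum>x\<in>A. c x Q * x Q)"
  using assms unfolding ideal_at_def by blast

lemma ideal_atI:
  assumes "regular_at X P f" "finite A" "A \<subseteq> G" "\<And>x. x \<in> A \<Longrightarrow> regular_at X P (c x)"
    "\<forall>\<^sub>F Q in near X P. f Q = (\<Sum>x\<in>A. c x Q * x Q)"
  shows "f \<in> ideal_at X P G"
  using assms unfolding ideal_at_def by blast

lemma germ_ideal_ideal_at:
  assumes "P \<in> X"
  shows "germ_ideal X P (ideal_at X P G)"
  unfolding germ_ideal_def
proof (intro conjI ballI allI impI)
  show "(\<lambda>Q. 0) \<in> ideal_at X P G"
    unfolding ideal_at_def using assms by (auto intro: regular_at_const intro!: exI[of _ "{}"])
next
  fix f g assume fg: "f \<in> ideal_at X P G" "g \<in> ideal_at X P G"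
  from fg(1) obtain A c where f: "regular_at X P f" "finite A" "A \<subseteq> G"
      "\<And>x. x \<in> A \<Longrightarrow> regular_at X P (c x)" "\<forall>\<^sub>F Q in near X P. f Q = (\<Sum>x\<in>A. c x Q * x Q)"
    by (rule ideal_atE) blast
  from fg(2) obtain B d where g: "regular_at X P g" "finite B" "B \<subseteq> G"
      "\<And>x. x \<in> B \<Longrightarrow> regular_at X P (d x)" "\<forall>\<^sub>F Q in near X P. g Q = (\<Sum>x\<in>B. d x Q * x Q)"
    by (rule ideal_atE) blast
  \<comment> \<open>Both coefficient families are extended by 0 to the union of the two finite sets
    of generators.\<close>
  define c' d' where "c' x Q = (if x \<in> A then c x Q else 0)" and "d' x Q = (if x \<in> B then d x Q else 0)" for x Q
  have "(\<Sum>x\<in>A. c x Q * x Q) = (\<Sum>x\<in>A \<union> B. c' x Q * x Q)"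
    "(\<Sum>x\<in>B. d x Q * x Q) = (\<Sum>x\<in>A \<union> B. d' x Q * x Q)" for Q
    using f(2) g(2) by (auto simp: c'_def d'_def intro!: sum.mono_neutral_cong_left)
  moreover have "regular_at X P (c' x)" "regular_at X P (d' x)" for x
    using f(4)[of x] g(4)[of x] regular_at_const[OF assms]
    by (cases "x \<in> A"; cases "x \<in> B"; simp add: c'_def [abs_def] d'_def [abs_def])+
  moreover from f(5) g(5) have "\<forall>\<^sub>F Q in near X P. f Q + g Q = (\<Sum>x\<in>A. c x Q * x Q) + (\<Sum>x\<in>B. d x Q * x Q)"
    by eventually_elim simp
  ultimately show "(\<lambda>Q. f Q + g Q) \<in> ideal_at X P G"
    using f(1,2,3) g(1,2,3)
    by (intro ideal_atI[where A = "A \<union> B" and c = "\<lambda>x Q. c' x Q + d' x Q"])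
      (auto intro: regular_at_add simp: distrib_right sum.distrib)
next
  fix e f assume e: "regular_at X P e" and "f \<in> ideal_at X P G"
  from this(2) obtain A c where f: "regular_at X P f" "finite A" "A \<subseteq> G"
      "\<And>x. x \<in> A \<Longrightarrow> regular_at X P (c x)" "\<forall>\<^sub>F Q in near X P. f Q = (\<Sum>x\<in>A. c x Q * x Q)"
    by (rule ideal_atE) blast
  from f(5) have "\<forall>\<^sub>F Q in near X P. e Q * f Q = (\<Sum>x\<in>A. (e Q * c x Q) * x Q)"
    by eventually_elim (simp add: sum_distrib_left mult.assoc)
  with f e show "(\<lambda>Q. e Q * f Q) \<in> ideal_at X P G"
    by (intro ideal_atI[where A = A and c = "\<lambda>x Q. e Q * c x Q"] regular_at_mult) auto
next
  fix f g assume "f \<in> ideal_at X P G" and g: "\<forall>\<^sub>F Q in near X P. g Q = f Q"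
  from this(1) obtain A c where f: "regular_at X P f" "finite A" "A \<subseteq> G"
      "\<And>x. x \<in> A \<Longrightarrow> regular_at X P (c x)" "\<forall>\<^sub>F Q in near X P. f Q = (\<Sum>x\<in>A. c x Q * x Q)"
    by (rule ideal_atE) blast
  from g f(5) have "\<forall>\<^sub>F Q in near X P. g Q = (\<Sum>x\<in>A. c x Q * x Q)"
    by eventually_elim simp
  with f g show "g \<in> ideal_at X P G"
    by (intro ideal_atI[OF regular_at_cong[OF f(1) g] f(2,3,4)])
qed (simp add: ideal_at_def)

lemma ideal_at_generator:
  assumes "regular_at X P g" "g \<in> G"
  shows "g \<in> ideal_at X P G"
  using assms regular_at_mem[OF assms(1)]
  by (intro ideal_atI[where A = "{g}" and c = "\<lambda>_ _. 1"] regular_at_const) auto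

lemma ideal_at_least:
  assumes "germ_ideal X P J" "G \<subseteq> J"
  shows "ideal_at X P G \<subseteq> J"
proof
  fix f assume "f \<in> ideal_at X P G"
  then obtain A c where f: "A \<subseteq> G" "\<And>x. x \<in> A \<Longrightarrow> regular_at X P (c x)"
      "\<forall>\<^sub>F Q in near X P. f Q = (\<Sum>x\<in>A. c x Q * x Q)"
    by (rule ideal_atE) blast
  have "(\<lambda>Q. \<Sum>x\<in>A. c x Q * x Q) \<in> J"
    using f(1,2) assms by (intro germ_ideal_sum germ_ideal_mult) auto
  then show "f \<in> J" using f(3) by (rule germ_ideal_cong[OF assms(1)])
qed

lemma ideal_at_finite:
  assumes "finite G" "f \<in> ideal_at X P G" "P \<in> X"
  obtains c where "\<And>x. x \<in> G \<Longrightarrow> regular_at X P (c x)" "\<forall>\<^sub>F Q in near X P. f Q = (\<Sum>x\<in>G. c x Q * x Q)"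
proof -
  from assms(2) obtain A c where f: "A \<subseteq> G" "\<And>x. x \<in> A \<Longrightarrow> regular_at X P (c x)"
      "\<forall>\<^sub>F Q in near X P. f Q = (\<Sum>x\<in>A. c x Q * x Q)"
    by (rule ideal_atE) blast
  define c' where "c' x Q = (if x \<in> A then c x Q else 0)" for x Q
  have "(\<Sum>x\<in>A. c x Q * x Q) = (\<Sum>x\<in>G. c' x Q * x Q)" for Q
    using f(1) assms(1) by (auto simp: c'_def intro!: sum.mono_neutral_cong_left)
  moreover have "regular_at X P (c' x)" for x
    using f(2)[of x] regular_at_const[OF assms(3)] by (cases "x \<in> A") (simp_all add: c'_def [abs_def])
  ultimately show thesis using f(3) by (intro that[of c']) auto
qed

lemma ideal_at_pairE:
  assumes "f \<in> ideal_at X P {g, h}" "P \<in> X"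
  obtains a b where "regular_at X P a" "regular_at X P b" "\<forall>\<^sub>F Q in near X P. f Q = a Q * g Q + b Q * h Q"
proof -
  from assms obtain c where c: "\<And>x. x \<in> {g, h} \<Longrightarrow> regular_at X P (c x)"
    "\<forall>\<^sub>F Q in near X P. f Q = (\<Sum>x\<in>{g, h}. c x Q * x Q)"
    by (rule ideal_at_finite[OF finite.insertI[OF finite.insertI[OF finite.emptyI]]]) blast
  \<comment> \<open>If the two generators coincide, \<open>{g, h}\<close> is a singleton and the sum
    has one term, so the second coefficient is taken to be 0.\<close>
  show thesis
  proof (cases "g = h")
    case True
    then show thesis using c assms(2) by (intro that[of "c g" "\<lambda>_. 0"]) (auto intro: regular_at_const)
  next
    case False
    then show thesis using c by (intro that[of "c g" "c h"]) auto
  qed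
qed

lemma ideal_at_singletonE:
  assumes "f \<in> ideal_at X P {h}" "P \<in> X"
  obtains a where "regular_at X P a" "\<forall>\<^sub>F Q in near X P. f Q = a Q * h Q"
proof -
  from assms obtain c where "\<And>x. x \<in> {h} \<Longrightarrow> regular_at X P (c x)"
    "\<forall>\<^sub>F Q in near X P. f Q = (\<Sum>x\<in>{h}. c x Q * x Q)"
    by (rule ideal_at_finite[OF finite.insertI[OF finite.emptyI]]) blast
  then show thesis by (intro that[of "c h"]) auto
qed

lemma germ_ideal_max_ideal:
  assumes "P \<in> X"
  shows "germ_ideal X P (max_ideal X P)"
  unfolding germ_ideal_def max_ideal_def
  using assms eventually_near_self[OF assms]
  by (auto intro: regular_at_const regular_at_add regular_at_mult regular_at_cong)
    (metis (full_types))

lemma germ_ideal_vanishing: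
  assumes "P \<in> X"
  shows "germ_ideal X P (vanishing_ideal X C P)"
  unfolding germ_ideal_def vanishing_ideal_def
  using assms
  by (auto intro: regular_at_const regular_at_add regular_at_mult regular_at_cong elim: eventually_elim2 eventually_mono)

text \<open>Nakayama's lemma by elimination. In the relation for \<open>y\<close> its own
  coefficient lies in the maximal ideal, so \<open>1 - c y\<close> is invertible and
  \<open>y\<close> can be solved for; substituting into the other relations keeps their shape, with
  one generator fewer.\<close>

lemma nakayama_relations:
  assumes "finite Y" "germ_ideal X P N" "\<And>y. y \<in> Y \<Longrightarrow> regular_at X P y"
    and "\<And>y. y \<in> Y \<Longrightarrow> \<exists>n\<in>N. \<exists>c. (\<forall>z\<in>Y. c z \<in> max_ideal X P) \<and>
      (\<forall>\<^sub>F Q in near X P. y Q = n Q + (\<Sum>z\<in>Y. c z Q * z Q))"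
  shows "Y \<subseteq> N"
  using assms(1,3,4)
proof (induction Y rule: finite_induct)
  case (insert y Y)
  have reg: "regular_at X P z" if "z \<in> insert y Y" for z
    using insert.prems(1) that by blast
  then have P: "P \<in> X" using regular_at_mem by blast
  note max = germ_ideal_max_ideal[OF P]
  obtain n c where n: "n \<in> N" and c: "\<And>z. z \<in> insert y Y \<Longrightarrow> c z \<in> max_ideal X P"
    and y: "\<forall>\<^sub>F Q in near X P. y Q = n Q + (\<Sum>z\<in>insert y Y. c z Q * z Q)"
    using insert.prems(2)[of y] by blast
  define u where "u Q = inverse (1 - c y Q)" for Q
  have cy: "regular_at X P (c y)" "c y P = 0"
    using c[of y] by (auto simp: max_ideal_def)
  then have "regular_at X P (\<lambda>Q. 1 - c y Q)" "1 - c y P \<noteq> 0"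
    by (auto intro: regular_at_diff regular_at_const[OF P])
  from regular_at_inverse[OF this] regular_at_nonzero[OF this]
  have u: "regular_at X P u" "\<forall>\<^sub>F Q in near X P. 1 - c y Q \<noteq> 0"
    by (simp_all add: u_def [abs_def])
  have y': "\<forall>\<^sub>F Q in near X P. y Q = u Q * n Q + (\<Sum>z\<in>Y. (u Q * c z Q) * z Q)"
    using y u(2)
  proof eventually_elim
    case (elim Q)
    then have "y Q * (1 - c y Q) = n Q + (\<Sum>z\<in>Y. c z Q * z Q)"
      using insert.hyps by (simp add: algebra_simps)
    then have "y Q = u Q * (n Q + (\<Sum>z\<in>Y. c z Q * z Q))"
      using elim(2) by (simp add: u_def field_simps)
    then show ?case by (simp add: distrib_left sum_distrib_left mult.assoc)
  qed
  have "Y \<subseteq> N"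
  proof (rule insert.IH)
    fix x assume "x \<in> Y"
    then obtain n' c' where n': "n' \<in> N" and c': "\<And>z. z \<in> insert y Y \<Longrightarrow> c' z \<in> max_ideal X P"
      and x: "\<forall>\<^sub>F Q in near X P. x Q = n' Q + (\<Sum>z\<in>insert y Y. c' z Q * z Q)"
      using insert.prems(2)[of x] by blast
    have c'y: "regular_at X P (c' y)"
      using c'[of y] by (auto simp: max_ideal_def)
    show "\<exists>n\<in>N. \<exists>c. (\<forall>z\<in>Y. c z \<in> max_ideal X P) \<and> (\<forall>\<^sub>F Q in near X P. x Q = n Q + (\<Sum>z\<in>Y. c z Q * z Q))"
    proof (intro bexI exI conjI ballI)
      show "(\<lambda>Q. n' Q + c' y Q * (u Q * n Q)) \<in> N"
        using n n' c'y u(1) assms(2) by (intro germ_ideal_add germ_ideal_mult) auto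
      show "(\<lambda>Q. c' z Q + c' y Q * (u Q * c z Q)) \<in> max_ideal X P" if "z \<in> Y" for z
        using c[of z] c'[of z] that c'y u(1) max by (intro germ_ideal_add germ_ideal_mult) auto
      show "\<forall>\<^sub>F Q in near X P. x Q = n' Q + c' y Q * (u Q * n Q) +
          (\<Sum>z\<in>Y. (c' z Q + c' y Q * (u Q * c z Q)) * z Q)"
        using x y'
      proof eventually_elim
        case (elim Q)
        have "x Q = n' Q + c' y Q * y Q + (\<Sum>z\<in>Y. c' z Q * z Q)"
          using elim(1) insert.hyps by simp
        also have "c' y Q * y Q = c' y Q * (u Q * n Q) + (\<Sum>z\<in>Y. c' y Q * (u Q * c z Q) * z Q)"
          by (subst elim(2)) (simp add: distrib_left sum_distrib_left mult.assoc)
        finally show ?case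
          by (simp add: distrib_right sum.distrib)
      qed
    qed
  qed (use reg in auto)
  moreover have "(\<lambda>Q. u Q * n Q + (\<Sum>z\<in>Y. (u Q * c z Q) * z Q)) \<in> N"
    using n u(1) c \<open>Y \<subseteq> N\<close> assms(2)
    by (intro germ_ideal_add germ_ideal_sum germ_ideal_mult regular_at_mult) (auto simp: max_ideal_def)
  then have "y \<in> N" using y' by (rule germ_ideal_cong[OF assms(2)])
  ultimately show ?case by blast
qed simp

lemma nakayama:
  assumes "finite Y" "germ_ideal X P N" "\<And>y. y \<in> Y \<Longrightarrow> regular_at X P y" "P \<in> X"
    and "\<And>y. y \<in> Y \<Longrightarrow> \<exists>n\<in>N. \<exists>z\<in>ideal_at X P {(\<lambda>Q. f Q * g Q) | f g. f \<in> max_ideal X P \<and> g \<in> ideal_at X P Y}.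
      \<forall>\<^sub>F Q in near X P. y Q = n Q + z Q"
  shows "ideal_at X P Y \<subseteq> N"
proof -
  note max = germ_ideal_max_ideal[OF assms(4)]
  \<comment> \<open>The combinations of \<open>Y\<close> with coefficients in the maximal ideal.
    They form an ideal that contains the generating products, hence the whole product ideal, whose
    elements thereby get coefficients of the kind that the elimination requires.\<close>
  define M where "M = {x. regular_at X P x \<and> (\<exists>c. (\<forall>y\<in>Y. c y \<in> max_ideal X P) \<and>
    (\<forall>\<^sub>F Q in near X P. x Q = (\<Sum>y\<in>Y. c y Q * y Q)))}"
  have "germ_ideal X P M"
    unfolding germ_ideal_def
  proof (intro conjI ballI allI impI)
    show "(\<lambda>Q. 0) \<in> M"
      unfolding M_def using assms(4) germ_ideal_zero[OF max]
      by (auto intro: regular_at_const intro!: exI[of _ "\<lambda>_ _. 0"])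
  next
    fix f g assume "f \<in> M" "g \<in> M"
    then obtain c d where *: "regular_at X P f" "\<forall>y\<in>Y. c y \<in> max_ideal X P"
        "\<forall>\<^sub>F Q in near X P. f Q = (\<Sum>y\<in>Y. c y Q * y Q)"
        "regular_at X P g" "\<forall>y\<in>Y. d y \<in> max_ideal X P"
        "\<forall>\<^sub>F Q in near X P. g Q = (\<Sum>y\<in>Y. d y Q * y Q)"
      unfolding M_def by auto
    from *(3,6) have "\<forall>\<^sub>F Q in near X P. f Q + g Q = (\<Sum>y\<in>Y. (c y Q + d y Q) * y Q)"
      by eventually_elim (simp add: distrib_right sum.distrib)
    with * show "(\<lambda>Q. f Q + g Q) \<in> M"
      unfolding M_def using germ_ideal_add[OF max]
      by (auto intro!: regular_at_add exI[of _ "\<lambda>y Q. c y Q + d y Q"])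
  next
    fix e f assume e: "regular_at X P e" and "f \<in> M"
    then obtain c where *: "regular_at X P f" "\<forall>y\<in>Y. c y \<in> max_ideal X P"
        "\<forall>\<^sub>F Q in near X P. f Q = (\<Sum>y\<in>Y. c y Q * y Q)"
      unfolding M_def by auto
    from *(3) have "\<forall>\<^sub>F Q in near X P. e Q * f Q = (\<Sum>y\<in>Y. (e Q * c y Q) * y Q)"
      by eventually_elim (simp add: sum_distrib_left mult.assoc)
    with * e show "(\<lambda>Q. e Q * f Q) \<in> M"
      unfolding M_def using germ_ideal_mult[OF max e]
      by (auto intro!: regular_at_mult exI[of _ "\<lambda>y Q. e Q * c y Q"])
  next
    fix f g assume "f \<in> M" and g: "\<forall>\<^sub>F Q in near X P. g Q = f Q"
    then obtain c where *: "regular_at X P f" "\<forall>y\<in>Y. c y \<in> max_ideal X P"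
        "\<forall>\<^sub>F Q in near X P. f Q = (\<Sum>y\<in>Y. c y Q * y Q)"
      unfolding M_def by auto
    from *(3) g have "\<forall>\<^sub>F Q in near X P. g Q = (\<Sum>y\<in>Y. c y Q * y Q)"
      by eventually_elim simp
    with * regular_at_cong[OF *(1) g] show "g \<in> M"
      unfolding M_def by blast
  qed (simp add: M_def)
  moreover have "{(\<lambda>Q. f Q * g Q) | f g. f \<in> max_ideal X P \<and> g \<in> ideal_at X P Y} \<subseteq> M"
  proof clarify
    fix f g assume f: "f \<in> max_ideal X P" and g: "g \<in> ideal_at X P Y"
    from assms(1) g assms(4) obtain c where c: "\<And>x. x \<in> Y \<Longrightarrow> regular_at X P (c x)"
      "\<forall>\<^sub>F Q in near X P. g Q = (\<Sum>x\<in>Y. c x Q * x Q)"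
      by (rule ideal_at_finite) blast
    from c(2) have "\<forall>\<^sub>F Q in near X P. f Q * g Q = (\<Sum>x\<in>Y. (c x Q * f Q) * x Q)"
      by eventually_elim (simp add: sum_distrib_left mult_ac)
    moreover have "regular_at X P (\<lambda>Q. f Q * g Q)"
      using f g by (auto simp: max_ideal_def ideal_at_def intro: regular_at_mult)
    ultimately show "(\<lambda>Q. f Q * g Q) \<in> M"
      unfolding M_def using germ_ideal_mult[OF max c(1) f]
      by (auto intro!: exI[of _ "\<lambda>x Q. c x Q * f Q"])
  qed
  ultimately have M: "ideal_at X P {(\<lambda>Q. f Q * g Q) | f g. f \<in> max_ideal X P \<and> g \<in> ideal_at X P Y} \<subseteq> M"
    by (rule ideal_at_least)
  have "Y \<subseteq> N"
  proof (rule nakayama_relations[OF assms(1,2,3)])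
    fix y assume "y \<in> Y"
    from assms(5)[OF this] M obtain n z where nz: "n \<in> N" "z \<in> M" "\<forall>\<^sub>F Q in near X P. y Q = n Q + z Q"
      by blast
    from nz(2) obtain c where c: "\<forall>y\<in>Y. c y \<in> max_ideal X P"
        "\<forall>\<^sub>F Q in near X P. z Q = (\<Sum>y\<in>Y. c y Q * y Q)"
      unfolding M_def by auto
    from nz(3) c(2) have "\<forall>\<^sub>F Q in near X P. y Q = n Q + (\<Sum>y\<in>Y. c y Q * y Q)"
      by eventually_elim simp
    with nz(1) c(1) show "\<exists>n\<in>N. \<exists>c. (\<forall>z\<in>Y. c z \<in> max_ideal X P) \<and>
        (\<forall>\<^sub>F Q in near X P. y Q = n Q + (\<Sum>z\<in>Y. c z Q * z Q))"
      by blast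
  qed
  then show ?thesis by (rule ideal_at_least[OF assms(2)])
qed

end

section \<open>Morphisms and retractions\<close>

lemma morphism_mem:
  assumes "morphism X Y f" "X \<subseteq> proj_space" "Y \<subseteq> proj_space" "P \<in> X"
  shows "f P \<in> Y"
  using assms unfolding morphism_def continuous_map_def by auto

lemma morphism_near:
  assumes "morphism X Y f" "X \<subseteq> proj_space" "Y \<subseteq> proj_space" "P \<in> X"
    and "\<forall>\<^sub>F Q in near Y (f P). R Q"
  shows "\<forall>\<^sub>F Q in near X P. R (f Q)"
proof -
  interpret X: proj_subset X using assms(2) by unfold_locales
  interpret Y: proj_subset Y using assms(3) by unfold_locales
  from assms(5) obtain U where U: "openin (ztop Y) U" "f P \<in> U" "\<forall>Q\<in>U. R Q"
    using morphism_mem[OF assms(1-4)] by (auto simp: Y.eventually_near)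
  have "openin (ztop X) {Q \<in> topspace (ztop X). f Q \<in> U}"
    using assms(1) U(1) unfolding morphism_def by (blast intro: openin_continuous_map_preimage)
  then have "openin (ztop X) {Q \<in> X. f Q \<in> U}"
    unfolding X.topspace_ztop .
  with U(2,3) assms(4) show ?thesis
    by (subst X.eventually_near) (auto intro!: exI[of _ "{Q \<in> X. f Q \<in> U}"])
qed

text \<open>The definition of \<open>morphism\<close> speaks of functions regular on an open set; a
  function regular at one point is regular on a neighbourhood, which supplies that set.\<close>

lemma morphism_regular:
  assumes "morphism X Y f" "X \<subseteq> proj_space" "Y \<subseteq> proj_space" "P \<in> X" "regular_at Y (f P) h"
  shows "regular_at X P (\<lambda>Q. h (f Q))"
proof -
  interpret Y: proj_subset Y using assms(3) by unfold_locales
  from Y.regular_at_near[OF assms(5)] obtain U where "openin (ztop Y) U" "f P \<in> U" "regular_on Y U h"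
    using morphism_mem[OF assms(1-4)] by (auto simp: Y.eventually_near regular_on_def)
  with assms(1,4) have "regular_at X P (h \<circ> f)"
    unfolding morphism_def by (auto simp: regular_on_def)
  then show ?thesis by (simp add: o_def)
qed

lemma morphism_compose:
  assumes "morphism X Y f" "morphism Y Z g" "X \<subseteq> proj_space" "Y \<subseteq> proj_space"
  shows "morphism X Z (\<lambda>P. g (f P))"
proof -
  have "continuous_map (ztop X) (ztop Z) (g \<circ> f)"
    using assms unfolding morphism_def by (blast intro: continuous_map_compose)
  moreover have "regular_on X {P \<in> X. g (f P) \<in> V} (h \<circ> (\<lambda>P. g (f P)))"
    if "openin (ztop Z) V" "regular_on Z V h" for V h
  proof -
    have "topspace (ztop Y) = Y" using assms(4) by auto
    moreover have "openin (ztop Y) {P \<in> topspace (ztop Y). g P \<in> V}"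
      using assms(2) that(1) unfolding morphism_def by (blast intro: openin_continuous_map_preimage)
    ultimately have "openin (ztop Y) {P \<in> Y. g P \<in> V}"
      by simp
    moreover have "regular_on Y {P \<in> Y. g P \<in> V} (h \<circ> g)"
      using assms(2) that unfolding morphism_def by blast
    ultimately have "regular_on X {P \<in> X. f P \<in> {P \<in> Y. g P \<in> V}} ((h \<circ> g) \<circ> f)"
      using assms(1) unfolding morphism_def by blast
    moreover have "{P \<in> X. f P \<in> {P \<in> Y. g P \<in> V}} = {P \<in> X. g (f P) \<in> V}"
      using morphism_mem[OF assms(1,3,4)] by auto
    ultimately show ?thesis by (simp add: o_def)
  qed
  ultimately show ?thesis
    unfolding morphism_def by (simp add: o_def)
qed

context proj_subset
begin

lemma morphism_const: "P \<in> X \<Longrightarrow> morphism X X (\<lambda>Q. P)"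
  unfolding morphism_def regular_on_def using subset by (auto simp: o_def intro: regular_at_const)

text \<open>The functions \<open>f\<close> satisfying the conclusion form a subring closed under inverses,
  by the Leibniz rule \<open>fg - f'g' = f (g - g') + g' (f - f')\<close>.\<close>

lemma diff_retraction_in_ideal:
  assumes "morphism X X r" "r P = P" "v \<in> P" "v $ k \<noteq> 0" "regular_at X P f"
  shows "(\<lambda>Q. f Q - f (r Q)) \<in> ideal_at X P (range (\<lambda>i Q. affine_coord k i Q - affine_coord k i (r Q)))"
    (is "_ \<in> ?I")
proof -
  have P: "P \<in> X" using assms(5) by (rule regular_at_mem)
  note I = germ_ideal_ideal_at[OF P, of "range (\<lambda>i Q. affine_coord k i Q - affine_coord k i (r Q))"]
  have reg: "regular_at X P (\<lambda>Q. f (r Q))" if "regular_at X P f" for f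
    using morphism_regular[OF assms(1) subset subset P] that assms(2) by simp
  have near: "\<forall>\<^sub>F Q in near X P. R (r Q)" if "\<forall>\<^sub>F Q in near X P. R Q" for R
    using morphism_near[OF assms(1) subset subset P] that assms(2) by simp
  have "regular_at X P f \<and> (\<lambda>Q. f Q - f (r Q)) \<in> ?I"
    using assms(5,3,4)
  proof (induction f rule: regular_at_induct)
    case (const c)
    then show ?case using P germ_ideal_zero[OF I] by (simp add: regular_at_const)
  next
    case (coord i)
    have "regular_at X P (affine_coord k i)"
      using P assms(3,4) by (rule regular_at_affine_coord)
    then show ?case
      by (auto intro!: ideal_at_generator regular_at_diff reg)
  next
    case (add f g)
    then have "(\<lambda>Q. (f Q - f (r Q)) + (g Q - g (r Q))) \<in> ?I"
      by (intro germ_ideal_add[OF I]) auto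
    with add show ?case by (auto intro: regular_at_add simp: algebra_simps)
  next
    case (mult f g)
    then have "(\<lambda>Q. f Q * (g Q - g (r Q)) + g (r Q) * (f Q - f (r Q))) \<in> ?I"
      by (intro germ_ideal_add[OF I] germ_ideal_mult[OF I] reg) auto
    with mult show ?case by (auto intro: regular_at_mult simp: algebra_simps)
  next
    case (inverse f)
    then have f: "regular_at X P f" "f P \<noteq> 0" "f (r P) \<noteq> 0" using assms(2) by auto
    have "(\<lambda>Q. (- 1 * (inverse (f Q) * inverse (f (r Q)))) * (f Q - f (r Q))) \<in> ?I"
      using inverse.IH f
      by (intro germ_ideal_mult[OF I] regular_at_mult regular_at_const P regular_at_inverse reg) auto
    \<comment> \<open>The identity can fail where \<open>f\<close> or its pullback vanishes, as the
      inverse of 0 is 0; both are nonzero at \<open>P\<close>, which \<open>r\<close> fixes, hence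
      near \<open>P\<close>.\<close>
    moreover have "\<forall>\<^sub>F Q in near X P. inverse (f Q) - inverse (f (r Q)) =
        (- 1 * (inverse (f Q) * inverse (f (r Q)))) * (f Q - f (r Q))"
      using regular_at_nonzero[OF f(1,2)] near[OF regular_at_nonzero[OF f(1,2)]]
      by eventually_elim (simp add: field_simps)
    ultimately show ?case using regular_at_inverse[OF f(1,2)] by (auto intro: germ_ideal_cong[OF I])
  next
    case (cong f g)
    from cong(2) near[OF cong(2)]
    have "\<forall>\<^sub>F Q in near X P. g Q - g (r Q) = f Q - f (r Q)"
      by eventually_elim simp
    with cong show ?case by (auto intro: germ_ideal_cong[OF I] regular_at_cong)
  qed
  then show ?thesis ..
qed

text \<open>The constant map to \<open>P\<close> is a retraction too, and
  \<open>f - f \<circ> r\<close> is then \<open>f - f P\<close>, which is \<open>f\<close> itself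
  when \<open>f\<close> vanishes at \<open>P\<close>.\<close>

lemma max_ideal_eq:
  assumes "P \<in> X" "v \<in> P" "v $ k \<noteq> 0"
  shows "max_ideal X P = ideal_at X P (range (\<lambda>i Q. affine_coord k i Q - affine_coord k i P))"
proof
  show "max_ideal X P \<subseteq> ideal_at X P (range (\<lambda>i Q. affine_coord k i Q - affine_coord k i P))"
    using diff_retraction_in_ideal[OF morphism_const[OF assms(1)] refl assms(2,3)]
    by (fastforce simp: max_ideal_def)
  show "ideal_at X P (range (\<lambda>i Q. affine_coord k i Q - affine_coord k i P)) \<subseteq> max_ideal X P"
    using assms
    by (intro ideal_at_least germ_ideal_max_ideal)
      (auto simp: max_ideal_def intro!: regular_at_diff regular_at_affine_coord regular_at_const)
qed

end

section \<open>Sums and preimages of ideals\<close>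

context proj_subset
begin

lemma germ_ideal_plus:
  assumes "germ_ideal X P I" "germ_ideal X P J" "P \<in> X"
  shows "germ_ideal X P {f. \<exists>g\<in>I. \<exists>h\<in>J. \<forall>\<^sub>F Q in near X P. f Q = g Q + h Q}"
    (is "germ_ideal X P ?S")
  unfolding germ_ideal_def
proof (intro conjI ballI allI impI)
  fix f assume "f \<in> ?S"
  then obtain g h where *: "g \<in> I" "h \<in> J" "\<forall>\<^sub>F Q in near X P. f Q = g Q + h Q" by blast
  have "regular_at X P (\<lambda>Q. g Q + h Q)"
    using * assms by (blast intro: regular_at_add germ_ideal_regular)
  then show "regular_at X P f" using *(3) by (rule regular_at_cong)
next
  show "(\<lambda>Q. 0) \<in> ?S"
    using germ_ideal_zero[OF assms(1)] germ_ideal_zero[OF assms(2)]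
    by (intro CollectI bexI[of _ "\<lambda>Q. 0"]) auto
next
  fix f f' assume ff': "f \<in> ?S" "f' \<in> ?S"
  from ff'(1) obtain g h where *: "g \<in> I" "h \<in> J" "\<forall>\<^sub>F Q in near X P. f Q = g Q + h Q" by blast
  from ff'(2) obtain g' h' where **: "g' \<in> I" "h' \<in> J" "\<forall>\<^sub>F Q in near X P. f' Q = g' Q + h' Q" by blast
  from *(3) **(3) have "\<forall>\<^sub>F Q in near X P. f Q + f' Q = (g Q + g' Q) + (h Q + h' Q)"
    by eventually_elim simp
  with germ_ideal_add[OF assms(1) *(1) **(1)] germ_ideal_add[OF assms(2) *(2) **(2)]
  show "(\<lambda>Q. f Q + f' Q) \<in> ?S" by (intro CollectI bexI)
next
  fix c f assume c: "regular_at X P c" and "f \<in> ?S"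
  then obtain g h where *: "g \<in> I" "h \<in> J" "\<forall>\<^sub>F Q in near X P. f Q = g Q + h Q" by blast
  from *(3) have "\<forall>\<^sub>F Q in near X P. c Q * f Q = c Q * g Q + c Q * h Q"
    by eventually_elim (simp add: distrib_left)
  with germ_ideal_mult[OF assms(1) c *(1)] germ_ideal_mult[OF assms(2) c *(2)]
  show "(\<lambda>Q. c Q * f Q) \<in> ?S" by (intro CollectI bexI)
next
  fix f f' assume "f \<in> ?S" and f': "\<forall>\<^sub>F Q in near X P. f' Q = f Q"
  then obtain g h where *: "g \<in> I" "h \<in> J" "\<forall>\<^sub>F Q in near X P. f Q = g Q + h Q" by blast
  from f' *(3) have "\<forall>\<^sub>F Q in near X P. f' Q = g Q + h Q"
    by eventually_elim simp
  with * show "f' \<in> ?S" by blast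
qed

lemma germ_ideal_plus_left:
  assumes "germ_ideal X P J" "f \<in> I"
  shows "f \<in> {f. \<exists>g\<in>I. \<exists>h\<in>J. \<forall>\<^sub>F Q in near X P. f Q = g Q + h Q}"
  using assms(2) germ_ideal_zero[OF assms(1)]
  by (intro CollectI bexI[of _ f] bexI[of _ "\<lambda>Q. 0"]) auto

lemma germ_ideal_plus_right:
  assumes "germ_ideal X P I" "f \<in> J"
  shows "f \<in> {f. \<exists>g\<in>I. \<exists>h\<in>J. \<forall>\<^sub>F Q in near X P. f Q = g Q + h Q}"
  using assms(2) germ_ideal_zero[OF assms(1)]
  by (intro CollectI bexI[of _ f] bexI[of _ "\<lambda>Q. 0"]) auto

end

text \<open>Preimage of an ideal under the homomorphism of local rings induced by \<open>s\<close>.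
  It serves to show that pulling back along a section maps the square of one maximal ideal into the
  square of the other.\<close>

lemma germ_ideal_pullback:
  assumes "morphism Y X s" "Y \<subseteq> proj_space" "X \<subseteq> proj_space" "a \<in> Y" "germ_ideal Y a I"
  shows "germ_ideal X (s a) {f. regular_at X (s a) f \<and> (\<lambda>b. f (s b)) \<in> I}"
proof -
  interpret X: proj_subset X using assms(3) by unfold_locales
  interpret Y: proj_subset Y using assms(2) by unfold_locales
  have sa: "s a \<in> X" by (rule morphism_mem[OF assms(1-4)])
  note reg = morphism_regular[OF assms(1-4)] and near = morphism_near[OF assms(1-4)]
  show ?thesis
    unfolding germ_ideal_def
    using X.regular_at_const[OF sa] Y.germ_ideal_zero[OF assms(5)] Y.germ_ideal_add[OF assms(5)]
      Y.germ_ideal_mult[OF assms(5) reg]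
    by (auto intro: X.regular_at_add X.regular_at_mult X.regular_at_cong Y.germ_ideal_cong[OF assms(5)] near)
qed

section \<open>Irreducibility and local equations of divisors\<close>

locale proj_variety =
  fixes X :: "('k::field, 'n::finite) ppoint set"
  assumes irreducible: "irreducible_closed X"

sublocale proj_variety \<subseteq> proj_subset
proof
  have "closedin zariski X" using irreducible unfolding irreducible_closed_def by blast
  then show "X \<subseteq> proj_space" using closedin_subset[of zariski X] by simp
qed

context proj_variety
begin

text \<open>Otherwise the complements of the two open sets would cover the irreducible
  \<open>X\<close>.\<close>

lemma opens_meet:
  assumes "openin (ztop X) U" "U \<noteq> {}" "openin (ztop X) V" "V \<noteq> {}"
  shows "U \<inter> V \<noteq> {}"
proof
  assume empty: "U \<inter> V = {}"
  obtain U' V' where U': "openin zariski U'" "U = U' \<inter> X" and V': "openin zariski V'" "V = V' \<inter> X"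
    using assms(1,3) unfolding openin_subtopology by blast
  have "closedin zariski (proj_space - U')" "closedin zariski (proj_space - V')"
    using U'(1) V'(1) by (metis openin_closedin_eq topspace_zariski)+
  moreover have "X \<subseteq> (proj_space - U') \<union> (proj_space - V')"
    using empty subset U'(2) V'(2) by blast
  ultimately have "X \<subseteq> proj_space - U' \<or> X \<subseteq> proj_space - V'"
    using irreducible unfolding irreducible_closed_def by blast
  then show False using assms(2,4) U'(2) V'(2) by blast
qed

lemma generically_conj:
  assumes "generically X R" "generically X S"
  shows "generically X (\<lambda>Q. R Q \<and> S Q)"
proof -
  obtain U V where "openin (ztop X) U" "U \<noteq> {}" "\<forall>Q\<in>U. R Q" "openin (ztop X) V" "V \<noteq> {}" "\<forall>Q\<in>V. S Q"
    using assms unfolding generically_def by blast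
  then show ?thesis
    unfolding generically_def using opens_meet[of U V] by (intro exI[of _ "U \<inter> V"]) auto
qed

lemma generically_mono: "generically X R \<Longrightarrow> (\<And>Q. R Q \<Longrightarrow> S Q) \<Longrightarrow> generically X S"
  unfolding generically_def by blast

lemma near_imp_generically: "P \<in> X \<Longrightarrow> \<forall>\<^sub>F Q in near X P. R Q \<Longrightarrow> generically X R"
  unfolding eventually_near generically_def by blast

text \<open>A nearby point with nonzero value would have an open set of such points, which meets the
  open set of zeros by irreducibility. Through this, the generic equalities in
  \<open>unit_coset\<close> become equalities of germs between regular functions.\<close>

lemma regular_generically_zero:
  assumes "regular_at X P f" "generically X (\<lambda>Q. f Q = 0)"
  shows "\<forall>\<^sub>F Q in near X P. f Q = 0"
proof -
  have P: "P \<in> X" using assms(1) by (rule regular_at_mem)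
  from regular_at_near[OF assms(1)] obtain U where
    U: "openin (ztop X) U" "P \<in> U" "\<forall>Q\<in>U. regular_at X Q f"
    by (auto simp: eventually_near[OF P])
  from assms(2) obtain V where V: "openin (ztop X) V" "V \<noteq> {}" "\<forall>Q\<in>V. f Q = 0"
    unfolding generically_def by blast
  have "f Q = 0" if "Q \<in> U" for Q
  proof (rule ccontr)
    assume "f Q \<noteq> 0"
    moreover have "regular_at X Q f" using U(3) that by blast
    ultimately have "\<forall>\<^sub>F Q in near X Q. f Q \<noteq> 0" by (rule regular_at_nonzero[rotated])
    then obtain W where "openin (ztop X) W" "Q \<in> W" "\<forall>Q\<in>W. f Q \<noteq> 0"
      using regular_at_mem[OF \<open>regular_at X Q f\<close>] by (auto simp: eventually_near)
    then show False using opens_meet[of W V] V by blast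
  qed
  with U(1,2) show ?thesis by (auto simp: eventually_near[OF P])
qed

lemma regular_generically_eq:
  assumes "regular_at X P f" "regular_at X P g" "generically X (\<lambda>Q. f Q = g Q)"
  shows "\<forall>\<^sub>F Q in near X P. f Q = g Q"
  using regular_generically_zero[OF regular_at_diff[OF assms(1,2)]] assms(3) by simp

lemma nonzero_rational_near:
  assumes "regular_at X P f" "nonzero_rational X f"
  shows "\<not> (\<forall>\<^sub>F Q in near X P. f Q = 0)"
proof
  assume "\<forall>\<^sub>F Q in near X P. f Q = 0"
  then have "generically X (\<lambda>Q. f Q = 0 \<and> f Q \<noteq> 0)"
    using near_imp_generically[OF regular_at_mem[OF assms(1)]] assms(2) generically_conj
    unfolding nonzero_rational_def by blast
  then show False unfolding generically_def by blast
qed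

lemma nonzero_rationalI:
  assumes "regular_at X P f" "generically X (\<lambda>Q. f Q \<noteq> 0)"
  shows "nonzero_rational X f"
  using assms unfolding nonzero_rational_def by blast

lemma nonzero_rational_regularI:
  assumes "regular_at X P f" "\<not> (\<forall>\<^sub>F Q in near X P. f Q = 0)"
  shows "nonzero_rational X f"
proof -
  from regular_at_near[OF assms(1)] obtain U where
    U: "openin (ztop X) U" "P \<in> U" "\<forall>Q\<in>U. regular_at X Q f"
    by (auto simp: eventually_near[OF regular_at_mem[OF assms(1)]])
  with assms(2) obtain Q where Q: "Q \<in> U" "f Q \<noteq> 0"
    by (auto simp: eventually_near[OF regular_at_mem[OF assms(1)]])
  then have "generically X (\<lambda>Q. f Q \<noteq> 0)"
    using U(3) near_imp_generically regular_at_nonzero regular_at_mem by blast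
  with assms(1) show ?thesis by (rule nonzero_rationalI)
qed

section \<open>Local equations modulo units\<close>

lemma unit_coset_self:
  assumes "nonzero_rational X f" "P \<in> X"
  shows "f \<in> unit_coset X P f"
proof -
  have "generically X (\<lambda>Q. f Q = 1 * f Q)"
    using near_imp_generically[OF assms(2), of "\<lambda>_. True"] by simp
  with assms show ?thesis
    unfolding unit_coset_def by (auto intro!: exI[of _ "\<lambda>_. 1"] regular_at_const)
qed

lemma unit_coset_subset:
  assumes "regular_at X P u" "u P \<noteq> 0" "generically X (\<lambda>Q. g Q = u Q * f Q)"
  shows "unit_coset X P g \<subseteq> unit_coset X P f"
proof
  fix h assume "h \<in> unit_coset X P g"
  then obtain w where w: "nonzero_rational X h" "regular_at X P w" "w P \<noteq> 0"
      "generically X (\<lambda>Q. h Q = w Q * g Q)"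
    unfolding unit_coset_def by blast
  have "generically X (\<lambda>Q. h Q = (w Q * u Q) * f Q)"
    using generically_conj[OF w(4) assms(3)] by (rule generically_mono) (simp add: mult.assoc)
  moreover have "regular_at X P (\<lambda>Q. w Q * u Q)" "w P * u P \<noteq> 0"
    using w assms by (auto intro: regular_at_mult)
  ultimately show "h \<in> unit_coset X P f"
    using w(1) unfolding unit_coset_def by blast
qed

lemma unit_coset_eq:
  assumes "regular_at X P u" "u P \<noteq> 0" "generically X (\<lambda>Q. g Q = u Q * f Q)"
  shows "unit_coset X P g = unit_coset X P f"
proof
  have "generically X (\<lambda>Q. u Q \<noteq> 0)"
    using near_imp_generically[OF regular_at_mem] regular_at_nonzero assms(1,2) by blast
  from generically_conj[OF this assms(3)] have "generically X (\<lambda>Q. f Q = inverse (u Q) * g Q)"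
    by (rule generically_mono) simp
  then show "unit_coset X P f \<subseteq> unit_coset X P g"
    using assms(2) regular_at_inverse[OF assms(1,2)] by (intro unit_coset_subset) auto
qed (rule unit_coset_subset[OF assms])

lemma unit_coset_unit:
  assumes "regular_at X P u" "u P \<noteq> 0"
  shows "unit_coset X P u = unit_coset X P (\<lambda>_. 1)"
proof (rule unit_coset_eq[OF assms])
  show "generically X (\<lambda>Q. u Q = u Q * 1)"
    using near_imp_generically[OF regular_at_mem[OF assms(1)], of "\<lambda>_. True"] by simp
qed

lemma unit_coset_regularE:
  assumes "g \<in> unit_coset X P f" "regular_at X P f" "regular_at X P g"
  obtains u where "regular_at X P u" "u P \<noteq> 0" "\<forall>\<^sub>F Q in near X P. g Q = u Q * f Q"
  using assms regular_generically_eq[OF assms(3) regular_at_mult]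
  unfolding unit_coset_def by blast

end

text \<open>The divisor with local equations generating the ideal of \<open>C\<close>; its value at a point is empty if
  that ideal is not principal.\<close>

definition ideal_divisor ::
  "('k::field, 'n::finite) ppoint set \<Rightarrow> ('k, 'n) ppoint set \<Rightarrow> ('k, 'n) divisor" where
  "ideal_divisor X C P = (if P \<in> X then
     \<Union>h \<in> {h. regular_at X P h \<and> nonzero_rational X h \<and> ideal_at X P {h} = vanishing_ideal X C P}.
       unit_coset X P h else {})"

context proj_variety
begin

text \<open>From \<open>g = u h\<close> and \<open>h = w g\<close> follows
  \<open>(1 - w u) h = 0\<close>. If \<open>u\<close> vanished at \<open>P\<close>, then
  \<open>1 - w u\<close> would be a unit and \<open>h\<close> the zero germ. This makes the union in
  \<open>ideal_divisor\<close> a single coset.\<close>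

lemma principal_generators_associated:
  assumes "regular_at X P g" "regular_at X P h" "nonzero_rational X h" "ideal_at X P {g} = ideal_at X P {h}"
  shows "unit_coset X P g = unit_coset X P h"
proof -
  have P: "P \<in> X" using assms(1) by (rule regular_at_mem)
  have gh: "g \<in> ideal_at X P {h}" "h \<in> ideal_at X P {g}"
    using ideal_at_generator[OF assms(1), of "{g}"] ideal_at_generator[OF assms(2), of "{h}"] assms(4) by auto
  from gh(1) P obtain u where u: "regular_at X P u" "\<forall>\<^sub>F Q in near X P. g Q = u Q * h Q"
    by (rule ideal_at_singletonE)
  from gh(2) P obtain w where w: "regular_at X P w" "\<forall>\<^sub>F Q in near X P. h Q = w Q * g Q"
    by (rule ideal_at_singletonE)
  have "u P \<noteq> 0"
  proof
    assume "u P = 0"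
    moreover have reg: "regular_at X P (\<lambda>Q. 1 - w Q * u Q)"
      using u(1) w(1) P by (intro regular_at_diff regular_at_mult regular_at_const)
    ultimately have "\<forall>\<^sub>F Q in near X P. 1 - w Q * u Q \<noteq> 0"
      by (intro regular_at_nonzero[OF reg]) simp
    then have "\<forall>\<^sub>F Q in near X P. h Q = 0"
      using u(2) w(2)
    proof eventually_elim
      case (elim Q)
      then have "(1 - w Q * u Q) * h Q = 0" by (simp add: algebra_simps)
      with elim(1) show ?case by simp
    qed
    then show False using nonzero_rational_near[OF assms(2,3)] by blast
  qed
  with u show ?thesis
    using near_imp_generically[OF P u(2)] by (intro unit_coset_eq)
qed

lemma ideal_divisor_eq:
  assumes "regular_at X P h" "nonzero_rational X h" "ideal_at X P {h} = vanishing_ideal X C P"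
  shows "ideal_divisor X C P = unit_coset X P h"
proof -
  have "(\<Union>g \<in> {g. regular_at X P g \<and> nonzero_rational X g \<and> ideal_at X P {g} = vanishing_ideal X C P}.
      unit_coset X P g) = unit_coset X P h" (is "(\<Union>g \<in> ?H. _) = _")
  proof (rule SUP_eq_const)
    have "h \<in> ?H" using assms by simp
    then show "?H \<noteq> {}" by blast
    show "unit_coset X P g = unit_coset X P h" if "g \<in> ?H" for g
      using that assms by (intro principal_generators_associated) simp_all
  qed
  then show ?thesis
    using regular_at_mem[OF assms(1)] by (simp add: ideal_divisor_def)
qed

lemma nonzero_rational_one:
  assumes "P \<in> X"
  shows "nonzero_rational X (\<lambda>_. 1)"
proof (rule nonzero_rationalI[OF regular_at_const[OF assms]])
  show "generically X (\<lambda>Q. (1::'k) \<noteq> 0)"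
    by (rule near_imp_generically[OF assms]) simp
qed

lemma ideal_at_unit:
  assumes "regular_at X P u" "u P \<noteq> 0" "u \<in> G" "regular_at X P f"
  shows "f \<in> ideal_at X P G"
proof (rule germ_ideal_cong[OF germ_ideal_ideal_at[OF regular_at_mem[OF assms(1)]]])
  show "(\<lambda>Q. (f Q * inverse (u Q)) * u Q) \<in> ideal_at X P G"
    using assms regular_at_mem[OF assms(1)]
    by (intro germ_ideal_mult[OF germ_ideal_ideal_at] regular_at_mult regular_at_inverse ideal_at_generator)
  show "\<forall>\<^sub>F Q in near X P. f Q = (f Q * inverse (u Q)) * u Q"
    using regular_at_nonzero[OF assms(1,2)] by eventually_elim simp
qed

lemma ideal_divisor_outside:
  assumes "P \<in> X" "\<forall>\<^sub>F Q in near X P. Q \<notin> C"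
  shows "ideal_divisor X C P = unit_coset X P (\<lambda>_. 1)"
proof (rule ideal_divisor_eq)
  show "ideal_at X P {\<lambda>_. 1} = vanishing_ideal X C P"
  proof
    show "ideal_at X P {\<lambda>_. 1} \<subseteq> vanishing_ideal X C P"
      using assms by (intro ideal_at_least germ_ideal_vanishing)
        (auto simp: vanishing_ideal_def intro: regular_at_const elim: eventually_mono)
    show "vanishing_ideal X C P \<subseteq> ideal_at X P {\<lambda>_. 1}"
      using ideal_at_unit[OF regular_at_const[OF assms(1), of 1]] by (auto simp: vanishing_ideal_def)
  qed
qed (use assms in \<open>auto intro: regular_at_const nonzero_rational_one\<close>)

text \<open>Needed because \<open>local_intersection\<close> ranges over all regular local equations
  of the two divisors, which are determined only up to units.\<close>

lemma ideal_at_pair_associated: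
  assumes "regular_at X P f" "regular_at X P g" "regular_at X P u" "u P \<noteq> 0" "regular_at X P w" "w P \<noteq> 0"
    and "\<forall>\<^sub>F Q in near X P. f' Q = u Q * f Q" "\<forall>\<^sub>F Q in near X P. g' Q = w Q * g Q"
  shows "ideal_at X P {f', g'} = ideal_at X P {f, g}"
proof -
  have P: "P \<in> X" using assms(1) by (rule regular_at_mem)
  have *: "ideal_at X P {f', g'} \<subseteq> ideal_at X P {f, g}"
    if "regular_at X P f" "regular_at X P g" "regular_at X P u" "regular_at X P w"
      and "\<forall>\<^sub>F Q in near X P. f' Q = u Q * f Q" "\<forall>\<^sub>F Q in near X P. g' Q = w Q * g Q" for f g f' g' u w
  proof (rule ideal_at_least[OF germ_ideal_ideal_at[OF P]])
    note I = germ_ideal_ideal_at[OF P, of "{f, g}"]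
    have "(\<lambda>Q. u Q * f Q) \<in> ideal_at X P {f, g}" "(\<lambda>Q. w Q * g Q) \<in> ideal_at X P {f, g}"
      using that(3,4) ideal_at_generator[OF that(1), of "{f, g}"] ideal_at_generator[OF that(2), of "{f, g}"]
      by (auto intro: germ_ideal_mult[OF I])
    then show "{f', g'} \<subseteq> ideal_at X P {f, g}"
      using germ_ideal_cong[OF I _ that(5)] germ_ideal_cong[OF I _ that(6)] by blast
  qed
  have inv: "\<forall>\<^sub>F Q in near X P. f Q = inverse (u Q) * f' Q"
    if "regular_at X P u" "u P \<noteq> 0" "\<forall>\<^sub>F Q in near X P. f' Q = u Q * f Q" for f f' u
    using that(3) regular_at_nonzero[OF that(1,2)] by eventually_elim simp
  have "regular_at X P f'" "regular_at X P g'"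
    using regular_at_cong[OF regular_at_mult[OF assms(3,1)] assms(7)]
      regular_at_cong[OF regular_at_mult[OF assms(5,2)] assms(8)] by auto
  then have "ideal_at X P {f, g} \<subseteq> ideal_at X P {f', g'}"
    using assms by (intro *[where u = "\<lambda>Q. inverse (u Q)" and w = "\<lambda>Q. inverse (w Q)"] inv regular_at_inverse)
  with *[OF assms(1,2,3,5,7,8)] show ?thesis by blast
qed

text \<open>Evaluation at \<open>P\<close> identifies the quotient with the base field. That no
  other \<open>n\<close> qualifies matters for the definite description in
  \<open>local_intersection\<close>.\<close>

lemma quotient_dim_max_ideal:
  assumes "P \<in> X"
  shows "quotient_dim {h. regular_at X P h} (max_ideal X P) n \<longleftrightarrow> n = 1"
proof
  assume "quotient_dim {h. regular_at X P h} (max_ideal X P) n"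
  then obtain B where B: "B \<subseteq> {h. regular_at X P h}" "finite B" "card B = n"
    "\<forall>f\<in>{h. regular_at X P h}. \<exists>c. (\<lambda>x. f x - (\<Sum>g\<in>B. c g * g x)) \<in> max_ideal X P"
    "\<forall>c. (\<lambda>x. \<Sum>g\<in>B. c g * g x) \<in> max_ideal X P \<longrightarrow> (\<forall>g\<in>B. c g = 0)"
    unfolding quotient_dim_def by (elim exE conjE) (rule that)
  have ev: "(\<lambda>x. \<Sum>g\<in>B. c g * g x) \<in> max_ideal X P \<longleftrightarrow> (\<Sum>g\<in>B. c g * g P) = 0" for c
    using B(1) assms
    by (auto simp: max_ideal_def intro!: regular_at_sum regular_at_mult intro: regular_at_const)
  have indep: "\<forall>g\<in>B. c g = 0" if "(\<Sum>g\<in>B. c g * g P) = 0" for c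
    using B(5) ev[of c] that by blast
  have nz: "g P \<noteq> 0" if "g \<in> B" for g
  proof
    assume "g P = 0"
    then have "(\<Sum>f\<in>B. (if f = g then 1 else 0) * f P) = 0"
      by (intro sum.neutral) auto
    from indep[OF this] that show False by auto
  qed
  have "card B \<le> Suc 0"
  proof (subst card_le_Suc0_iff_eq[OF B(2)], intro ballI)
    fix e g assume eg: "e \<in> B" "g \<in> B"
    show "e = g"
    proof (rule ccontr)
      assume ne: "e \<noteq> g"
      \<comment> \<open>The combination \<open>g P * e - e P * g\<close> vanishes at
        \<open>P\<close>, so two distinct basis elements would be dependent.\<close>
      define c where "c f = (if f = e then g P else if f = g then - e P else 0)" for f
      have "(\<Sum>f\<in>B. c f * f P) = (\<Sum>f\<in>{e, g}. c f * f P)"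
        using eg B(2) by (intro sum.mono_neutral_right) (auto simp: c_def)
      also have "\<dots> = 0" using ne by (simp add: c_def)
      finally have "c e = 0" using indep eg(1) by blast
      then show False using nz[OF eg(2)] by (simp add: c_def)
    qed
  qed
  moreover have "B \<noteq> {}"
  proof
    assume "B = {}"
    moreover have "\<exists>c. (\<lambda>x. 1 - (\<Sum>g\<in>B. c g * g x)) \<in> max_ideal X P"
      using bspec[OF B(4), of "\<lambda>_. 1"] regular_at_const[OF assms, of 1] by simp
    ultimately show False by (simp add: max_ideal_def)
  qed
  then have "card B \<noteq> 0" using B(2) by simp
  ultimately show "n = 1" using B(3) by simp
next
  assume "n = 1"
  show "quotient_dim {h. regular_at X P h} (max_ideal X P) n"
    unfolding quotient_dim_def
  proof (intro exI[of _ "{\<lambda>_. 1}"] conjI ballI allI impI)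
    fix f assume "f \<in> {h. regular_at X P h}"
    then show "\<exists>c. (\<lambda>x. f x - (\<Sum>g\<in>{\<lambda>_. 1}. c g * g x)) \<in> max_ideal X P"
      using assms by (intro exI[of _ "\<lambda>_. f P"]) (auto simp: max_ideal_def intro: regular_at_diff regular_at_const)
  qed (use assms \<open>n = 1\<close> in \<open>auto simp: max_ideal_def intro: regular_at_const\<close>)
qed

end

section \<open>The projective line\<close>

interpretation projective: proj_subset "proj_space :: ('k::field, 'n::finite) ppoint set"
  by unfold_locales simp

lemma form_restricted_to_line:
  assumes "F \<in> form d"
  shows "\<exists>p. \<forall>x. poly p x = F (v + x *s w)"
proof -
  from assms obtain c where
    F: "F = (\<lambda>v. \<Sum>m | (\<Sum>i\<in>UNIV. m i) = d. c m * (\<Prod>i\<in>UNIV. v $ i ^ m i))"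
    unfolding form_def by auto
  show ?thesis
    unfolding F
    by (intro exI[of _ "\<Sum>m | (\<Sum>i\<in>UNIV. m i) = d. [:c m:] * (\<Prod>i\<in>UNIV. [:v $ i, w $ i:] ^ m i)"])
      (simp add: poly_sum poly_prod poly_power mult.commute)
qed

lemma proj_line_other_index:
  fixes k :: 2
  obtains l where "l \<noteq> k" "UNIV = {k, l}"
proof -
  consider "k = 1" | "k = 2" using exhaust_2[of k] by blast
  then show thesis
  proof cases
    case 1
    then show thesis by (intro that[of 2]) (auto simp: UNIV_2)
  next
    case 2
    then show thesis by (intro that[of 1]) (auto simp: UNIV_2)
  qed
qed

text \<open>Its use is that a regular function on the line that vanishes near \<open>a\<close>
  except possibly at \<open>a\<close> must vanish at \<open>a\<close> as well.\<close>

lemma proj_line_not_isolated: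
  fixes a :: "('k::alg_closed_field, 2) ppoint"
  assumes "a \<in> proj_line" "\<forall>\<^sub>F Q in near proj_line a. R Q"
  shows "\<exists>Q\<in>proj_line. Q \<noteq> a \<and> R Q"
proof -
  obtain v k where v: "v \<in> a" "v $ k \<noteq> 0"
    using assms(1) by (rule representative_coordinate)
  obtain l where l: "l \<noteq> k" by (rule proj_line_other_index)
  obtain U where U: "openin zariski U" "a \<in> U" "\<forall>Q \<in> U \<inter> proj_space. R Q"
    using assms unfolding projective.eventually_near[OF assms(1)] openin_subtopology by blast
  obtain d F where F: "F \<in> form d" "\<forall>v\<in>a. F v \<noteq> 0"
    "\<forall>Q\<in>proj_space. (\<forall>v\<in>Q. F v \<noteq> 0) \<longrightarrow> Q \<in> U"
    using zariski_base[OF U(1,2)] by blast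
  obtain p where p: "\<And>x. poly p x = F (v + x *s axis l 1)"
    using form_restricted_to_line[OF F(1)] by blast
  have "poly p 0 \<noteq> 0" using F(2) v(1) by (simp add: p)
  then have "p \<noteq> 0" by auto
  \<comment> \<open>\<open>pCons (-1) p\<close> is the polynomial \<open>X p - 1\<close>. A root
    \<open>x\<close> of it makes \<open>x\<close> and \<open>poly p x\<close> nonzero at the same
    time.\<close>
  then have "degree (pCons (-1) p) > 0" by simp
  then obtain x where "poly (pCons (-1) p) x = 0"
    using alg_closed_imp_poly_has_root by blast
  then have "x * poly p x = 1" by simp
  then have x: "x \<noteq> 0" "poly p x \<noteq> 0" by auto
  define q where "q = v + x *s axis l 1"
  have q: "q $ k = v $ k" "q $ l = v $ l + x"
    using l by (auto simp: q_def axis_def)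
  define Q where "Q = {c *s q | c. c \<noteq> 0}"
  have "q \<noteq> 0" using q(1) v(2) by auto
  then have Q: "Q \<in> proj_space" unfolding proj_space_def Q_def by blast
  have qQ: "q \<in> Q" unfolding Q_def by (intro CollectI exI[of _ 1]) simp
  have "Q \<noteq> a"
  proof
    assume "Q = a"
    then obtain c where c: "v = c *s q" using v(1) unfolding Q_def by auto
    then have "v $ k = c * v $ k" using q(1) by (metis vector_smult_component)
    then have "c = 1" using v(2) by simp
    then show False using c q(2) x(1) by simp
  qed
  moreover have "F q \<noteq> 0" using x(2) by (simp add: p q_def)
  then have "Q \<in> U" using F(3) Q form_nonvanishing[OF F(1) Q qQ] by blast
  ultimately show ?thesis using Q U(3) by blast
qed

text \<open>The line has only two homogeneous coordinates. Of the two generators of the maximal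
  ideal, the one with \<open>i = k\<close> is the zero germ, as that coordinate is constantly 1 near
  \<open>a\<close>, and the other is \<open>t\<close>. The single remaining ratio also determines
  the point.\<close>

lemma proj_line_parameter:
  fixes a :: "('k::alg_closed_field, 2) ppoint"
  assumes "a \<in> proj_line"
  obtains t U where "openin (ztop proj_line) U" "a \<in> U" "regular_on proj_line U t"
    "\<And>Q. Q \<in> U \<Longrightarrow> t Q = 0 \<longleftrightarrow> Q = a" "local_parameter a t"
proof -
  obtain v k where v: "v \<in> a" "v $ k \<noteq> 0"
    using assms(1) by (rule representative_coordinate)
  obtain l where l: "l \<noteq> k" "UNIV = {k, l}" by (rule proj_line_other_index)
  define t :: "('k, 2) pfun" where "t Q = affine_coord k l Q - affine_coord k l a" for Q
  define U :: "('k, 2) ppoint set" where "U = {Q \<in> proj_space. \<forall>v\<in>Q. v $ k \<noteq> 0}"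
  have U: "openin (ztop proj_line) U"
    unfolding U_def by (rule openin_nonvanishing[OF form_coordinate]) simp
  have a: "a \<in> U"
    using form_nonvanishing[OF form_coordinate assms v(1), of k] v(2) assms by (simp add: U_def)
  have reg: "regular_at proj_line Q t" if "Q \<in> U" for Q
  proof -
    obtain w where "w \<in> Q" using \<open>Q \<in> U\<close> representative_exists[of Q] unfolding U_def by blast
    with that have "Q \<in> proj_line" "w \<in> Q" "w $ k \<noteq> 0" by (auto simp: U_def)
    then show ?thesis
      unfolding t_def [abs_def]
      by (intro projective.regular_at_diff projective.regular_at_affine_coord projective.regular_at_const)
  qed
  have zero: "t Q = 0 \<longleftrightarrow> Q = a" if "Q \<in> U" for Q
  proof
    assume "t Q = 0"
    obtain w where w: "w \<in> Q" using \<open>Q \<in> U\<close> representative_exists[of Q] unfolding U_def by blast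
    then have Q: "Q \<in> proj_space" "w $ k \<noteq> 0" using \<open>Q \<in> U\<close> by (auto simp: U_def)
    have lk: "w $ l / w $ k = v $ l / v $ k"
      using \<open>t Q = 0\<close> by (simp add: t_def affine_coord_eq[OF Q(1) w] affine_coord_eq[OF assms v(1)])
    define c where "c = w $ k / v $ k"
    have c: "c \<noteq> 0" "w $ k = c * v $ k" using Q(2) v(2) by (auto simp: c_def)
    have "w $ l = c * v $ l"
      using lk Q(2) v(2) by (simp add: c_def field_simps)
    then have "w $ i = c * v $ i" for i
      using l(2) c(2) by (cases "i = k") auto
    then have "w = c *s v" by (simp add: vec_eq_iff)
    then have "w \<in> a" using representative_scale[OF assms v(1) c(1)] by simp
    then show "Q = a" using proj_space_eqI[OF Q(1) assms w] by blast
  qed (simp add: t_def)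
  have t: "t \<in> max_ideal proj_line a"
    using reg[OF a] by (simp add: max_ideal_def t_def)
  have "(\<lambda>Q. affine_coord k i Q - affine_coord k i a) \<in> ideal_at proj_line a {t}" for i
  proof (cases "i = k")
    case True
    have "\<forall>\<^sub>F Q in near proj_line a. Q \<in> U"
      using U a by (rule projective.eventually_near_open)
    then have "\<forall>\<^sub>F Q in near proj_line a. affine_coord k i Q - affine_coord k i a = 0"
    proof eventually_elim
      case (elim Q)
      then obtain w where "w \<in> Q" using representative_exists[of Q] unfolding U_def by blast
      with elim v assms show ?case by (auto simp: True affine_coord_eq U_def)
    qed
    then show ?thesis
      using projective.germ_ideal_ideal_at[OF assms] by (blast intro: projective.germ_ideal_cong projective.germ_ideal_zero)
  next
    case False
    then have "i = l" using l(2) by auto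
    then show ?thesis using projective.ideal_at_generator[OF reg[OF a], of "{t}"] by (simp add: t_def [abs_def])
  qed
  then have "max_ideal proj_line a \<subseteq> ideal_at proj_line a {t}"
    unfolding projective.max_ideal_eq[OF assms v]
    by (intro projective.ideal_at_least projective.germ_ideal_ideal_at assms) auto
  then have "local_parameter a t" using t unfolding local_parameter_def by blast
  with U a reg zero show thesis by (intro that[of U t]) (auto simp: regular_on_def)
qed

section \<open>Divisibility by a local parameter of the line\<close>

lemma local_parameterE:
  assumes "local_parameter a t" "f \<in> max_ideal proj_line a"
  obtains c where "regular_at proj_line a c" "\<forall>\<^sub>F Q in near proj_line a. f Q = c Q * t Q"
proof -
  have "f \<in> ideal_at proj_line a {t}" "a \<in> proj_line"
    using assms projective.regular_at_mem by (auto simp: local_parameter_def max_ideal_def)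
  then show thesis by (rule projective.ideal_at_singletonE) (rule that)
qed

text \<open>The explicit parameter, whose only zero nearby is \<open>a\<close>, is a multiple of
  \<open>t\<close>, so \<open>t\<close> has no further zeros either.\<close>

lemma local_parameter_nonzero:
  fixes a :: "('k::alg_closed_field, 2) ppoint"
  assumes "local_parameter a t"
  shows "\<forall>\<^sub>F Q in near proj_line a. t Q = 0 \<longrightarrow> Q = a"
proof -
  have a: "a \<in> proj_line"
    using assms projective.regular_at_mem by (auto simp: local_parameter_def max_ideal_def)
  obtain t0 U where t0: "openin (ztop proj_line) U" "a \<in> U" "\<And>Q. Q \<in> U \<Longrightarrow> t0 Q = 0 \<longleftrightarrow> Q = a"
    "local_parameter a t0"
    using a by (rule proj_line_parameter) blast
  have "t0 \<in> max_ideal proj_line a" using t0(4) by (simp add: local_parameter_def)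
  with assms obtain c where "\<forall>\<^sub>F Q in near proj_line a. t0 Q = c Q * t Q"
    by (rule local_parameterE)
  moreover have "\<forall>\<^sub>F Q in near proj_line a. Q \<in> U"
    using t0(1,2) by (rule projective.eventually_near_open)
  ultimately show ?thesis by eventually_elim (use t0(3) in auto)
qed

text \<open>Away from \<open>a\<close> the factor \<open>t\<close> is nonzero, so \<open>b\<close>
  vanishes there; a nonzero value at \<open>a\<close> alone would isolate \<open>a\<close>.\<close>

lemma local_parameter_cancel:
  fixes a :: "('k::alg_closed_field, 2) ppoint"
  assumes "local_parameter a t" "regular_at proj_line a b" "\<forall>\<^sub>F Q in near proj_line a. b Q * t Q = 0"
  shows "\<forall>\<^sub>F Q in near proj_line a. b Q = 0"
proof -
  have a: "a \<in> proj_line" using assms(2) by (rule projective.regular_at_mem)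
  have *: "\<forall>\<^sub>F Q in near proj_line a. Q \<noteq> a \<longrightarrow> b Q = 0"
    using assms(3) local_parameter_nonzero[OF assms(1)] by eventually_elim auto
  have "b a = 0"
  proof (rule ccontr)
    assume "b a \<noteq> 0"
    with assms(2) have "\<forall>\<^sub>F Q in near proj_line a. b Q \<noteq> 0" by (rule projective.regular_at_nonzero)
    with * have "\<forall>\<^sub>F Q in near proj_line a. Q = a" by eventually_elim auto
    from proj_line_not_isolated[OF a this] show False by blast
  qed
  with * show ?thesis by (auto elim: eventually_mono)
qed

text \<open>Each parameter is a multiple of the other, and cancelling \<open>t\<close> in
  \<open>t = w u t\<close> gives \<open>w u = 1\<close>.\<close>

lemma local_parameter_unit:
  fixes a :: "('k::alg_closed_field, 2) ppoint"
  assumes "local_parameter a t" "local_parameter a t'"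
  obtains u where "regular_at proj_line a u" "u a \<noteq> 0" "\<forall>\<^sub>F Q in near proj_line a. t' Q = u Q * t Q"
proof -
  have t: "t \<in> max_ideal proj_line a" "t' \<in> max_ideal proj_line a"
    using assms by (auto simp: local_parameter_def)
  then have a: "a \<in> proj_line" using projective.regular_at_mem by (auto simp: max_ideal_def)
  from assms(1) t(2) obtain u where u: "regular_at proj_line a u" "\<forall>\<^sub>F Q in near proj_line a. t' Q = u Q * t Q"
    by (rule local_parameterE)
  from assms(2) t(1) obtain w where w: "regular_at proj_line a w" "\<forall>\<^sub>F Q in near proj_line a. t Q = w Q * t' Q"
    by (rule local_parameterE)
  have reg: "regular_at proj_line a (\<lambda>Q. 1 - w Q * u Q)"
    by (intro projective.regular_at_diff projective.regular_at_const projective.regular_at_mult a u w)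
  have "\<forall>\<^sub>F Q in near proj_line a. (1 - w Q * u Q) * t Q = 0"
    using u(2) w(2) by eventually_elim (auto simp: algebra_simps)
  with assms(1) reg have "\<forall>\<^sub>F Q in near proj_line a. 1 - w Q * u Q = 0"
    by (rule local_parameter_cancel)
  then have "1 - w a * u a = 0" by (rule projective.eventually_near_self[OF a])
  then have "u a \<noteq> 0" by auto
  with u that show thesis by blast
qed

text \<open>Products of two germs vanishing at \<open>a\<close> are multiples of the square of
  \<open>t\<close>. A relation \<open>t = c t t\<close> would give \<open>1 = c t\<close> after
  cancellation, which fails at \<open>a\<close>.\<close>

lemma local_parameter_not_square:
  fixes a :: "('k::alg_closed_field, 2) ppoint"
  assumes "local_parameter a t"
  shows "t \<notin> ideal_at proj_line a {(\<lambda>Q. f Q * g Q) | f g. f \<in> max_ideal proj_line a \<and> g \<in> max_ideal proj_line a}"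
proof
  assume sq: "t \<in> ideal_at proj_line a {(\<lambda>Q. f Q * g Q) | f g. f \<in> max_ideal proj_line a \<and> g \<in> max_ideal proj_line a}"
  have t: "t \<in> max_ideal proj_line a" "regular_at proj_line a t" "t a = 0"
    using assms by (auto simp: local_parameter_def max_ideal_def)
  have a: "a \<in> proj_line" using t(2) by (rule projective.regular_at_mem)
  note I = projective.germ_ideal_ideal_at[OF a, of "{\<lambda>Q. t Q * t Q}"]
  have "ideal_at proj_line a {(\<lambda>Q. f Q * g Q) | f g. f \<in> max_ideal proj_line a \<and> g \<in> max_ideal proj_line a}
      \<subseteq> ideal_at proj_line a {\<lambda>Q. t Q * t Q}"
  proof (rule projective.ideal_at_least[OF I], clarify)
    fix f g assume f: "f \<in> max_ideal proj_line a" and g: "g \<in> max_ideal proj_line a"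
    from assms f obtain c where c: "regular_at proj_line a c" "\<forall>\<^sub>F Q in near proj_line a. f Q = c Q * t Q"
      by (rule local_parameterE)
    from assms g obtain d where d: "regular_at proj_line a d" "\<forall>\<^sub>F Q in near proj_line a. g Q = d Q * t Q"
      by (rule local_parameterE)
    have "(\<lambda>Q. (c Q * d Q) * (t Q * t Q)) \<in> ideal_at proj_line a {\<lambda>Q. t Q * t Q}"
      by (intro projective.germ_ideal_mult[OF I] projective.regular_at_mult c d t projective.ideal_at_generator) simp
    moreover have "\<forall>\<^sub>F Q in near proj_line a. f Q * g Q = (c Q * d Q) * (t Q * t Q)"
      using c(2) d(2) by eventually_elim simp
    ultimately show "(\<lambda>Q. f Q * g Q) \<in> ideal_at proj_line a {\<lambda>Q. t Q * t Q}"
      by (rule projective.germ_ideal_cong[OF I])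
  qed
  with sq have "t \<in> ideal_at proj_line a {\<lambda>Q. t Q * t Q}" by blast
  from this a obtain c where c: "regular_at proj_line a c" "\<forall>\<^sub>F Q in near proj_line a. t Q = c Q * (t Q * t Q)"
    by (rule projective.ideal_at_singletonE)
  have reg: "regular_at proj_line a (\<lambda>Q. 1 - c Q * t Q)"
    by (intro projective.regular_at_diff projective.regular_at_const projective.regular_at_mult a c t)
  have "\<forall>\<^sub>F Q in near proj_line a. (1 - c Q * t Q) * t Q = 0"
    using c(2) by eventually_elim (simp add: algebra_simps)
  with assms reg have "\<forall>\<^sub>F Q in near proj_line a. 1 - c Q * t Q = 0"
    by (rule local_parameter_cancel)
  then have "1 - c a * t a = 0" by (rule projective.eventually_near_self[OF a])
  then show False using t(3) by simp
qed

section \<open>The image of a section is a Cartier divisor\<close>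

abbreviation max_ideal_sq :: "('k::field, 'n::finite) ppoint set \<Rightarrow> ('k, 'n) ppoint \<Rightarrow> ('k, 'n) pfun set" where
  "max_ideal_sq X P \<equiv> ideal_at X P {(\<lambda>Q. f Q * g Q) | f g. f \<in> max_ideal X P \<and> g \<in> max_ideal X P}"

locale sectioned_surface = proj_variety X
  for X :: "('k::alg_closed_field, 'n::finite) ppoint set" +
  fixes \<phi> :: "('k, 'n) ppoint \<Rightarrow> ('k, 2) ppoint" and s :: "('k, 2) ppoint \<Rightarrow> ('k, 'n) ppoint"
  assumes nonsingular: "nonsingular_surface X"
    and phi: "morphism X proj_line \<phi>"
    and sec: "morphism proj_line X s"
    and phi_sec: "a \<in> proj_line \<Longrightarrow> \<phi> (s a) = a"
begin

abbreviation curve :: "('k, 'n) ppoint set" where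
  "curve \<equiv> s ` proj_line"

abbreviation retract :: "('k, 'n) ppoint \<Rightarrow> ('k, 'n) ppoint" where
  "retract Q \<equiv> s (\<phi> Q)"

lemma phi_mem: "P \<in> X \<Longrightarrow> \<phi> P \<in> proj_line"
  using morphism_mem[OF phi subset] by simp

lemma sec_mem: "a \<in> proj_line \<Longrightarrow> s a \<in> X"
  using morphism_mem[OF sec _ subset] by simp

lemma phi_near: "P \<in> X \<Longrightarrow> \<forall>\<^sub>F b in near proj_line (\<phi> P). R b \<Longrightarrow> \<forall>\<^sub>F Q in near X P. R (\<phi> Q)"
  by (rule morphism_near[OF phi subset]) auto

lemma sec_near: "a \<in> proj_line \<Longrightarrow> \<forall>\<^sub>F Q in near X (s a). R Q \<Longrightarrow> \<forall>\<^sub>F b in near proj_line a. R (s b)"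
  by (rule morphism_near[OF sec _ subset]) auto

lemma phi_regular: "P \<in> X \<Longrightarrow> regular_at proj_line (\<phi> P) f \<Longrightarrow> regular_at X P (\<lambda>Q. f (\<phi> Q))"
  by (rule morphism_regular[OF phi subset]) auto

lemma sec_regular: "a \<in> proj_line \<Longrightarrow> regular_at X (s a) f \<Longrightarrow> regular_at proj_line a (\<lambda>b. f (s b))"
  by (rule morphism_regular[OF sec _ subset]) auto

lemma retract_morphism: "morphism X X retract"
  using phi sec subset by (rule morphism_compose) simp

lemma retract_mem: "Q \<in> X \<Longrightarrow> retract Q \<in> X"
  by (simp add: phi_mem sec_mem)

lemma curve_iff: "Q \<in> X \<Longrightarrow> Q \<in> curve \<longleftrightarrow> retract Q = Q"
  using phi_mem phi_sec by (auto simp: image_iff)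

lemma curve_subset: "curve \<subseteq> X"
  using sec_mem by blast

lemma retract_regular: "P \<in> X \<Longrightarrow> regular_at X (retract P) f \<Longrightarrow> regular_at X P (\<lambda>Q. f (retract Q))"
  by (rule morphism_regular[OF retract_morphism subset subset])

text \<open>Where \<open>Q = retract Q\<close>, all 2-by-2 minors of the coordinates of the two points vanish.\<close>

lemma curve_closed:
  assumes "P \<in> X" "P \<notin> curve"
  shows "\<forall>\<^sub>F Q in near X P. Q \<notin> curve"
proof -
  let ?R = "retract P"
  have R: "?R \<in> X" "?R \<noteq> P" using assms retract_mem curve_iff by auto
  obtain v i where v: "v \<in> P" "v $ i \<noteq> 0"
    using assms(1) subset by (meson representative_coordinate subsetD)
  obtain w j where w: "w \<in> ?R" "w $ j \<noteq> 0"
    using R(1) subset by (meson representative_coordinate subsetD)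
  have "\<exists>l. v $ i * w $ l \<noteq> v $ l * w $ i"
  proof (rule ccontr)
    assume "\<not> ?thesis"
    then have minor: "v $ i * w $ l = v $ l * w $ i" for l by auto
    define c where "c = w $ i / v $ i"
    have "w $ l = c * v $ l" for l
      using minor[of l] v(2) by (simp add: c_def field_simps)
    then have wc: "w = c *s v" by (simp add: vec_eq_iff)
    then have "c \<noteq> 0" using w(2) by auto
    with wc have "w \<in> P" using representative_scale[OF _ v(1)] assms(1) subset by blast
    then show False using proj_space_eqI[of ?R P w] R w(1) assms(1) subset by blast
  qed
  then obtain l where l: "v $ i * w $ l \<noteq> v $ l * w $ i" ..
  \<comment> \<open>The two points are measured in different charts, \<open>i\<close> for
    \<open>Q\<close> and \<open>j\<close> for its image, since no coordinate need be nonzero at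
    both. Up to denominators \<open>D\<close> is the minor for the indices \<open>i\<close> and
    \<open>l\<close>.\<close>
  define D where "D Q = affine_coord i i Q * affine_coord j l (retract Q) -
    affine_coord i l Q * affine_coord j i (retract Q)" for Q
  have "regular_at X P D"
    unfolding D_def [abs_def]
    by (intro regular_at_diff regular_at_mult regular_at_affine_coord[OF assms(1) v]
        retract_regular[OF assms(1) regular_at_affine_coord[OF R(1) w]])
  moreover have "D P \<noteq> 0"
  proof -
    have "P \<in> proj_space" "?R \<in> proj_space" using assms(1) R(1) subset by auto
    then have "D P = (v $ i * w $ l - v $ l * w $ i) / (v $ i * w $ j)"
      by (simp add: D_def affine_coord_eq[OF _ v(1)] affine_coord_eq[OF _ w(1)] diff_divide_distrib)
    then show ?thesis using l v(2) w(2) by simp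
  qed
  ultimately have "\<forall>\<^sub>F Q in near X P. D Q \<noteq> 0" by (rule regular_at_nonzero)
  then show ?thesis using eventually_near_mem[OF assms(1)]
  proof eventually_elim
    case (elim Q)
    obtain u where u: "u \<in> Q" using elim(2) subset representative_exists by blast
    have "Q \<in> proj_space" using elim(2) subset by blast
    \<comment> \<open>If \<open>u $ i = 0\<close>, all ratios with this denominator are 0 by
      convention, and \<open>D Q = 0\<close> against the choice of \<open>Q\<close>.\<close>
    then have "retract Q \<noteq> Q"
      using elim(1) affine_coord_eq[OF _ u] by (cases "u $ i = 0") (auto simp: D_def)
    then show ?case using curve_iff[OF elim(2)] by blast
  qed
qed

text \<open>If all affine coordinates of the two points agreed, their representatives would be
  proportional. This will show that a local equation of the curve has no nearby zeros off the
  curve.\<close>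

lemma curve_generators_detect:
  assumes "Q \<in> X" "Q \<notin> curve" "u \<in> Q" "u $ k \<noteq> 0" "w \<in> retract Q" "w $ k \<noteq> 0"
  shows "\<exists>i. affine_coord k i Q - affine_coord k i (retract Q) \<noteq> 0"
proof (rule ccontr)
  assume "\<not> ?thesis"
  moreover have Q: "Q \<in> proj_space" "retract Q \<in> proj_space"
    using assms(1) retract_mem subset by auto
  ultimately have ratio: "u $ i / u $ k = w $ i / w $ k" for i
    using affine_coord_eq[OF _ assms(3)] affine_coord_eq[OF _ assms(5)] by auto
  define c where "c = w $ k / u $ k"
  have "w $ i = c * u $ i" for i
    using ratio[of i] assms(4,6) by (simp add: c_def field_simps)
  then have "w = c *s u" by (simp add: vec_eq_iff)
  moreover have "c \<noteq> 0" using assms(4,6) by (simp add: c_def)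
  ultimately have "w \<in> Q" using representative_scale[OF Q(1) assms(3)] by blast
  then have "retract Q = Q" using proj_space_eqI[OF Q(2,1) assms(5)] by blast
  then show False using assms(1,2) curve_iff by blast
qed

text \<open>The retraction takes values in the curve, so a function vanishing on the curve equals
  \<open>f - f \<circ> retract\<close> near \<open>P\<close>, and such differences are generated by
  those of the coordinates.\<close>

lemma vanishing_ideal_curve:
  assumes "P \<in> curve" "v \<in> P" "v $ k \<noteq> 0"
  shows "vanishing_ideal X curve P = ideal_at X P (range (\<lambda>i Q. affine_coord k i Q - affine_coord k i (retract Q)))"
    (is "_ = ideal_at X P (range ?y)")
proof
  have P: "P \<in> X" "retract P = P" using assms(1) curve_subset curve_iff by blast+
  show "vanishing_ideal X curve P \<subseteq> ideal_at X P (range ?y)"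
  proof
    fix f assume "f \<in> vanishing_ideal X curve P"
    then have f: "regular_at X P f" "\<forall>\<^sub>F Q in near X P. Q \<in> curve \<longrightarrow> f Q = 0"
      by (auto simp: vanishing_ideal_def)
    have "\<forall>\<^sub>F Q in near X P. retract Q \<in> curve \<longrightarrow> f (retract Q) = 0"
      using morphism_near[OF retract_morphism subset subset P(1)] f(2) P(2) by simp
    then have "\<forall>\<^sub>F Q in near X P. f Q = f Q - f (retract Q)"
      using eventually_near_mem[OF P(1)] by eventually_elim (use phi_mem in auto)
    with diff_retraction_in_ideal[OF retract_morphism P(2) assms(2,3) f(1)]
    show "f \<in> ideal_at X P (range ?y)"
      by (rule germ_ideal_cong[OF germ_ideal_ideal_at[OF P(1)]])
  qed
  have "regular_at X P (affine_coord k i)" for i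
    by (rule regular_at_affine_coord[OF P(1) assms(2,3)])
  then have "regular_at X P (?y i)" for i
    using P by (intro regular_at_diff retract_regular) simp_all
  moreover have "\<forall>\<^sub>F Q in near X P. Q \<in> curve \<longrightarrow> ?y i Q = 0" for i
    using eventually_near_mem[OF P(1)] by eventually_elim (use curve_iff in auto)
  ultimately show "ideal_at X P (range ?y) \<subseteq> vanishing_ideal X curve P"
    by (intro ideal_at_least germ_ideal_vanishing P(1)) (auto simp: vanishing_ideal_def)
qed

text \<open>If \<open>f \<circ> s\<close> vanishes near \<open>a\<close>, composing with
  \<open>\<phi>\<close> shows that \<open>f \<circ> retract\<close> vanishes near
  \<open>s a\<close>, and on the curve this is \<open>f\<close>. Membership in the ideal of the
  curve can therefore be decided on the line.\<close>

lemma vanishing_curve_iff: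
  assumes "a \<in> proj_line" "regular_at X (s a) f"
  shows "f \<in> vanishing_ideal X curve (s a) \<longleftrightarrow> (\<forall>\<^sub>F b in near proj_line a. f (s b) = 0)"
proof
  assume "f \<in> vanishing_ideal X curve (s a)"
  then have "\<forall>\<^sub>F Q in near X (s a). Q \<in> curve \<longrightarrow> f Q = 0"
    by (simp add: vanishing_ideal_def)
  from sec_near[OF assms(1) this] projective.eventually_near_mem[OF assms(1)]
  show "\<forall>\<^sub>F b in near proj_line a. f (s b) = 0"
    by eventually_elim auto
next
  assume "\<forall>\<^sub>F b in near proj_line a. f (s b) = 0"
  then have "\<forall>\<^sub>F Q in near X (s a). f (retract Q) = 0"
    using assms(1) by (intro phi_near sec_mem) (simp_all add: phi_sec)
  moreover have "\<forall>\<^sub>F Q in near X (s a). Q \<in> X"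
    using assms(1) by (intro eventually_near_mem sec_mem)
  ultimately have "\<forall>\<^sub>F Q in near X (s a). Q \<in> curve \<longrightarrow> f Q = 0"
    by eventually_elim (use curve_iff in auto)
  with assms(2) show "f \<in> vanishing_ideal X curve (s a)"
    by (simp add: vanishing_ideal_def)
qed

text \<open>Pulling back along \<open>s\<close> maps the square of the maximal ideal at
  \<open>s a\<close> into that at \<open>a\<close>, but recovers \<open>t\<close> itself, since
  \<open>\<phi> \<circ> s\<close> is the identity on the line.\<close>

lemma fiber_parameter_not_square:
  assumes "local_parameter a t" "a \<in> proj_line"
  shows "(\<lambda>Q. t (\<phi> Q)) \<notin> max_ideal_sq X (s a)"
proof
  assume sq: "(\<lambda>Q. t (\<phi> Q)) \<in> max_ideal_sq X (s a)"
  note I = projective.germ_ideal_ideal_at[OF assms(2)]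
  have "max_ideal_sq X (s a) \<subseteq> {f. regular_at X (s a) f \<and> (\<lambda>b. f (s b)) \<in> max_ideal_sq proj_line a}"
  proof (rule ideal_at_least)
    show "germ_ideal X (s a) {f. regular_at X (s a) f \<and> (\<lambda>b. f (s b)) \<in> max_ideal_sq proj_line a}"
      by (rule germ_ideal_pullback[OF sec _ subset assms(2) I]) simp
  next
    have "regular_at X (s a) (\<lambda>Q. f Q * g Q) \<and> (\<lambda>b. f (s b) * g (s b)) \<in> max_ideal_sq proj_line a"
      if fg: "f \<in> max_ideal X (s a)" "g \<in> max_ideal X (s a)" for f g
    proof
      show "regular_at X (s a) (\<lambda>Q. f Q * g Q)"
        using fg by (auto simp: max_ideal_def intro: regular_at_mult)
      have "(\<lambda>b. f (s b)) \<in> max_ideal proj_line a" "(\<lambda>b. g (s b)) \<in> max_ideal proj_line a"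
        using fg assms(2) by (auto simp: max_ideal_def intro: sec_regular)
      then show "(\<lambda>b. f (s b) * g (s b)) \<in> max_ideal_sq proj_line a"
        by (intro projective.ideal_at_generator) (auto simp: max_ideal_def intro: projective.regular_at_mult)
    qed
    then show "{(\<lambda>Q. f Q * g Q) | f g. f \<in> max_ideal X (s a) \<and> g \<in> max_ideal X (s a)}
        \<subseteq> {f. regular_at X (s a) f \<and> (\<lambda>b. f (s b)) \<in> max_ideal_sq proj_line a}"
      by auto
  qed
  with sq have "(\<lambda>b. t (\<phi> (s b))) \<in> max_ideal_sq proj_line a" by blast
  moreover have "\<forall>\<^sub>F b in near proj_line a. t b = t (\<phi> (s b))"
    using projective.eventually_near_mem[OF assms(2)] by eventually_elim (simp add: phi_sec)
  ultimately have "t \<in> max_ideal_sq proj_line a"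
    by (rule projective.germ_ideal_cong[OF I])
  then show False using local_parameter_not_square[OF assms(1)] by blast
qed

text \<open>Since \<open>t\<close> pulled back to the surface is not in the square of the maximal ideal, one basis vector
  \<open>e'\<close> of the cotangent space completes it to a basis, and \<open>e'\<close> can be corrected to
  \<open>h = e' - e' \<circ> retract\<close>, which vanishes on the curve. Nakayama's lemma is applied to the maximal ideal
  and then to the ideal of the curve.\<close>

lemma local_equation:
  assumes "a \<in> proj_line" "local_parameter a t"
  obtains h where "max_ideal X (s a) = ideal_at X (s a) {\<lambda>Q. t (\<phi> Q), h}"
    "vanishing_ideal X curve (s a) = ideal_at X (s a) {h}" "regular_at X (s a) h" "nonzero_rational X h"
proof -
  define P where "P = s a"
  define \<tau> where "\<tau> Q = t (\<phi> Q)" for Q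
  have P: "P \<in> X" "P \<in> curve" "\<phi> P = a" "retract P = P"
    using assms(1) sec_mem phi_sec by (auto simp: P_def)
  note m = germ_ideal_max_ideal[OF P(1)] and I = germ_ideal_ideal_at[OF P(1)]
  obtain v k where v: "v \<in> P" "v $ k \<noteq> 0"
    using P(1) subset by (meson representative_coordinate subsetD)
  have t: "regular_at proj_line a t" "t a = 0"
    using assms(2) by (auto simp: local_parameter_def max_ideal_def)
  then have tau: "\<tau> \<in> max_ideal X P"
    using phi_regular[OF P(1), of t] P(3) by (simp add: max_ideal_def \<tau>_def [abs_def])
  have "quotient_dim (max_ideal X P) (max_ideal_sq X P) 2"
    using nonsingular P(1) by (simp add: nonsingular_surface_def)
  then obtain B where B: "B \<subseteq> max_ideal X P" "finite B" "card B = 2"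
    "\<forall>f\<in>max_ideal X P. \<exists>c. (\<lambda>x. f x - (\<Sum>g\<in>B. c g * g x)) \<in> max_ideal_sq X P"
    "\<forall>c. (\<lambda>x. \<Sum>g\<in>B. c g * g x) \<in> max_ideal_sq X P \<longrightarrow> (\<forall>g\<in>B. c g = 0)"
    unfolding quotient_dim_def by (elim exE conjE) (rule that)
  obtain c where c: "(\<lambda>x. \<tau> x - (\<Sum>g\<in>B. c g * g x)) \<in> max_ideal_sq X P"
    using bspec[OF B(4) tau] by (elim exE)
  have "\<exists>e\<in>B. c e \<noteq> 0"
  proof (rule ccontr)
    assume "\<not> ?thesis"
    then have "\<tau> \<in> max_ideal_sq X P" using c by simp
    then show False
      using fiber_parameter_not_square[OF assms(2,1)] by (simp add: P_def \<tau>_def [abs_def])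
  qed
  \<comment> \<open>The basis vector \<open>e\<close> will be exchanged for \<open>\<tau>\<close>,
    in whose expansion it has a nonzero coefficient.\<close>
  then obtain e where e: "e \<in> B" "c e \<noteq> 0" by blast
  from B(3) e(1) obtain e' where e': "B = {e, e'}" "e \<noteq> e'"
    by (metis card_2_iff doubleton_eq_iff insertE singletonD)
  have em: "e \<in> max_ideal X P" "e' \<in> max_ideal X P" using B(1) e' by auto
  define h where "h Q = e' Q - e' (retract Q)" for Q
  have e'_reg: "regular_at X P e'" using em(2) by (simp add: max_ideal_def)
  have h_reg: "regular_at X P h"
    unfolding h_def [abs_def] using P(1,4) e'_reg by (intro regular_at_diff retract_regular) simp_all
  have h_van: "h \<in> vanishing_ideal X curve P"
  proof -
    have "h \<in> vanishing_ideal X curve (s a) \<longleftrightarrow> (\<forall>\<^sub>F b in near proj_line a. h (s b) = 0)"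
      using h_reg by (intro vanishing_curve_iff assms) (simp add: P_def)
    moreover have "\<forall>\<^sub>F b in near proj_line a. h (s b) = 0"
      using projective.eventually_near_mem[OF assms(1)]
      by eventually_elim (simp add: h_def phi_sec)
    ultimately show ?thesis by (simp add: P_def)
  qed
  have h_max: "h \<in> max_ideal X P"
    using h_reg P(4) by (simp add: max_ideal_def h_def)
  define N where "N = ideal_at X P {\<tau>, h}"
  have N: "germ_ideal X P N" unfolding N_def by (rule I)
  have tau_reg: "regular_at X P \<tau>" using tau by (simp add: max_ideal_def)
  have gens: "\<tau> \<in> N" "h \<in> N"
    unfolding N_def using tau_reg h_reg by (auto intro: ideal_at_generator)
  \<comment> \<open>The correction \<open>e' \<circ> retract\<close> is the pullback of a germ on
    the line that vanishes at \<open>a\<close>, hence a multiple of \<open>\<tau>\<close>.\<close>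
  have e'N: "e' \<in> N"
  proof -
    have "(\<lambda>b. e' (s b)) \<in> max_ideal proj_line a"
      using sec_regular[OF assms(1), of e'] e'_reg em(2) by (simp add: max_ideal_def P_def)
    with assms(2) obtain d where d: "regular_at proj_line a d" "\<forall>\<^sub>F b in near proj_line a. e' (s b) = d b * t b"
      by (rule local_parameterE)
    have dphi: "regular_at X P (\<lambda>Q. d (\<phi> Q))" using d(1) P by (intro phi_regular) simp_all
    have "\<forall>\<^sub>F Q in near X P. e' (retract Q) = d (\<phi> Q) * t (\<phi> Q)"
      using d(2) P(3) by (intro phi_near[OF P(1)]) simp
    then have "\<forall>\<^sub>F Q in near X P. e' Q = h Q + d (\<phi> Q) * \<tau> Q"
      by eventually_elim (simp add: h_def \<tau>_def)
    moreover have "(\<lambda>Q. h Q + d (\<phi> Q) * \<tau> Q) \<in> N"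
      by (intro germ_ideal_add[OF N] germ_ideal_mult[OF N] gens dphi)
    ultimately show ?thesis by (rule germ_ideal_cong[OF N, rotated])
  qed
  \<comment> \<open>\<open>S\<close> is the sum of \<open>N\<close> and the square of the maximal
    ideal. The exchange shows that it contains the maximal ideal, which is the hypothesis of
    Nakayama's lemma for \<open>N\<close>.\<close>
  define S where "S = {f. \<exists>g\<in>N. \<exists>h\<in>max_ideal_sq X P. \<forall>\<^sub>F Q in near X P. f Q = g Q + h Q}"
  have S: "germ_ideal X P S" unfolding S_def by (rule germ_ideal_plus[OF N I P(1)])
  have NS: "f \<in> S" if "f \<in> N" for f unfolding S_def using I that by (rule germ_ideal_plus_left)
  have mS: "f \<in> S" if "f \<in> max_ideal_sq X P" for f unfolding S_def using N that by (rule germ_ideal_plus_right)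
  note const = regular_at_const[OF P(1)]
  have eS: "e \<in> S"
  proof -
    have "(\<lambda>Q. inverse (c e) * (\<tau> Q + (-1) * (\<tau> Q - (\<Sum>g\<in>B. c g * g Q)) + (- c e') * e' Q)) \<in> S"
      by (intro germ_ideal_mult[OF S const] germ_ideal_add[OF S] NS[OF gens(1)] mS[OF c] NS[OF e'N])
    moreover have "(\<lambda>Q. inverse (c e) * (\<tau> Q + (-1) * (\<tau> Q - (\<Sum>g\<in>B. c g * g Q)) + (- c e') * e' Q)) = e"
      using e(2) e' by (simp add: field_simps)
    ultimately show ?thesis by simp
  qed
  have max_S: "f \<in> S" if f: "f \<in> max_ideal X P" for f
  proof -
    obtain d where d: "(\<lambda>x. f x - (\<Sum>g\<in>B. d g * g x)) \<in> max_ideal_sq X P"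
      using bspec[OF B(4) f] by (elim exE)
    have "(\<lambda>Q. (f Q - (\<Sum>g\<in>B. d g * g Q)) + (d e * e Q + d e' * e' Q)) \<in> S"
      by (intro germ_ideal_mult[OF S const] germ_ideal_add[OF S] mS[OF d] NS[OF e'N] eS)
    then show ?thesis using e' by simp
  qed
  have max_eq: "max_ideal X P = N"
  proof
    let ?Y = "range (\<lambda>i Q. affine_coord k i Q - affine_coord k i P)"
    have Y: "max_ideal X P = ideal_at X P ?Y"
      using P(1) v by (rule max_ideal_eq)
    have Y_max: "y \<in> max_ideal X P" if "y \<in> ?Y" for y
      using that regular_at_affine_coord[OF P(1) v] const
      by (auto simp: max_ideal_def intro!: regular_at_diff)
    have "ideal_at X P ?Y \<subseteq> N"
    proof (rule nakayama[OF _ N _ P(1)])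
      show "\<exists>n\<in>N. \<exists>z\<in>ideal_at X P {(\<lambda>Q. f Q * g Q) | f g. f \<in> max_ideal X P \<and> g \<in> ideal_at X P ?Y}.
        \<forall>\<^sub>F Q in near X P. y Q = n Q + z Q" if "y \<in> ?Y" for y
        using max_S[OF Y_max[OF that]] unfolding S_def Y by blast
    qed (use Y_max in \<open>auto simp: max_ideal_def\<close>)
    with Y show "max_ideal X P \<subseteq> N" by simp
    show "N \<subseteq> max_ideal X P"
      unfolding N_def using tau h_max by (intro ideal_at_least[OF m]) auto
  qed
  have van_eq: "vanishing_ideal X curve P = ideal_at X P {h}"
  proof
    let ?Y = "range (\<lambda>i Q. affine_coord k i Q - affine_coord k i (retract Q))"
    have Y: "vanishing_ideal X curve P = ideal_at X P ?Y"
      using P(2) v by (rule vanishing_ideal_curve)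
    note van = germ_ideal_vanishing[OF P(1), of curve]
    have Y_van: "y \<in> vanishing_ideal X curve P" if "y \<in> ?Y" for y
    proof -
      have "regular_at X P y"
        using that regular_at_affine_coord[OF P(1) v] P(1,4)
        by (auto intro!: regular_at_diff retract_regular)
      then show ?thesis unfolding Y using that by (rule ideal_at_generator)
    qed
    have "ideal_at X P ?Y \<subseteq> ideal_at X P {h}"
    proof (rule nakayama[OF _ I _ P(1)])
      fix y assume "y \<in> ?Y"
      then have y: "y \<in> vanishing_ideal X curve P" by (rule Y_van)
      then have y_reg: "regular_at X P y" by (simp add: vanishing_ideal_def)
      have "\<forall>\<^sub>F Q in near X P. Q \<in> curve \<longrightarrow> y Q = 0" using y by (simp add: vanishing_ideal_def)
      then have "y P = 0" using eventually_near_self[OF P(1)] P(2) by blast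
      with y_reg have "y \<in> N" by (simp add: max_ideal_def flip: max_eq)
      then obtain f g where fg: "regular_at X P f" "regular_at X P g"
        "\<forall>\<^sub>F Q in near X P. y Q = f Q * \<tau> Q + g Q * h Q"
        unfolding N_def using P(1) by (rule ideal_at_pairE)
      \<comment> \<open>As \<open>y\<close> and \<open>h\<close> vanish on the curve, so does
        \<open>f \<tau>\<close>. Along the curve \<open>\<tau>\<close> is the parameter
        \<open>t\<close> and cancels, so \<open>f\<close> itself lies in the ideal of the curve.
        Hence \<open>y\<close> is \<open>g h\<close> up to an element of the maximal ideal times
        that ideal.\<close>
      have "(\<lambda>Q. y Q + (-1 * g Q) * h Q) \<in> vanishing_ideal X curve P"
        using fg(2) by (intro germ_ideal_add[OF van] germ_ideal_mult[OF van] regular_at_mult const y h_van)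
      moreover have "\<forall>\<^sub>F Q in near X P. f Q * \<tau> Q = y Q + (-1 * g Q) * h Q"
        using fg(3) by eventually_elim simp
      ultimately have "(\<lambda>Q. f Q * \<tau> Q) \<in> vanishing_ideal X curve P"
        by (rule germ_ideal_cong[OF van])
      then have "\<forall>\<^sub>F b in near proj_line a. f (s b) * \<tau> (s b) = 0"
        using vanishing_curve_iff[OF assms(1), of "\<lambda>Q. f Q * \<tau> Q"] regular_at_mult[OF fg(1) tau_reg]
        by (simp add: P_def)
      then have "\<forall>\<^sub>F b in near proj_line a. f (s b) * t b = 0"
        using projective.eventually_near_mem[OF assms(1)]
        by eventually_elim (simp add: \<tau>_def phi_sec)
      moreover have "regular_at proj_line a (\<lambda>b. f (s b))"
        using sec_regular[OF assms(1), of f] fg(1) by (simp add: P_def)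
      ultimately have "\<forall>\<^sub>F b in near proj_line a. f (s b) = 0"
        by (rule local_parameter_cancel[OF assms(2), rotated])
      then have "f \<in> vanishing_ideal X curve P"
        using vanishing_curve_iff[OF assms(1), of f] fg(1) by (simp add: P_def)
      then have f: "f \<in> ideal_at X P ?Y" using Y by simp
      have "(\<lambda>Q. \<tau> Q * f Q) \<in> ideal_at X P {(\<lambda>Q. f Q * g Q) | f g. f \<in> max_ideal X P \<and> g \<in> ideal_at X P ?Y}"
        by (rule ideal_at_generator[OF regular_at_mult[OF tau_reg fg(1)]])
          (intro CollectI exI[of _ \<tau>] exI[of _ f] conjI refl tau f)
      moreover have "(\<lambda>Q. g Q * h Q) \<in> ideal_at X P {h}"
        using fg(2) h_reg by (intro germ_ideal_mult[OF I] ideal_at_generator) auto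
      moreover have "\<forall>\<^sub>F Q in near X P. y Q = g Q * h Q + \<tau> Q * f Q"
        using fg(3) by eventually_elim (simp add: algebra_simps)
      ultimately show "\<exists>n\<in>ideal_at X P {h}.
          \<exists>z\<in>ideal_at X P {(\<lambda>Q. f Q * g Q) | f g. f \<in> max_ideal X P \<and> g \<in> ideal_at X P ?Y}.
          \<forall>\<^sub>F Q in near X P. y Q = n Q + z Q"
        by (intro bexI[of _ "\<lambda>Q. g Q * h Q"] bexI[of _ "\<lambda>Q. \<tau> Q * f Q"])
    qed (use Y_van in \<open>auto simp: vanishing_ideal_def\<close>)
    with Y show "vanishing_ideal X curve P \<subseteq> ideal_at X P {h}" by simp
    show "ideal_at X P {h} \<subseteq> vanishing_ideal X curve P"
      using h_van by (intro ideal_at_least[OF van]) simp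
  qed
  \<comment> \<open>If \<open>h\<close> were the zero germ, \<open>\<tau>\<close> alone would
    generate the maximal ideal, with \<open>e\<close> and \<open>e'\<close> its multiples by
    \<open>x\<close> and \<open>x'\<close>. The combination \<open>x' P * e - x P * e'\<close> then
    lies in the square; independence gives \<open>x P = 0\<close>, which puts \<open>e\<close>
    itself into the square.\<close>
  have "nonzero_rational X h"
  proof (rule nonzero_rational_regularI[OF h_reg], rule notI)
    assume h0: "\<forall>\<^sub>F Q in near X P. h Q = 0"
    have mult: "\<exists>x. regular_at X P x \<and> (\<forall>\<^sub>F Q in near X P. f Q = x Q * \<tau> Q)" if f: "f \<in> max_ideal X P" for f
    proof -
      have "f \<in> ideal_at X P {\<tau>, h}" using f max_eq N_def by simp
      then obtain x y where xy: "regular_at X P x" "\<forall>\<^sub>F Q in near X P. f Q = x Q * \<tau> Q + y Q * h Q"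
        using P(1) by (rule ideal_at_pairE)
      from xy(2) h0 have "\<forall>\<^sub>F Q in near X P. f Q = x Q * \<tau> Q"
        by eventually_elim simp
      with xy(1) show ?thesis by (intro exI conjI)
    qed
    obtain x where x: "regular_at X P x" "\<forall>\<^sub>F Q in near X P. e Q = x Q * \<tau> Q" using mult[OF em(1)] by blast
    obtain x' where x': "regular_at X P x'" "\<forall>\<^sub>F Q in near X P. e' Q = x' Q * \<tau> Q" using mult[OF em(2)] by blast
    have sq: "(\<lambda>Q. y Q * \<tau> Q) \<in> max_ideal_sq X P" if "y \<in> max_ideal X P" for y
      using that tau by (intro ideal_at_generator regular_at_mult tau_reg) (auto simp: max_ideal_def)
    have "(\<lambda>Q. x' P * x Q - x P * x' Q) \<in> max_ideal X P"
      using x(1) x'(1) const by (auto simp: max_ideal_def intro!: regular_at_diff regular_at_mult)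
    from sq[OF this] have "(\<lambda>Q. x' P * e Q - x P * e' Q) \<in> max_ideal_sq X P"
    proof (rule germ_ideal_cong[OF I])
      show "\<forall>\<^sub>F Q in near X P. x' P * e Q - x P * e' Q = (x' P * x Q - x P * x' Q) * \<tau> Q"
        using x(2) x'(2) by eventually_elim (simp add: algebra_simps)
    qed
    then have "(if g = e then x' P else - x P) = 0" if "g \<in> B" for g
      using that e' by (intro B(5)[rule_format]) simp
    from this[of e'] have "x P = 0" using e' by auto
    then have "x \<in> max_ideal X P" using x(1) by (simp add: max_ideal_def)
    from germ_ideal_cong[OF I sq[OF this] x(2)] have "(if g = e then 1 else 0) = (0::'k)" if "g \<in> B" for g
      using that e' by (intro B(5)[rule_format]) simp
    from this[of e] show False using e(1) by simp
  qed
  with max_eq van_eq h_reg show thesis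
    by (intro that[of h]) (simp_all add: N_def P_def \<tau>_def [abs_def])
qed

end

section \<open>Effective divisors of the section and of a fiber\<close>

context sectioned_surface
begin

abbreviation section_divisor :: "('k, 'n) divisor" where
  "section_divisor \<equiv> ideal_divisor X curve"

text \<open>The finitely many relations \<open>y i = a i * h\<close> persist at all points near
  \<open>P\<close>. On the curve they make \<open>h\<close> a generator of its ideal; off the curve
  some \<open>y i\<close> is nonzero, so \<open>h\<close> is a unit.\<close>

lemma section_divisor_near:
  assumes "P \<in> curve" "regular_at X P h" "nonzero_rational X h" "vanishing_ideal X curve P = ideal_at X P {h}"
  shows "\<forall>\<^sub>F Q in near X P. section_divisor Q = unit_coset X Q h"
proof -
  have P: "P \<in> X" "retract P = P" using assms(1) curve_subset curve_iff by blast+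
  obtain v k where v: "v \<in> P" "v $ k \<noteq> 0"
    using P(1) subset by (meson representative_coordinate subsetD)
  define y where "y i Q = affine_coord k i Q - affine_coord k i (retract Q)" for i Q
  have "\<exists>a. regular_at X P a \<and> (\<forall>\<^sub>F Q in near X P. y i Q = a Q * h Q)" for i
  proof -
    have "regular_at X P (y i)"
      unfolding y_def [abs_def] using regular_at_affine_coord[OF P(1) v] P
      by (intro regular_at_diff retract_regular) simp_all
    then have "y i \<in> ideal_at X P (range (\<lambda>i Q. affine_coord k i Q - affine_coord k i (retract Q)))"
      by (rule ideal_at_generator) (auto simp: y_def [abs_def])
    then have "y i \<in> ideal_at X P {h}" using vanishing_ideal_curve[OF assms(1) v] assms(4) by simp
    from this P(1) show ?thesis by (rule ideal_at_singletonE) (intro exI conjI)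
  qed
  then obtain a where a: "\<And>i. regular_at X P (a i)" "\<And>i. \<forall>\<^sub>F Q in near X P. y i Q = a i Q * h Q"
    by metis
  have "h \<in> vanishing_ideal X curve P"
    using ideal_at_generator[OF assms(2), of "{h}"] assms(4) by simp
  then have h_van: "\<forall>\<^sub>F Q in near X P. Q \<in> curve \<longrightarrow> h Q = 0"
    by (simp add: vanishing_ideal_def)
  have coord: "\<forall>\<^sub>F Q in near X P. \<forall>v\<in>Q. v $ k \<noteq> 0"
    using eventually_nonvanishing[OF form_coordinate P(1) v] .
  have coord': "\<forall>\<^sub>F Q in near X P. \<forall>v\<in>retract Q. v $ k \<noteq> 0"
    using morphism_near[OF retract_morphism subset subset P(1)] coord P(2) by simp
  have "\<forall>\<^sub>F Q in near X P. \<forall>i. regular_at X Q (a i) \<and> (\<forall>\<^sub>F R in near X Q. y i R = a i R * h R)"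
    using regular_at_near[OF a(1)] eventually_near_near[OF P(1) a(2)]
    by (intro eventually_all_finite eventually_conj)
  then show ?thesis
    using eventually_near_near[OF P(1) h_van] coord coord' regular_at_near[OF assms(2)] eventually_near_mem[OF P(1)]
  proof eventually_elim
    case (elim Q)
    note Q = \<open>Q \<in> X\<close> and I = germ_ideal_ideal_at[OF \<open>Q \<in> X\<close>]
    obtain u where u: "u \<in> Q" using Q subset representative_exists by blast
    obtain w where w: "w \<in> retract Q" using retract_mem[OF Q] subset representative_exists by blast
    have uk: "u $ k \<noteq> 0" and wk: "w $ k \<noteq> 0" using elim(3,4) u w by auto
    have "ideal_at X Q {h} = vanishing_ideal X curve Q"
    proof
      show "ideal_at X Q {h} \<subseteq> vanishing_ideal X curve Q"
        using elim by (intro ideal_at_least germ_ideal_vanishing) (auto simp: vanishing_ideal_def)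
      show "vanishing_ideal X curve Q \<subseteq> ideal_at X Q {h}"
      proof (cases "Q \<in> curve")
        case True
        have "y i \<in> ideal_at X Q {h}" for i
        proof (rule germ_ideal_cong[OF I])
          show "(\<lambda>R. a i R * h R) \<in> ideal_at X Q {h}"
            using elim(1,5) by (intro germ_ideal_mult[OF I] ideal_at_generator) auto
          show "\<forall>\<^sub>F R in near X Q. y i R = a i R * h R" using elim(1) by simp
        qed
        then have "ideal_at X Q (range y) \<subseteq> ideal_at X Q {h}"
          by (intro ideal_at_least[OF I]) auto
        then show ?thesis
          using vanishing_ideal_curve[OF True u uk] by (simp add: y_def [abs_def])
      next
        case False
        then obtain i where "y i Q \<noteq> 0"
          unfolding y_def using curve_generators_detect[OF Q _ u uk w wk] by blast
        moreover have "y i Q = a i Q * h Q"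
          using elim(1) eventually_near_self[OF Q, of "\<lambda>R. y i R = a i R * h R"] by simp
        ultimately have "h Q \<noteq> 0" by auto
        then show ?thesis
          using ideal_at_unit[OF elim(5)] by (auto simp: vanishing_ideal_def)
      qed
    qed
    then show ?case by (rule ideal_divisor_eq[OF elim(5) assms(3)])
  qed
qed

lemma section_divisor_local_equation:
  assumes "P \<in> X"
  obtains h where "regular_at X P h" "nonzero_rational X h" "\<forall>\<^sub>F Q in near X P. section_divisor Q = unit_coset X Q h"
    "h P = 0 \<longleftrightarrow> P \<in> curve"
proof (cases "P \<in> curve")
  case True
  then obtain a where a: "a \<in> proj_line" "P = s a" by blast
  from a(1) obtain t where t: "local_parameter a t" by (rule proj_line_parameter)
  from a(1) t obtain h where h: "vanishing_ideal X curve P = ideal_at X P {h}" "regular_at X P h" "nonzero_rational X h"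
    unfolding a(2) by (rule local_equation)
  have "h \<in> vanishing_ideal X curve P"
    using ideal_at_generator[OF h(2), of "{h}"] h(1) by simp
  then have "\<forall>\<^sub>F Q in near X P. Q \<in> curve \<longrightarrow> h Q = 0"
    by (simp add: vanishing_ideal_def)
  then have "h P = 0" using eventually_near_self[OF assms] True by blast
  with True section_divisor_near[OF True h(2,3,1)] h(2,3) show thesis by (intro that[of h]) simp_all
next
  case False
  note out = curve_closed[OF assms False]
  have "\<forall>\<^sub>F Q in near X P. section_divisor Q = unit_coset X Q (\<lambda>_. 1)"
    using eventually_near_near[OF assms out] eventually_near_mem[OF assms]
    by eventually_elim (rule ideal_divisor_outside)
  then show thesis
    using that[of "\<lambda>_. 1"] False assms by (simp add: regular_at_const nonzero_rational_one)
qed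

lemma effectiveI:
  assumes "\<And>P. P \<notin> X \<Longrightarrow> D P = {}"
    and "\<And>P. P \<in> X \<Longrightarrow> \<exists>h. regular_at X P h \<and> nonzero_rational X h \<and> (\<forall>\<^sub>F Q in near X P. D Q = unit_coset X Q h)"
  shows "effective X D"
  unfolding effective_def divisors_def
proof (intro conjI CollectI allI impI ballI)
  fix P assume P: "P \<in> X"
  from assms(2)[OF P] obtain h where
    h: "regular_at X P h" "nonzero_rational X h" "\<forall>\<^sub>F Q in near X P. D Q = unit_coset X Q h"
    by blast
  show "\<exists>U f. openin (ztop X) U \<and> P \<in> U \<and> nonzero_rational X f \<and> (\<forall>Q\<in>U. D Q = unit_coset X Q f)"
    using h(2,3) unfolding eventually_near[OF P] by blast
  have "D P = unit_coset X P h" using h(3) by (rule eventually_near_self[OF P])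
  then show "\<exists>f\<in>D P. regular_at X P f"
    using unit_coset_self[OF h(2) P] h(1) by auto
qed (rule assms(1))

lemma effective_section_divisor: "effective X section_divisor"
proof (rule effectiveI)
  fix P assume "P \<in> X"
  then show "\<exists>h. regular_at X P h \<and> nonzero_rational X h \<and> (\<forall>\<^sub>F Q in near X P. section_divisor Q = unit_coset X Q h)"
    by (rule section_divisor_local_equation) blast
qed (simp add: ideal_divisor_def)

text \<open>The section provides a point in the fiber over some \<open>b\<close> different from
  \<open>a\<close>, where the pulled-back function has the nonzero value \<open>t b\<close>.\<close>

lemma fiber_equation_nonzero:
  assumes "a \<in> proj_line" "openin (ztop proj_line) U" "a \<in> U" "regular_on proj_line U t"
    "\<And>b. b \<in> U \<Longrightarrow> t b = 0 \<longleftrightarrow> b = a"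
  shows "nonzero_rational X (\<lambda>Q. t (\<phi> Q))"
proof -
  have "\<forall>\<^sub>F b in near proj_line a. b \<in> U"
    using assms(2,3) by (rule projective.eventually_near_open)
  then obtain b where b: "b \<in> proj_line" "b \<noteq> a" "b \<in> U"
    using proj_line_not_isolated[OF assms(1)] by blast
  have reg: "regular_at X (s b) (\<lambda>Q. t (\<phi> Q))"
    using assms(4) b by (intro phi_regular sec_mem) (simp_all add: phi_sec regular_on_def)
  have "t b \<noteq> 0" using assms(5)[OF b(3)] b(2) by simp
  then have "\<not> (\<forall>\<^sub>F Q in near X (s b). t (\<phi> Q) = 0)"
    using eventually_near_self[OF sec_mem[OF b(1)], of "\<lambda>Q. t (\<phi> Q) = 0"] phi_sec[OF b(1)] by auto
  with reg show ?thesis by (rule nonzero_rational_regularI)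
qed

text \<open>Two parameters at \<open>a\<close> differ by a unit, whose pullback is a unit at
  \<open>P\<close>, so all cosets in the union coincide.\<close>

lemma fiber_divisor_eq:
  assumes "P \<in> X" "\<phi> P = a" "local_parameter a t"
  shows "fiber_divisor X \<phi> a P = unit_coset X P (\<lambda>Q. t (\<phi> Q))"
proof -
  have eq: "unit_coset X P (t' \<circ> \<phi>) = unit_coset X P (\<lambda>Q. t (\<phi> Q))" if "local_parameter a t'" for t'
  proof -
    from assms(3) that obtain u where u: "regular_at proj_line a u" "u a \<noteq> 0"
      "\<forall>\<^sub>F b in near proj_line a. t' b = u b * t b"
      by (rule local_parameter_unit)
    have "\<forall>\<^sub>F Q in near X P. t' (\<phi> Q) = u (\<phi> Q) * t (\<phi> Q)"
      using u(3) assms(2) by (intro phi_near[OF assms(1)]) simp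
    from near_imp_generically[OF assms(1) this]
    have "generically X (\<lambda>Q. (t' \<circ> \<phi>) Q = u (\<phi> Q) * t (\<phi> Q))" by simp
    moreover have "regular_at X P (\<lambda>Q. u (\<phi> Q))" using phi_regular[OF assms(1)] u(1) assms(2) by simp
    ultimately show ?thesis using u(2) assms(2) by (intro unit_coset_eq[where u = "\<lambda>Q. u (\<phi> Q)"]) simp_all
  qed
  have "(\<Union>t' \<in> {t'. local_parameter a t'}. unit_coset X P (t' \<circ> \<phi>)) = unit_coset X P (\<lambda>Q. t (\<phi> Q))"
  proof (rule SUP_eq_const)
    have "t \<in> {t'. local_parameter a t'}" using assms(3) by simp
    then show "{t'. local_parameter a t'} \<noteq> {}" by blast
  qed (use eq in simp)
  then show ?thesis using assms(1,2) by (simp add: fiber_divisor_def)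
qed

lemma fiber_divisor_outside:
  "P \<in> X \<Longrightarrow> \<phi> P \<noteq> a \<Longrightarrow> fiber_divisor X \<phi> a P = unit_coset X P (\<lambda>_. 1)"
  by (simp add: fiber_divisor_def)

lemma effective_fiber_divisor:
  assumes "a \<in> proj_line"
  shows "effective X (fiber_divisor X \<phi> a)"
proof (rule effectiveI)
  fix P assume P: "P \<in> X"
  obtain t U where t: "openin (ztop proj_line) U" "a \<in> U" "regular_on proj_line U t"
    "\<And>b. b \<in> U \<Longrightarrow> t b = 0 \<longleftrightarrow> b = a" "local_parameter a t"
    using assms by (rule proj_line_parameter) blast
  show "\<exists>h. regular_at X P h \<and> nonzero_rational X h \<and> (\<forall>\<^sub>F Q in near X P. fiber_divisor X \<phi> a Q = unit_coset X Q h)"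
  proof (cases "\<phi> P = a")
    case True
    have "\<forall>\<^sub>F b in near proj_line (\<phi> P). b \<in> U"
      using t(1,2) True by (intro projective.eventually_near_open) auto
    from phi_near[OF P this] eventually_near_mem[OF P]
    have "\<forall>\<^sub>F Q in near X P. fiber_divisor X \<phi> a Q = unit_coset X Q (\<lambda>Q. t (\<phi> Q))"
    proof eventually_elim
      case (elim Q)
      show ?case
      proof (cases "\<phi> Q = a")
        case False
        have "regular_at X Q (\<lambda>Q. t (\<phi> Q))"
          using t(3) elim by (intro phi_regular) (simp_all add: regular_on_def)
        moreover have "t (\<phi> Q) \<noteq> 0" using t(4)[OF elim(1)] False by simp
        ultimately have "unit_coset X Q (\<lambda>Q. t (\<phi> Q)) = unit_coset X Q (\<lambda>_. 1)"
          by (rule unit_coset_unit)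
        then show ?thesis using fiber_divisor_outside[OF elim(2) False] by simp
      qed (rule fiber_divisor_eq[OF elim(2) _ t(5)])
    qed
    moreover have "regular_at X P (\<lambda>Q. t (\<phi> Q))"
      using t(2,3) True by (intro phi_regular[OF P]) (simp add: regular_on_def)
    moreover have "nonzero_rational X (\<lambda>Q. t (\<phi> Q))"
      using assms t(1-4) by (rule fiber_equation_nonzero)
    ultimately show ?thesis by blast
  next
    case False
    obtain t' U' where t': "openin (ztop proj_line) U'" "\<phi> P \<in> U'" "regular_on proj_line U' t'"
      "\<And>b. b \<in> U' \<Longrightarrow> t' b = 0 \<longleftrightarrow> b = \<phi> P" "local_parameter (\<phi> P) t'"
      using phi_mem[OF P] by (rule proj_line_parameter) blast
    have "\<forall>\<^sub>F b in near proj_line (\<phi> P). b \<noteq> a"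
    proof (cases "a \<in> U'")
      case True
      \<comment> \<open>This separates the two points of the line: \<open>d\<close> is nonzero at
        \<open>\<phi> P\<close> and vanishes at \<open>a\<close>.\<close>
      define d where "d b = t' b - t' a" for b
      have "regular_at proj_line (\<phi> P) d"
        using t'(2,3) phi_mem[OF P] unfolding d_def [abs_def] regular_on_def
        by (intro projective.regular_at_diff projective.regular_at_const) simp_all
      moreover have "d (\<phi> P) \<noteq> 0"
        using t'(4)[OF t'(2)] t'(4)[OF True] False by (simp add: d_def)
      ultimately have "\<forall>\<^sub>F b in near proj_line (\<phi> P). d b \<noteq> 0" by (rule projective.regular_at_nonzero)
      then show ?thesis by (rule eventually_mono) (auto simp: d_def)
    next
      assume "a \<notin> U'"
      with projective.eventually_near_open[OF t'(1,2)] show ?thesis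
        by (auto elim: eventually_mono)
    qed
    from phi_near[OF P this] eventually_near_mem[OF P]
    have "\<forall>\<^sub>F Q in near X P. fiber_divisor X \<phi> a Q = unit_coset X Q (\<lambda>_. 1)"
      by eventually_elim (rule fiber_divisor_outside)
    then show ?thesis using P regular_at_const nonzero_rational_one by blast
  qed
qed (simp add: fiber_divisor_def)

section \<open>Transversal intersection of fiber and section\<close>

lemma supports_meet:
  assumes "a \<in> proj_line"
  shows "support X (fiber_divisor X \<phi> a) \<inter> support X section_divisor = {s a}"
proof
  from assms obtain t where t: "local_parameter a t" by (rule proj_line_parameter)
  have one: "\<exists>f\<in>unit_coset X Q (\<lambda>_. 1). regular_at X Q f \<and> f Q \<noteq> 0" if "Q \<in> X" for Q
    using unit_coset_self[OF nonzero_rational_one that] that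
    by (intro bexI[of _ "\<lambda>_. 1"]) (auto intro: regular_at_const)
  show "support X (fiber_divisor X \<phi> a) \<inter> support X section_divisor \<subseteq> {s a}"
  proof
    fix Q assume "Q \<in> support X (fiber_divisor X \<phi> a) \<inter> support X section_divisor"
    then have Q: "Q \<in> X" "\<not> (\<exists>f\<in>fiber_divisor X \<phi> a Q. regular_at X Q f \<and> f Q \<noteq> 0)"
      "\<not> (\<exists>f\<in>section_divisor Q. regular_at X Q f \<and> f Q \<noteq> 0)"
      by (auto simp: support_def)
    \<comment> \<open>Off the fiber, and likewise off the curve, the constant 1 is a local equation
      of the divisor in question, so the supports are contained in these sets.\<close>
    have "\<phi> Q = a" using Q(1,2) fiber_divisor_outside one by metis
    moreover have "Q \<in> curve"
      using Q(1,3) ideal_divisor_outside[OF Q(1) curve_closed[OF Q(1)]] one by metis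
    ultimately show "Q \<in> {s a}" using curve_iff[OF Q(1)] by auto
  qed
  define P where "P = s a"
  have P: "P \<in> X" "P \<in> curve" "\<phi> P = a" using assms sec_mem phi_sec by (auto simp: P_def)
  have "f P = 0" if f: "f \<in> unit_coset X P h" "regular_at X P f" and h: "regular_at X P h" "h P = 0" for f h
  proof -
    from f(1) h(1) f(2) obtain u where "\<forall>\<^sub>F Q in near X P. f Q = u Q * h Q"
      by (rule unit_coset_regularE)
    then have "f P = u P * h P" by (rule eventually_near_self[OF P(1)])
    then show ?thesis using h(2) by simp
  qed
  moreover have "regular_at X P (\<lambda>Q. t (\<phi> Q))" "t (\<phi> P) = 0"
    using t P(3) by (auto intro!: phi_regular[OF P(1)] simp: local_parameter_def max_ideal_def)
  moreover obtain h where h: "regular_at X P h" "\<forall>\<^sub>F Q in near X P. section_divisor Q = unit_coset X Q h"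
    "h P = 0 \<longleftrightarrow> P \<in> curve"
    using P(1) by (rule section_divisor_local_equation) blast
  moreover have "section_divisor P = unit_coset X P h"
    using h(2) by (rule eventually_near_self[OF P(1)])
  ultimately have "P \<in> support X (fiber_divisor X \<phi> a)" "P \<in> support X section_divisor"
    using P fiber_divisor_eq[OF P(1,3) t] unfolding support_def by auto
  then show "{s a} \<subseteq> support X (fiber_divisor X \<phi> a) \<inter> support X section_divisor"
    by (simp add: P_def)
qed

text \<open>Any regular local equations of the two divisors at the point differ from
  \<open>\<tau>\<close> and \<open>h\<close> by units, so together they generate the maximal ideal,
  and the quotient has dimension 1 for every choice. This is the uniqueness that the definite
  description requires.\<close>

lemma local_intersection_section:
  assumes "a \<in> proj_line"
  shows "local_intersection X (fiber_divisor X \<phi> a) section_divisor (s a) = 1"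
proof -
  from assms obtain t where t: "local_parameter a t" by (rule proj_line_parameter)
  define P where "P = s a"
  have P: "P \<in> X" "P \<in> curve" "\<phi> P = a" using assms sec_mem phi_sec by (auto simp: P_def)
  define \<tau> where "\<tau> Q = t (\<phi> Q)" for Q
  from assms t obtain h where h: "max_ideal X P = ideal_at X P {\<tau>, h}"
    "vanishing_ideal X curve P = ideal_at X P {h}" "regular_at X P h" "nonzero_rational X h"
    unfolding P_def \<tau>_def [abs_def] by (rule local_equation)
  have tau: "regular_at X P \<tau>"
    using t P(3) by (auto intro!: phi_regular[OF P(1)] simp: \<tau>_def [abs_def] local_parameter_def max_ideal_def)
  have F: "fiber_divisor X \<phi> a P = unit_coset X P \<tau>"
    using fiber_divisor_eq[OF P(1,3) t] by (simp add: \<tau>_def [abs_def])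
  have Z: "section_divisor P = unit_coset X P h"
    by (rule ideal_divisor_eq[OF h(3,4) h(2)[symmetric]])
  have ideal: "ideal_at X P {f, g} = max_ideal X P"
    if "f \<in> unit_coset X P \<tau>" "g \<in> unit_coset X P h" "regular_at X P f" "regular_at X P g" for f g
  proof -
    from that(1) tau that(3) obtain u where u: "regular_at X P u" "u P \<noteq> 0" "\<forall>\<^sub>F Q in near X P. f Q = u Q * \<tau> Q"
      by (rule unit_coset_regularE)
    from that(2) h(3) that(4) obtain w where w: "regular_at X P w" "w P \<noteq> 0" "\<forall>\<^sub>F Q in near X P. g Q = w Q * h Q"
      by (rule unit_coset_regularE)
    from ideal_at_pair_associated[OF tau h(3) u(1,2) w(1,2) u(3) w(3)] h(1) show ?thesis by simp
  qed
  obtain f g where "f \<in> unit_coset X P \<tau>" "regular_at X P f" "g \<in> unit_coset X P h" "regular_at X P g"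
    using effective_fiber_divisor[OF assms] effective_section_divisor P(1) F Z
    unfolding effective_def by metis
  then have "(\<exists>f\<in>unit_coset X P \<tau>. \<exists>g\<in>unit_coset X P h. regular_at X P f \<and> regular_at X P g \<and>
      quotient_dim {h. regular_at X P h} (ideal_at X P {f, g}) n) \<longleftrightarrow> n = 1" for n
    using quotient_dim_max_ideal[OF P(1)] ideal by metis
  then show ?thesis
    unfolding local_intersection_def P_def[symmetric] F Z by simp
qed

theorem fiber_section_intersection:
  assumes "intersection_pairing X I" "a \<in> proj_line"
  shows "I (fiber_divisor X \<phi> a) section_divisor = 1"
proof -
  have "I D E = (\<Sum>P \<in> support X D \<inter> support X E. int (local_intersection X D E P))"
    if "effective X D" "effective X E" "finite (support X D \<inter> support X E)" for D E
    using assms(1) that unfolding intersection_pairing_def by blast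
  from this[OF effective_fiber_divisor[OF assms(2)] effective_section_divisor]
  show ?thesis
    by (simp add: supports_meet[OF assms(2)] local_intersection_section[OF assms(2)])
qed

end

section \<open>Fiber classes in the canonical correspondence\<close>

text \<open>The correspondence may select other members of the two classes, for which no section is
  given. What survives the change of representative is the existence of a lattice vector pairing to
  1.\<close>

lemma isometry_transports_unit_pairing:
  assumes "g \<in> isometries S b" "f \<in> S" "\<exists>z\<in>S. b f z = 1"
  shows "g f \<in> S" "\<exists>z\<in>S. b (g f) z = 1"
proof -
  have g: "g ` S = S" "\<And>x y. b (g x) (g y) = b x y"
    using assms(1) by (auto simp: isometries_def)
  then show "g f \<in> S" using assms(2) by blast
  from assms(3) obtain z where "z \<in> S" "b f z = 1" by blast
  then show "\<exists>z\<in>S. b (g f) z = 1" using g by (metis imageI)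
qed

lemma neron_severi_pairing:
  assumes "neron_severi_lattice X I S b cl" "intersection_pairing X I" "x \<in> S" "y \<in> S"
  shows "b x y \<in> \<int>" "b x y = b y x"
proof -
  from assms(1,3,4) obtain D E where DE: "D \<in> divisors X" "x = cl D" "E \<in> divisors X" "y = cl E"
    unfolding neron_severi_lattice_def by blast
  then have "b x y = of_int (I D E)" "b y x = of_int (I E D)"
    using assms(1) unfolding neron_severi_lattice_def by blast+
  moreover have "I D E = I E D"
    using assms(2) DE unfolding intersection_pairing_def by blast
  ultimately show "b x y \<in> \<int>" "b x y = b y x" by simp_all
qed

lemma section_fiber_class:
  assumes "supersingular_K3 p \<sigma> X I S b cl" "genus_one_fibration X \<phi>" "admits_section X \<phi>"
  shows "fiber_class X cl \<phi> \<in> S" "\<exists>z\<in>S. b (fiber_class X cl \<phi>) z = 1"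
proof -
  from assms(3) obtain s where s: "morphism proj_line X s" "\<And>a. a \<in> proj_line \<Longrightarrow> \<phi> (s a) = a"
    unfolding admits_section_def by blast
  have X: "nonsingular_surface X" and I: "intersection_pairing X I" and cl: "neron_severi_lattice X I S b cl"
    using assms(1) by (auto simp: supersingular_K3_def K3_surface_def)
  interpret sectioned_surface X \<phi> s
    using X s assms(2) by unfold_locales (auto simp: nonsingular_surface_def genus_one_fibration_def)
  define a :: "('a, 2) ppoint" where "a = (SOME a. a \<in> proj_line)"
  have "\<exists>a :: ('a, 2) ppoint. a \<in> proj_line"
    unfolding proj_space_def by (auto intro!: exI[of _ "axis 1 1"] simp: axis_eq_0_iff)
  then have a: "a \<in> proj_line" unfolding a_def by (rule someI_ex)
  have F: "fiber_divisor X \<phi> a \<in> divisors X" and Z: "section_divisor \<in> divisors X"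
    using effective_fiber_divisor[OF a] effective_section_divisor by (auto simp: effective_def)
  have "b (cl (fiber_divisor X \<phi> a)) (cl section_divisor) = of_int (I (fiber_divisor X \<phi> a) section_divisor)"
    using cl F Z unfolding neron_severi_lattice_def by blast
  then have "b (fiber_class X cl \<phi>) (cl section_divisor) = 1"
    by (simp add: fiber_section_intersection[OF I a] fiber_class_def a_def[symmetric])
  moreover have "cl section_divisor \<in> S" and "fiber_class X cl \<phi> \<in> S"
    using cl F Z unfolding neron_severi_lattice_def fiber_class_def a_def[symmetric] by blast+
  ultimately show "fiber_class X cl \<phi> \<in> S" "\<exists>z\<in>S. b (fiber_class X cl \<phi>) z = 1" by blast+
qed

text \<open>Write \<open>u = j w\<close> with \<open>w\<close> in the dual lattice. Then \<open>f\<close> and \<open>c w\<close> have the same pairings, so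
  \<open>1/c = b w z\<close> is an integer, and \<open>b' u\<close> takes values in \<open>(p/c) b f (S\<^sup>\<or>) \<subseteq> p \<int>\<close>.\<close>

lemma canonical_embedding_unit_pairings:
  assumes "prime p" "canonical_embedding p S b S' b' j"
    and "\<And>x y. x \<in> S \<Longrightarrow> y \<in> S \<Longrightarrow> b x y \<in> \<int>"
    and "\<And>x y. x \<in> S' \<Longrightarrow> y \<in> S' \<Longrightarrow> b' x y = b' y x"
    and "f \<in> S" "z \<in> S" "b f z = 1" "u \<in> S'" "y \<in> S'" "b' u y = 1"
    and "\<And>y. y \<in> S' \<Longrightarrow> b' (j f) y = c * b' u y"
  shows False
proof -
  have bij: "bij_betw j (dual_lattice S b) S'" and
    scale: "\<And>x y. x \<in> dual_lattice S b \<Longrightarrow> y \<in> dual_lattice S b \<Longrightarrow> b' (j x) (j y) = real p * b x y"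
    using assms(2) by (auto simp: canonical_embedding_def)
  have p: "real p \<noteq> 0" using assms(1) by (simp add: prime_gt_0_nat)
  have dual: "x \<in> dual_lattice S b" if "x \<in> S" for x
    using that assms(3) by (simp add: dual_lattice_def)
  have jS': "j x \<in> S'" if "x \<in> dual_lattice S b" for x
    using bij that by (auto simp: bij_betw_def)
  obtain w where w: "w \<in> dual_lattice S b" "u = j w" using bij assms(8) by (auto simp: bij_betw_def)
  obtain x where x: "x \<in> dual_lattice S b" "y = j x" using bij assms(9) by (auto simp: bij_betw_def)
  have f: "f \<in> dual_lattice S b" and z: "z \<in> dual_lattice S b" using assms(5,6) by (auto intro: dual)
  have pair: "b f q = c * b w q" if "q \<in> dual_lattice S b" for q
  proof -
    have "real p * b f q = c * (real p * b w q)"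
      using assms(11)[OF jS'[OF that]] scale[OF f that] scale[OF w(1) that] w(2) by simp
    then show ?thesis using p by simp
  qed
  have "b w z \<in> \<int>" using w(1) assms(6) by (simp add: dual_lattice_def)
  \<comment> \<open>\<open>dual_lattice\<close> controls pairings with the dual vector in the first
    argument. The symmetry of \<open>b\<close> between \<open>f\<close> and \<open>x\<close> is
    obtained from that of \<open>b'\<close> through \<open>j\<close>.\<close>
  moreover have "b f x \<in> \<int>"
  proof -
    have "real p * b f x = real p * b x f"
      using assms(4)[OF jS'[OF f] jS'[OF x(1)]] scale[OF f x(1)] scale[OF x(1) f] by simp
    then show ?thesis using p x(1) assms(5) by (simp add: dual_lattice_def)
  qed
  \<comment> \<open>Multiply \<open>b f x = c * b w x\<close> by \<open>b w z\<close> and use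
    \<open>c * b w z = b f z = 1\<close>; this removes the rational factor \<open>c\<close>.\<close>
  moreover have "b w x = b w z * b f x"
    using pair[OF x(1)] pair[OF z] assms(7) by (simp add: mult.assoc[symmetric] mult.commute)
  ultimately obtain n :: int where "b w x = of_int n" by (metis Ints_cases Ints_mult)
  moreover have "real p * b w x = 1"
    using scale[OF w(1) x(1)] assms(10) w(2) x(2) by simp
  ultimately have "of_int (int p * n) = (1::real)" by simp
  then have "int p * n = 1" by (simp only: of_int_eq_1_iff)
  then have "int p = 1" by (metis pos_zmult_eq_1_iff prime_gt_0_nat assms(1) of_nat_0_less_iff)
  then show False using prime_gt_1_nat[OF assms(1)] by simp
qed

theorem theorem1p4:
  fixes p \<sigma> \<sigma>' :: nat
    and X :: "('k::alg_closed_field, 'n::finite) ppoint set"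
    and X' :: "('l::alg_closed_field, 'm::finite) ppoint set"
    and I :: "('k, 'n) divisor \<Rightarrow> ('k, 'n) divisor \<Rightarrow> int"
    and I' :: "('l, 'm) divisor \<Rightarrow> ('l, 'm) divisor \<Rightarrow> int"
    and S :: "'v::euclidean_space set" and b :: "'v \<Rightarrow> 'v \<Rightarrow> real"
    and S' :: "'w::euclidean_space set" and b' :: "'w \<Rightarrow> 'w \<Rightarrow> real"
    and cl :: "('k, 'n) divisor \<Rightarrow> 'v" and cl' :: "('l, 'm) divisor \<Rightarrow> 'w"
    and j :: "'v \<Rightarrow> 'w"
    and \<phi> :: "('k, 'n) ppoint \<Rightarrow> ('k, 2) ppoint"
    and \<phi>' :: "('l, 'm) ppoint \<Rightarrow> ('l, 2) ppoint"
  assumes "prime p"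
    and "supersingular_K3 p \<sigma> X I S b cl"
    and "supersingular_K3 p \<sigma>' X' I' S' b' cl'"
    and "\<sigma> + \<sigma>' = 11"
    and "canonical_embedding p S b S' b' j"
    and "genus_one_fibration X \<phi>"
    and "genus_one_fibration X' \<phi>'"
    and "admits_section X \<phi>"
    and "classes_correspond X cl X' S' b' cl' j
           (fibration_class X S b cl \<phi>) (fibration_class X' S' b' cl' \<phi>')"
  shows "\<not> admits_section X' \<phi>'"
proof
  assume sec': "admits_section X' \<phi>'"
  have lattice: "neron_severi_lattice X I S b cl" "intersection_pairing X I"
    and lattice': "neron_severi_lattice X' I' S' b' cl'" "intersection_pairing X' I'"
    using assms(2,3) by (auto simp: supersingular_K3_def)
  then have bilinear: "bilinear b'" by (simp add: neron_severi_lattice_def)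
  from assms(9) obtain \<psi> \<psi>' g c where
    psi: "\<psi> \<in> fibration_class X S b cl \<phi>" "\<psi>' \<in> fibration_class X' S' b' cl' \<phi>'"
    and g: "g \<in> isometries S' b'" "g (j (fiber_class X cl \<psi>)) = c *\<^sub>R fiber_class X' cl' \<psi>'"
    unfolding classes_correspond_def by blast
  obtain h where h: "h \<in> isometries S b" "h (fiber_class X cl \<phi>) = fiber_class X cl \<psi>"
    using psi(1) unfolding fibration_class_def lattice_equivalent_def positive_isometries_def by blast
  note f = isometry_transports_unit_pairing[OF h(1) section_fiber_class(1,2)[OF assms(2,6,8)], unfolded h(2)]
  obtain z where z: "z \<in> S" "b (fiber_class X cl \<psi>) z = 1" using f(2) by blast
  obtain h' where h': "h' \<in> isometries S' b'" "h' (fiber_class X' cl' \<phi>') = fiber_class X' cl' \<psi>'"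
    using psi(2) unfolding fibration_class_def lattice_equivalent_def positive_isometries_def by blast
  note f' = isometry_transports_unit_pairing[OF h'(1) section_fiber_class(1,2)[OF assms(3,7) sec'], unfolded h'(2)]
  obtain z' where z': "z' \<in> S'" "b' (fiber_class X' cl' \<psi>') z' = 1" using f'(2) by blast
  have iso: "g ` S' = S'" "\<And>x y. b' (g x) (g y) = b' x y"
    using g(1) by (auto simp: isometries_def)
  \<comment> \<open>The isometry \<open>g\<close> is moved to the side of \<open>\<psi>'\<close>:
    its fiber class, and then the vector pairing to 1 with it, are replaced by preimages under
    \<open>g\<close>.\<close>
  obtain u where u: "u \<in> S'" "fiber_class X' cl' \<psi>' = g u" using f'(1) iso(1) by blast
  obtain y where y: "y \<in> S'" "z' = g y" using z'(1) iso(1) by blast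
  have "b' u y = 1" using z'(2) u(2) y(2) iso(2) by simp
  moreover have "b' (j (fiber_class X cl \<psi>)) q = c * b' u q" for q
  proof -
    have "b' (j (fiber_class X cl \<psi>)) q = b' (c *\<^sub>R g u) (g q)"
      using iso(2)[of "j (fiber_class X cl \<psi>)" q] g(2) u(2) by simp
    also have "\<dots> = c * b' u q"
      using bilinear_lmul[OF bilinear, of c "g u" "g q"] iso(2) by simp
    finally show ?thesis .
  qed
  ultimately show False
    using canonical_embedding_unit_pairings[OF assms(1,5) neron_severi_pairing(1)[OF lattice]
        neron_severi_pairing(2)[OF lattice'] f(1) z u(1) y(1)]
    by blast
qed

end
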